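(* Let $M$ be a monoid, $\Gamma : \mathbf{PSh}(M) \to \mathbf{Set}$ the global sections functor, $C : \mathbf{PSh}(M) \to \mathbf{Set}$ the connected components functor, and $\alpha : \Gamma \to C$ the canonical natural transformation. The following are equivalent: (1) $M$ has a right absorbing element. (2) $\Gamma$ preserves epimorphisms, i.e. the terminal right $M$-set $1$ is projective. (3) $\Gamma$ has a right adjoint; that is, $\mathbf{PSh}(M)$ is local over $\mathbf{Set}$. (4) $\alpha : \Gamma \to C$ is epic; that is, $\mathbf{PSh}(M)$ is punctually locally connected (equivalently, pre-cohesive). (5) $C$ is full. (6) $\Gamma$ reflects the initial object, i.e. every non-empty right $M$-set has a fixed point. (7) The category of points of $\mathbf{PSh}(M)$ has an initial object.
   Context: For a monoid $M$, $\mathbf{PSh}(M)$ denotes the category of right $M$-sets (the empty one included) and $M$-equivariant maps. $\Delta : \mathbf{Set} \to \mathbf{PSh}(M)$ sends a set to itself with trivial action. Its right adjoint $\Gamma$ sends $X$ to the set of fixed points $\{x \in X : xm = x \ \forall m \in M\} \cong \mathrm{Hom}_{\mathbf{PSh}(M)}(1,X)$; its left adjoint $C$ sends $X$ to the quotient of $X$ by the equivalence relation generated by $x \sim xm$ ($x \in X$, $m \in M$). The adjunction $(\Delta \dashv \Gamma)$ is the global sections geometric morphism. The natural transformation $\alpha : \Gamma \to C$ sends a fixed point of $X$ to the connected component of $X$ containing it. An element $r \in M$ is right absorbing if $rn = r$ for all $n \in M$. A right $M$-set $B$ is projective if $\mathrm{Hom}_{\mathbf{PSh}(M)}(B,-)$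 preserves epimorphisms. A Grothendieck topos is local if its global sections functor has a right adjoint. A connected, locally connected Grothendieck topos is punctually locally connected if the canonical transformation $\alpha$ from its global sections functor to its connected components functor is epic; its global sections geometric morphism $f$ is pre-cohesive if it is local, hyperconnected and essential with $f_!$ preserving finite products. The category of points of $\mathbf{PSh}(M)$ has as objects the geometric morphisms $\mathbf{Set} \to \mathbf{PSh}(M)$ and as morphisms the natural transformations between inverse image functors; it is equivalent to the category of flat left $M$-sets (those $B$ for which $-\otimes_M B : \mathbf{PSh}(M) \to \mathbf{Set}$ preserves finite limits) and left $M$-set homomorphisms. *)

theory Defs
  imports "HOL-Algebra.Group" "HOL-Library.FuncSet" "HOL-Library.Equipollence"
begin

section \<open>Categories, functors, natural transformations\<close>

record ('o, 'a) category =
  Ob :: "'o set"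
  Mor :: "'a set"
  src :: "'a \<Rightarrow> 'o"
  tgt :: "'a \<Rightarrow> 'o"
  ident :: "'o \<Rightarrow> 'a"
  cmp :: "'a \<Rightarrow> 'a \<Rightarrow> 'a"  \<comment> \<open>\<open>cmp C g f\<close> is \<open>g\<close> after \<open>f\<close>\<close>

definition Hom :: "('o, 'a) category \<Rightarrow> 'o \<Rightarrow> 'o \<Rightarrow> 'a set" where
  "Hom C a b = {f \<in> Mor C. src C f = a \<and> tgt C f = b}"

definition is_category :: "('o, 'a) category \<Rightarrow> bool" where
  "is_category C \<longleftrightarrow>
     (\<forall>f\<in>Mor C. src C f \<in> Ob C \<and> tgt C f \<in> Ob C) \<and>
     (\<forall>a\<in>Ob C. ident C a \<in> Hom C a a) \<and>
     (\<forall>f\<in>Mor C. \<forall>g\<in>Mor C. tgt C f = src C g \<longrightarrow> cmp C g f \<in> Hom C (src C f) (tgt C g)) \<and>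
     (\<forall>f\<in>Mor C. cmp C f (ident C (src C f)) = f \<and> cmp C (ident C (tgt C f)) f = f) \<and>
     (\<forall>f\<in>Mor C. \<forall>g\<in>Mor C. \<forall>h\<in>Mor C. tgt C f = src C g \<longrightarrow> tgt C g = src C h \<longrightarrow>
        cmp C h (cmp C g f) = cmp C (cmp C h g) f)"

definition mono_in :: "('o, 'a) category \<Rightarrow> 'a \<Rightarrow> bool" where
  "mono_in C f \<longleftrightarrow> f \<in> Mor C \<and>
     (\<forall>g\<in>Mor C. \<forall>h\<in>Mor C. tgt C g = src C f \<longrightarrow> tgt C h = src C f \<longrightarrow> src C g = src C h \<longrightarrow>
        cmp C f g = cmp C f h \<longrightarrow> g = h)"

definition epi_in :: "('o, 'a) category \<Rightarrow> 'a \<Rightarrow> bool" where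
  "epi_in C f \<longleftrightarrow> f \<in> Mor C \<and>
     (\<forall>g\<in>Mor C. \<forall>h\<in>Mor C. src C g = tgt C f \<longrightarrow> src C h = tgt C f \<longrightarrow> tgt C g = tgt C h \<longrightarrow>
        cmp C g f = cmp C h f \<longrightarrow> g = h)"

definition isomorphic_in :: "('o, 'a) category \<Rightarrow> 'o \<Rightarrow> 'o \<Rightarrow> bool" where
  "isomorphic_in C a b \<longleftrightarrow> a \<in> Ob C \<and> b \<in> Ob C \<and>
     (\<exists>f\<in>Hom C a b. \<exists>g\<in>Hom C b a. cmp C g f = ident C a \<and> cmp C f g = ident C b)"

definition initial_in :: "('o, 'a) category \<Rightarrow> 'o \<Rightarrow> bool" where
  "initial_in C i \<longleftrightarrow> i \<in> Ob C \<and> (\<forall>a\<in>Ob C. \<exists>!f. f \<in> Hom C i a)"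

definition terminal_in :: "('o, 'a) category \<Rightarrow> 'o \<Rightarrow> bool" where
  "terminal_in C t \<longleftrightarrow> t \<in> Ob C \<and> (\<forall>a\<in>Ob C. \<exists>!f. f \<in> Hom C a t)"

text \<open>\<open>Hom(b,-)\<close> sends every epimorphism to a surjection of sets.\<close>

definition projective_in :: "('o, 'a) category \<Rightarrow> 'o \<Rightarrow> bool" where
  "projective_in C b \<longleftrightarrow> b \<in> Ob C \<and>
     (\<forall>p. epi_in C p \<longrightarrow> (\<lambda>f. cmp C p f) ` Hom C b (src C p) = Hom C b (tgt C p))"

record ('o, 'a, 'p, 'b) functr =
  fob :: "'o \<Rightarrow> 'p"
  fmor :: "'a \<Rightarrow> 'b"

definition is_functor ::
  "('o, 'a) category \<Rightarrow> ('p, 'b) category \<Rightarrow> ('o, 'a, 'p, 'b) functr \<Rightarrow> bool" where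
  "is_functor C D F \<longleftrightarrow>
     (\<forall>a\<in>Ob C. fob F a \<in> Ob D) \<and>
     (\<forall>f\<in>Mor C. fmor F f \<in> Hom D (fob F (src C f)) (fob F (tgt C f))) \<and>
     (\<forall>a\<in>Ob C. fmor F (ident C a) = ident D (fob F a)) \<and>
     (\<forall>f\<in>Mor C. \<forall>g\<in>Mor C. tgt C f = src C g \<longrightarrow>
        fmor F (cmp C g f) = cmp D (fmor F g) (fmor F f))"

definition functor_id :: "('o, 'a, 'o, 'a) functr" where
  "functor_id = \<lparr>fob = (\<lambda>a. a), fmor = (\<lambda>f. f)\<rparr>"

definition functor_comp ::
  "('p, 'b, 'q, 'c) functr \<Rightarrow> ('o, 'a, 'p, 'b) functr \<Rightarrow> ('o, 'a, 'q, 'c) functr" where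
  "functor_comp G F = \<lparr>fob = (\<lambda>a. fob G (fob F a)), fmor = (\<lambda>f. fmor G (fmor F f))\<rparr>"

text \<open>Components are required to be \<open>undefined\<close> outside the objects of \<open>C\<close>, so that equality of
  natural transformations is equality of all components.\<close>

definition is_nat_trans ::
  "('o, 'a) category \<Rightarrow> ('p, 'b) category \<Rightarrow> ('o, 'a, 'p, 'b) functr \<Rightarrow> ('o, 'a, 'p, 'b) functr
     \<Rightarrow> ('o \<Rightarrow> 'b) \<Rightarrow> bool" where
  "is_nat_trans C D F G \<tau> \<longleftrightarrow>
     \<tau> \<in> extensional (Ob C) \<and>
     (\<forall>a\<in>Ob C. \<tau> a \<in> Hom D (fob F a) (fob G a)) \<and>
     (\<forall>f\<in>Mor C. cmp D (fmor G f) (\<tau> (src C f)) = cmp D (\<tau> (tgt C f)) (fmor F f))"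

definition nat_trans_id :: "('o, 'a) category \<Rightarrow> ('p, 'b) category \<Rightarrow> ('o, 'a, 'p, 'b) functr \<Rightarrow> 'o \<Rightarrow> 'b" where
  "nat_trans_id C D F = (\<lambda>a\<in>Ob C. ident D (fob F a))"

definition nat_trans_comp ::
  "('o, 'a) category \<Rightarrow> ('p, 'b) category \<Rightarrow> ('o \<Rightarrow> 'b) \<Rightarrow> ('o \<Rightarrow> 'b) \<Rightarrow> 'o \<Rightarrow> 'b" where
  "nat_trans_comp C D \<sigma> \<tau> = (\<lambda>a\<in>Ob C. cmp D (\<sigma> a) (\<tau> a))"

definition functor_category ::
  "('o, 'a) category \<Rightarrow> ('p, 'b) category \<Rightarrow>
     (('o, 'a, 'p, 'b) functr,
      ('o, 'a, 'p, 'b) functr \<times> ('o \<Rightarrow> 'b) \<times> ('o, 'a, 'p, 'b) functr) category" where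
  "functor_category C D =
     \<lparr>Ob = {F. is_functor C D F},
      Mor = {(F, \<tau>, G). is_functor C D F \<and> is_functor C D G \<and> is_nat_trans C D F G \<tau>},
      src = fst,
      tgt = (\<lambda>t. snd (snd t)),
      ident = (\<lambda>F. (F, nat_trans_id C D F, F)),
      cmp = (\<lambda>t s. (fst s, nat_trans_comp C D (fst (snd t)) (fst (snd s)), snd (snd t)))\<rparr>"

definition full_functor ::
  "('o, 'a) category \<Rightarrow> ('p, 'b) category \<Rightarrow> ('o, 'a, 'p, 'b) functr \<Rightarrow> bool" where
  "full_functor C D F \<longleftrightarrow>
     (\<forall>a\<in>Ob C. \<forall>b\<in>Ob C. \<forall>g\<in>Hom D (fob F a) (fob F b). \<exists>f\<in>Hom C a b. fmor F f = g)"

definition faithful_functor ::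
  "('o, 'a) category \<Rightarrow> ('p, 'b) category \<Rightarrow> ('o, 'a, 'p, 'b) functr \<Rightarrow> bool" where
  "faithful_functor C D F \<longleftrightarrow> (\<forall>a\<in>Ob C. \<forall>b\<in>Ob C. inj_on (fmor F) (Hom C a b))"

definition preserves_epis ::
  "('o, 'a) category \<Rightarrow> ('p, 'b) category \<Rightarrow> ('o, 'a, 'p, 'b) functr \<Rightarrow> bool" where
  "preserves_epis C D F \<longleftrightarrow> (\<forall>f. epi_in C f \<longrightarrow> epi_in D (fmor F f))"

definition reflects_initial ::
  "('o, 'a) category \<Rightarrow> ('p, 'b) category \<Rightarrow> ('o, 'a, 'p, 'b) functr \<Rightarrow> bool" where
  "reflects_initial C D F \<longleftrightarrow> (\<forall>a\<in>Ob C. initial_in D (fob F a) \<longrightarrow> initial_in C a)"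

text \<open>\<open>F \<stileturn> G\<close> with \<open>F : C \<rightarrow> D\<close>, unit \<open>\<eta>\<close> and counit \<open>\<epsilon>\<close>.\<close>

definition adjunction ::
  "('o, 'a) category \<Rightarrow> ('p, 'b) category \<Rightarrow> ('o, 'a, 'p, 'b) functr \<Rightarrow> ('p, 'b, 'o, 'a) functr
     \<Rightarrow> ('o \<Rightarrow> 'a) \<Rightarrow> ('p \<Rightarrow> 'b) \<Rightarrow> bool" where
  "adjunction C D F G \<eta> \<epsilon> \<longleftrightarrow>
     is_functor C D F \<and> is_functor D C G \<and>
     is_nat_trans C C functor_id (functor_comp G F) \<eta> \<and>
     is_nat_trans D D (functor_comp F G) functor_id \<epsilon> \<and>
     (\<forall>a\<in>Ob C. cmp D (\<epsilon> (fob F a)) (fmor F (\<eta> a)) = ident D (fob F a)) \<and>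
     (\<forall>b\<in>Ob D. cmp C (fmor G (\<epsilon> b)) (\<eta> (fob G b)) = ident C (fob G b))"

definition has_right_adjoint ::
  "('o, 'a) category \<Rightarrow> ('p, 'b) category \<Rightarrow> ('o, 'a, 'p, 'b) functr \<Rightarrow> bool" where
  "has_right_adjoint C D F \<longleftrightarrow> (\<exists>G \<eta> \<epsilon>. adjunction C D F G \<eta> \<epsilon>)"

subsection \<open>Limits\<close>

definition is_cone ::
  "('i, 'j) category \<Rightarrow> ('o, 'a) category \<Rightarrow> ('i, 'j, 'o, 'a) functr \<Rightarrow> 'o \<Rightarrow> ('i \<Rightarrow> 'a) \<Rightarrow> bool" where
  "is_cone J C D L \<pi> \<longleftrightarrow> L \<in> Ob C \<and>
     (\<forall>j\<in>Ob J. \<pi> j \<in> Hom C L (fob D j)) \<and>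
     (\<forall>u\<in>Mor J. cmp C (fmor D u) (\<pi> (src J u)) = \<pi> (tgt J u))"

definition is_limit ::
  "('i, 'j) category \<Rightarrow> ('o, 'a) category \<Rightarrow> ('i, 'j, 'o, 'a) functr \<Rightarrow> 'o \<Rightarrow> ('i \<Rightarrow> 'a) \<Rightarrow> bool" where
  "is_limit J C D L \<pi> \<longleftrightarrow> is_cone J C D L \<pi> \<and>
     (\<forall>X \<sigma>. is_cone J C D X \<sigma> \<longrightarrow>
        (\<exists>!f. f \<in> Hom C X L \<and> (\<forall>j\<in>Ob J. cmp C (\<pi> j) f = \<sigma> j)))"

definition preserves_limits_of_shape ::
  "('i, 'j) category \<Rightarrow> ('o, 'a) category \<Rightarrow> ('p, 'b) category \<Rightarrow> ('o, 'a, 'p, 'b) functr \<Rightarrow> bool" where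
  "preserves_limits_of_shape J C E F \<longleftrightarrow>
     (\<forall>D L \<pi>. is_functor J C D \<longrightarrow> is_limit J C D L \<pi> \<longrightarrow>
        is_limit J E (functor_comp F D) (fob F L) (\<lambda>j. fmor F (\<pi> j)))"

definition finite_category :: "('i, 'j) category \<Rightarrow> bool" where
  "finite_category J \<longleftrightarrow> is_category J \<and> finite (Ob J) \<and> finite (Mor J)"

definition discrete_category :: "('i, 'j) category \<Rightarrow> bool" where
  "discrete_category J \<longleftrightarrow> is_category J \<and> Mor J = ident J ` Ob J"

text \<open>Every finite category is isomorphic to one whose objects and morphisms are natural numbers,
  so these shapes suffice.\<close>

definition preserves_finite_limits ::
  "('o, 'a) category \<Rightarrow> ('p, 'b) category \<Rightarrow> ('o, 'a, 'p, 'b) functr \<Rightarrow> bool" where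
  "preserves_finite_limits C E F \<longleftrightarrow>
     (\<forall>J :: (nat, nat) category. finite_category J \<longrightarrow> preserves_limits_of_shape J C E F)"

definition preserves_finite_products ::
  "('o, 'a) category \<Rightarrow> ('p, 'b) category \<Rightarrow> ('o, 'a, 'p, 'b) functr \<Rightarrow> bool" where
  "preserves_finite_products C E F \<longleftrightarrow>
     (\<forall>J :: (nat, nat) category. finite_category J \<longrightarrow> discrete_category J \<longrightarrow>
        preserves_limits_of_shape J C E F)"

section \<open>Geometric morphisms\<close>

record ('o, 'a, 'p, 'b) geom =
  inv_im :: "('p, 'b, 'o, 'a) functr"
  dir_im :: "('o, 'a, 'p, 'b) functr"
  gunit :: "'p \<Rightarrow> 'b"
  gcounit :: "'o \<Rightarrow> 'a"

definition geometric_morphism ::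
  "('o, 'a) category \<Rightarrow> ('p, 'b) category \<Rightarrow> ('o, 'a, 'p, 'b) geom \<Rightarrow> bool" where
  "geometric_morphism E S f \<longleftrightarrow>
     adjunction S E (inv_im f) (dir_im f) (gunit f) (gcounit f) \<and>
     preserves_finite_limits S E (inv_im f)"

definition connected_geom ::
  "('o, 'a) category \<Rightarrow> ('p, 'b) category \<Rightarrow> ('o, 'a, 'p, 'b) geom \<Rightarrow> bool" where
  "connected_geom E S f \<longleftrightarrow> geometric_morphism E S f \<and>
     full_functor S E (inv_im f) \<and> faithful_functor S E (inv_im f)"

definition hyperconnected_geom ::
  "('o, 'a) category \<Rightarrow> ('p, 'b) category \<Rightarrow> ('o, 'a, 'p, 'b) geom \<Rightarrow> bool" where
  "hyperconnected_geom E S f \<longleftrightarrow> connected_geom E S f \<and>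
     (\<forall>m. mono_in E m \<longrightarrow>
        (\<exists>A\<in>Ob S. isomorphic_in E (tgt E m) (fob (inv_im f) A)) \<longrightarrow>
        (\<exists>A\<in>Ob S. isomorphic_in E (src E m) (fob (inv_im f) A))) \<and>
     (\<forall>e. epi_in E e \<longrightarrow>
        (\<exists>A\<in>Ob S. isomorphic_in E (src E e) (fob (inv_im f) A)) \<longrightarrow>
        (\<exists>A\<in>Ob S. isomorphic_in E (tgt E e) (fob (inv_im f) A)))"

definition local_geom ::
  "('o, 'a) category \<Rightarrow> ('p, 'b) category \<Rightarrow> ('o, 'a, 'p, 'b) geom \<Rightarrow> bool" where
  "local_geom E S f \<longleftrightarrow> geometric_morphism E S f \<and> has_right_adjoint E S (dir_im f)"

text \<open>\<open>h\<close> is the extra left adjoint \<open>f\<^sub>!\<close> of the inverse image functor.\<close>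

definition essential_via ::
  "('o, 'a) category \<Rightarrow> ('p, 'b) category \<Rightarrow> ('o, 'a, 'p, 'b) geom \<Rightarrow> ('o, 'a, 'p, 'b) functr \<Rightarrow> bool" where
  "essential_via E S f h \<longleftrightarrow> geometric_morphism E S f \<and> (\<exists>\<eta> \<epsilon>. adjunction E S h (inv_im f) \<eta> \<epsilon>)"

definition precohesive_geom ::
  "('o, 'a) category \<Rightarrow> ('p, 'b) category \<Rightarrow> ('o, 'a, 'p, 'b) geom \<Rightarrow> bool" where
  "precohesive_geom E S f \<longleftrightarrow> local_geom E S f \<and> hyperconnected_geom E S f \<and>
     (\<exists>h. essential_via E S f h \<and> preserves_finite_products E S h)"

section \<open>The universe\<close>

text \<open>HOL has no category of all sets, so ``set'' means: subset of \<open>U\<close> of cardinality smaller than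
  \<open>U\<close>. The conditions on \<open>U\<close> say that it is infinite and that the
  small sets are closed under \<open>A \<mapsto> A\<^sup>M\<close> (hence \<open>M\<close> itself is isomorphic to a small set). If
  the cardinality of \<open>U\<close> is strongly inaccessible and larger than that of \<open>M\<close>, these are the sets
  of a Grothendieck universe containing \<open>M\<close>, up to isomorphism (see \<open>universe_for_strong_limit\<close>);
  the weaker conditions have the advantage that HOL proves such \<open>U\<close> to exist for every \<open>M\<close>
  (see \<open>universe_for_exists\<close>).\<close>

definition small :: "'u set \<Rightarrow> 'u set \<Rightarrow> bool" where
  "small U A \<longleftrightarrow> A \<subseteq> U \<and> A \<prec> U"

definition universe_for :: "('m, 'z) monoid_scheme \<Rightarrow> 'u set \<Rightarrow> bool" where
  "universe_for M U \<longleftrightarrow> infinite U \<and> (\<forall>A. small U A \<longrightarrow> (carrier M \<rightarrow>\<^sub>E A) \<prec> U)"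

definition Set_cat :: "'u set \<Rightarrow> ('u set, 'u set \<times> ('u \<Rightarrow> 'u) \<times> 'u set) category" where
  "Set_cat U =
     \<lparr>Ob = {A. small U A},
      Mor = {(A, f, B). small U A \<and> small U B \<and> f \<in> A \<rightarrow>\<^sub>E B},
      src = fst,
      tgt = (\<lambda>t. snd (snd t)),
      ident = (\<lambda>A. (A, \<lambda>x\<in>A. x, A)),
      cmp = (\<lambda>t s. (fst s, compose (fst s) (fst (snd t)) (fst (snd s)), snd (snd t)))\<rparr>"

section \<open>Right \<open>M\<close>-sets\<close>

record ('u, 'm) rset =
  pts :: "'u set"
  act :: "'u \<Rightarrow> 'm \<Rightarrow> 'u"

type_synonym ('u, 'm) rmap = "('u, 'm) rset \<times> ('u \<Rightarrow> 'u) \<times> ('u, 'm) rset"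

definition right_absorbing :: "('m, 'z) monoid_scheme \<Rightarrow> 'm \<Rightarrow> bool" where
  "right_absorbing M r \<longleftrightarrow> r \<in> carrier M \<and> (\<forall>n\<in>carrier M. r \<otimes>\<^bsub>M\<^esub> n = r)"

definition right_mset :: "('m, 'z) monoid_scheme \<Rightarrow> ('u, 'm) rset \<Rightarrow> bool" where
  "right_mset M X \<longleftrightarrow>
     (\<forall>x\<in>pts X. \<forall>m\<in>carrier M. act X x m \<in> pts X) \<and>
     (\<forall>x\<in>pts X. act X x \<one>\<^bsub>M\<^esub> = x) \<and>
     (\<forall>x\<in>pts X. \<forall>m\<in>carrier M. \<forall>n\<in>carrier M. act X x (m \<otimes>\<^bsub>M\<^esub> n) = act X (act X x m) n)"

definition equivariant :: "('m, 'z) monoid_scheme \<Rightarrow> ('u, 'm) rset \<Rightarrow> ('u, 'm) rset \<Rightarrow> ('u \<Rightarrow> 'u) \<Rightarrow> bool" where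
  "equivariant M X Y f \<longleftrightarrow> (\<forall>x\<in>pts X. \<forall>m\<in>carrier M. f (act X x m) = act Y (f x) m)"

definition PSh :: "('m, 'z) monoid_scheme \<Rightarrow> 'u set \<Rightarrow> (('u, 'm) rset, ('u, 'm) rmap) category" where
  "PSh M U =
     \<lparr>Ob = {X. right_mset M X \<and> small U (pts X)},
      Mor = {(X, f, Y). right_mset M X \<and> small U (pts X) \<and> right_mset M Y \<and> small U (pts Y) \<and>
               f \<in> pts X \<rightarrow>\<^sub>E pts Y \<and> equivariant M X Y f},
      src = fst,
      tgt = (\<lambda>t. snd (snd t)),
      ident = (\<lambda>X. (X, \<lambda>x\<in>pts X. x, X)),
      cmp = (\<lambda>t s. (fst s, compose (pts (fst s)) (fst (snd t)) (fst (snd s)), snd (snd t)))\<rparr>"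

definition fixed_points :: "('m, 'z) monoid_scheme \<Rightarrow> ('u, 'm) rset \<Rightarrow> 'u set" where
  "fixed_points M X = {x \<in> pts X. \<forall>m\<in>carrier M. act X x m = x}"

text \<open>The equivalence relation on \<open>X\<close> generated by \<open>x \<sim> xm\<close>.\<close>

definition conn_rel :: "('m, 'z) monoid_scheme \<Rightarrow> ('u, 'm) rset \<Rightarrow> ('u \<times> 'u) set" where
  "conn_rel M X = {(x, y). x \<in> pts X \<and> y \<in> pts X \<and>
     equivclp (\<lambda>a b. a \<in> pts X \<and> (\<exists>m\<in>carrier M. b = act X a m)) x y}"

text \<open>The quotient \<open>pts X // conn_rel M X\<close> is a set of subsets of \<open>U\<close>. To obtain an object of
  \<open>Set_cat U\<close>, each connected component \<open>K\<close> is encoded by a chosen element \<open>code K \<in> K\<close>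
  (injectively, since the components are disjoint); \<open>component M X x\<close> is the encoded component
  of \<open>x\<close>.\<close>

definition code :: "'u set \<Rightarrow> 'u" where
  "code K = (SOME k. k \<in> K)"

definition components :: "('m, 'z) monoid_scheme \<Rightarrow> ('u, 'm) rset \<Rightarrow> 'u set" where
  "components M X = code ` (pts X // conn_rel M X)"

definition component :: "('m, 'z) monoid_scheme \<Rightarrow> ('u, 'm) rset \<Rightarrow> 'u \<Rightarrow> 'u" where
  "component M X x = code (conn_rel M X `` {x})"

definition Delta :: "('u set, 'u set \<times> ('u \<Rightarrow> 'u) \<times> 'u set, ('u, 'm) rset, ('u, 'm) rmap) functr" where
  "Delta =
     (let triv = (\<lambda>A. \<lparr>pts = A, act = (\<lambda>x m. x)\<rparr>)
      in \<lparr>fob = triv, fmor = (\<lambda>(A, f, B). (triv A, f, triv B))\<rparr>)"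

definition Gamma ::
  "('m, 'z) monoid_scheme \<Rightarrow> (('u, 'm) rset, ('u, 'm) rmap, 'u set, 'u set \<times> ('u \<Rightarrow> 'u) \<times> 'u set) functr" where
  "Gamma M =
     \<lparr>fob = fixed_points M,
      fmor = (\<lambda>(X, f, Y). (fixed_points M X, restrict f (fixed_points M X), fixed_points M Y))\<rparr>"

text \<open>An encoded component \<open>c\<close> is an element of the component it encodes, so the component of
  \<open>f c\<close> is the image of that component.\<close>

definition Comps ::
  "('m, 'z) monoid_scheme \<Rightarrow> (('u, 'm) rset, ('u, 'm) rmap, 'u set, 'u set \<times> ('u \<Rightarrow> 'u) \<times> 'u set) functr" where
  "Comps M =
     \<lparr>fob = components M,
      fmor = (\<lambda>(X, f, Y). (components M X, \<lambda>c\<in>components M X. component M Y (f c), components M Y))\<rparr>"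

definition alpha :: "('m, 'z) monoid_scheme \<Rightarrow> 'u set \<Rightarrow> ('u, 'm) rset \<Rightarrow> 'u set \<times> ('u \<Rightarrow> 'u) \<times> 'u set" where
  "alpha M U =
     (\<lambda>X\<in>Ob (PSh M U). (fixed_points M X, \<lambda>x\<in>fixed_points M X. component M X x, components M X))"

text \<open>The unit \<open>A \<rightarrow> \<Gamma>\<Delta>A = A\<close> is the identity and the counit \<open>\<Delta>\<Gamma>X \<rightarrow> X\<close> is the inclusion.\<close>

definition global_sections ::
  "('m, 'z) monoid_scheme \<Rightarrow> 'u set \<Rightarrow>
     (('u, 'm) rset, ('u, 'm) rmap, 'u set, 'u set \<times> ('u \<Rightarrow> 'u) \<times> 'u set) geom" where
  "global_sections M U =
     \<lparr>inv_im = Delta,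
      dir_im = Gamma M,
      gunit = (\<lambda>A\<in>Ob (Set_cat U). (A, \<lambda>x\<in>A. x, A)),
      gcounit = (\<lambda>X\<in>Ob (PSh M U). (fob Delta (fixed_points M X), \<lambda>x\<in>fixed_points M X. x, X))\<rparr>"

text \<open>Over the category of sets, a geometric morphism is locally connected iff its inverse image
  functor has a left adjoint.\<close>

definition punctually_locally_connected :: "('m, 'z) monoid_scheme \<Rightarrow> 'u set \<Rightarrow> bool" where
  "punctually_locally_connected M U \<longleftrightarrow>
     connected_geom (PSh M U) (Set_cat U) (global_sections M U) \<and>
     essential_via (PSh M U) (Set_cat U) (global_sections M U) (Comps M) \<and>
     epi_in (functor_category (PSh M U) (Set_cat U)) (Gamma M, alpha M U, Comps M)"

text \<open>Points are geometric morphisms from the category of sets; a morphism of points is a natural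
  transformation between the inverse image functors.\<close>

definition points_category ::
  "('m, 'z) monoid_scheme \<Rightarrow> 'u set \<Rightarrow>
     (('u set, 'u set \<times> ('u \<Rightarrow> 'u) \<times> 'u set, ('u, 'm) rset, ('u, 'm) rmap) geom,
      ('u set, 'u set \<times> ('u \<Rightarrow> 'u) \<times> 'u set, ('u, 'm) rset, ('u, 'm) rmap) geom
        \<times> (('u, 'm) rset \<Rightarrow> 'u set \<times> ('u \<Rightarrow> 'u) \<times> 'u set)
        \<times> ('u set, 'u set \<times> ('u \<Rightarrow> 'u) \<times> 'u set, ('u, 'm) rset, ('u, 'm) rmap) geom) category" where
  "points_category M U =
     \<lparr>Ob = {p. geometric_morphism (Set_cat U) (PSh M U) p},
      Mor = {(p, \<tau>, q). geometric_morphism (Set_cat U) (PSh M U) p \<and>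
               geometric_morphism (Set_cat U) (PSh M U) q \<and>
               is_nat_trans (PSh M U) (Set_cat U) (inv_im p) (inv_im q) \<tau>},
      src = fst,
      tgt = (\<lambda>t. snd (snd t)),
      ident = (\<lambda>p. (p, nat_trans_id (PSh M U) (Set_cat U) (inv_im p), p)),
      cmp = (\<lambda>t s. (fst s, nat_trans_comp (PSh M U) (Set_cat U) (fst (snd t)) (fst (snd s)),
                    snd (snd t)))\<rparr>"

section \<open>Existence of universes\<close>

lemma lepoll_iff_ordLeq: "A \<lesssim> B \<longleftrightarrow> ordLeq3 (card_of A) (card_of B)"
  unfolding lepoll_def by (rule card_of_ordLeq)

lemma lesspoll_iff_ordLess: "A \<prec> B \<longleftrightarrow> ordLess2 (card_of A) (card_of B)"
  unfolding lesspoll_def lepoll_iff_ordLeq eqpoll_iff_card_of_ordIso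
  using ordLeq_iff_ordLess_or_ordIso not_ordLess_ordIso by blast

lemma times_lesspoll:
  assumes inf: "infinite U" and A: "A \<prec> U" and B: "B \<prec> U"
  shows "A \<times> B \<prec> U"
proof (cases "finite A \<and> finite B")
  case True
  then have "finite (A \<times> B)" by simp
  then show ?thesis
    using finite_lesspoll_infinite inf by blast
next
  case False
  show ?thesis
  proof (cases "A \<lesssim> B")
    case True
    with \<open>\<not> (finite A \<and> finite B)\<close> have "infinite B"
      unfolding lepoll_def by (meson finite_imageD finite_subset)
    then have "ordLeq3 (card_of (A \<times> B)) (card_of B)"
      using True card_of_Times_ordLeq_infinite_Field[of "card_of B" A B]
      by (simp add: lepoll_iff_ordLeq Field_card_of card_of_mono1 card_of_card_order_on)
    then show ?thesis using B ordLeq_ordLess_trans unfolding lesspoll_iff_ordLess by blast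
  next
    case le: False
    then have BA: "B \<lesssim> A"
      using ordLeq_total[OF card_of_Well_order card_of_Well_order, of A B]
      by (simp add: lepoll_iff_ordLeq)
    with \<open>\<not> (finite A \<and> finite B)\<close> have "infinite A"
      unfolding lepoll_def by (meson finite_imageD finite_subset)
    then have "ordLeq3 (card_of (A \<times> B)) (card_of A)"
      using BA card_of_Times_ordLeq_infinite_Field[of "card_of A" A B]
      by (simp add: lepoll_iff_ordLeq Field_card_of card_of_mono1 card_of_card_order_on)
    then show ?thesis using A ordLeq_ordLess_trans unfolding lesspoll_iff_ordLess by blast
  qed
qed

lemma funcset_lepoll_Pow: "(A \<rightarrow>\<^sub>E B) \<lesssim> Pow (A \<times> B)"
proof -
  have "inj_on (\<lambda>f. {(x, f x) |x. x \<in> A}) (A \<rightarrow>\<^sub>E B)"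
  proof (rule inj_onI)
    fix f g assume f: "f \<in> A \<rightarrow>\<^sub>E B" and g: "g \<in> A \<rightarrow>\<^sub>E B"
      and eq: "{(x, f x) |x. x \<in> A} = {(x, g x) |x. x \<in> A}"
    have "f x = g x" if "x \<in> A" for x using eq that by blast
    then show "f = g" using f g by (metis PiE_ext)
  qed
  moreover have "(\<lambda>f. {(x, f x) |x. x \<in> A}) ` (A \<rightarrow>\<^sub>E B) \<subseteq> Pow (A \<times> B)" by auto
  ultimately show ?thesis unfolding lepoll_def by blast
qed

lemma universe_for_strong_limit:
  assumes inf: "infinite U" and M: "carrier M \<prec> U"
    and lim: "\<And>A. small U A \<Longrightarrow> Pow A \<prec> U"
  shows "universe_for M U"
proof -
  have "(carrier M \<rightarrow>\<^sub>E A) \<prec> U" if A: "small U A" for A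
  proof -
    have MA: "carrier M \<times> A \<prec> U"
      using times_lesspoll[OF inf M] A unfolding small_def by blast
    then obtain g where g: "inj_on g (carrier M \<times> A)" "g ` (carrier M \<times> A) \<subseteq> U"
      unfolding lesspoll_def lepoll_def by blast
    let ?B = "g ` (carrier M \<times> A)"
    have "?B \<approx> carrier M \<times> A"
      using g(1) by (simp add: inj_on_image_eqpoll_self)
    then have "small U ?B"
      using MA g(2) eq_lesspoll_trans by (simp add: small_def) blast
    then have "Pow ?B \<prec> U" by (rule lim)
    moreover have "Pow (carrier M \<times> A) \<lesssim> Pow ?B"
      unfolding lepoll_def using g(1)
      by (intro exI[of _ "image g"]) (auto simp: inj_on_image_Pow)
    ultimately show ?thesis
      using funcset_lepoll_Pow[of "carrier M" A] lepoll_trans lesspoll_trans1 by blast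
  qed
  then show ?thesis using inf by (simp add: universe_for_def)
qed

lemma universe_for_exists:
  fixes M :: "('m, 'z) monoid_scheme"
  shows "\<exists>U :: 'm list set set set. universe_for M U"
proof -
  let ?r = "card_of (UNIV :: 'm list set set)"
  let ?U = "Field (cardSuc ?r)"
  have co: "Card_order ?r" by (rule card_of_Card_order)
  have U: "ordIso2 (card_of ?U) (cardSuc ?r)"
    using card_of_Field_ordIso[OF cardSuc_Card_order[OF co]] .
  have less: "A \<prec> ?U \<longleftrightarrow> A \<lesssim> (UNIV :: 'm list set set)" for A :: "'c set"
  proof -
    have "A \<prec> ?U \<longleftrightarrow> ordLess2 (card_of A) (cardSuc ?r)"
      unfolding lesspoll_iff_ordLess
      using U ordLess_ordIso_trans ordIso_symmetric by blast
    also have "\<dots> \<longleftrightarrow> ordLeq3 (card_of A) ?r"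
      using cardSuc_ordLess_ordLeq[OF co card_of_Card_order] cardSuc_ordLeq_ordLess[OF co card_of_Card_order] by blast
    finally show ?thesis by (simp add: lepoll_iff_ordLeq)
  qed
  have "(carrier M \<rightarrow>\<^sub>E A) \<prec> ?U" if A: "small ?U A" for A
  proof -
    obtain h :: "'m list set set \<Rightarrow> 'm list set" where h: "inj_on h A"
      using A less[of A] by (auto simp: small_def lepoll_def)
    let ?e = "\<lambda>f. {m # l |m l. m \<in> carrier M \<and> l \<in> h (f m)}"
    have "inj_on ?e (carrier M \<rightarrow>\<^sub>E A)"
    proof (rule inj_onI)
      fix f g assume f: "f \<in> carrier M \<rightarrow>\<^sub>E A" and g: "g \<in> carrier M \<rightarrow>\<^sub>E A" and eq: "?e f = ?e g"
      have "f m = g m" if m: "m \<in> carrier M" for m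
      proof -
        have "l \<in> h (f m) \<longleftrightarrow> m # l \<in> ?e f" "l \<in> h (g m) \<longleftrightarrow> m # l \<in> ?e g" for l using m by simp_all
        then have "h (f m) = h (g m)" unfolding eq by blast
        then show ?thesis using h f g m by (meson PiE_mem inj_onD)
      qed
      then show "f = g" using f g by (metis PiE_ext)
    qed
    then have "(carrier M \<rightarrow>\<^sub>E A) \<lesssim> (UNIV :: 'm list set set)"
      unfolding lepoll_def by (intro exI[of _ ?e] conjI) simp_all
    then show ?thesis by (simp only: less)
  qed
  moreover have "infinite ?U"
    using cardSuc_finite[OF co] by (simp add: Field_card_of Finite_Set.finite_set infinite_UNIV_listI)
  ultimately show ?thesis by (intro exI[of _ ?U]) (simp add: universe_for_def)
qed

end

theory Submission
  imports Defs
begin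

text \<open>
  The regular \<open>M\<close>-set is free on one generator, and its fixed points are exactly the right absorbing
  elements. Hence each condition is tested on it: any construction that produces a map from the
  terminal object to it, or a fixed point in it, yields a right absorbing element. Conversely, a right
  absorbing \<open>r\<close> is an idempotent such that \<open>xr\<close> is a fixed point of \<open>X\<close>, in the component of \<open>x\<close>, for
  every \<open>x \<in> X\<close>.

  For any idempotent \<open>e\<close>, the functor \<open>X \<mapsto> {x. xe = x}\<close> preserves limits and has a right adjoint. The
  case \<open>e = r\<close> is \<open>\<Gamma>\<close>, and the case \<open>e = 1\<close> is the forgetful functor; both are inverse images of
  points. The first point is initial by the Yoneda lemma. If some point is initial, its map to the
  second one is invariant under all endomorphisms \<open>x \<mapsto> xm\<close> of the latter, so it lands in fixed points.
\<close>

section \<open>Generalities on categories\<close>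

text \<open>Epimorphisms are given by cancellation, limits by their universal property, and \<alpha>
  is epic inside a functor category. Two devices bring this down to elements. First, the
  underlying-set functors of M-sets and of sets are represented by the regular M-set and a one-point
  set, so the elements of any limit are the compatible families of elements. Secondly, an
  epimorphism is tested against two copies of its codomain glued along its image; for \<alpha> that
  glued object has to be a functor with small values. Size shapes the right adjoints:
  \<open>universe_for\<close> bounds only the sets of maps from M to a small set, so maps from Me to
  S are injected into maps from M to S and then coded as elements of U. An initial point p yields a
  fixed point only if its inverse image at the regular M-set is non-empty. It is, because p
  preserves the terminal object and the epimorphism from the regular M-set to it. Pre-cohesiveness
  also asks that C preserve finite products: each component contains a fixed point xr, and two fixed
  points of a product with connected coordinates are joined by changing one coordinate at a
  time.\<close>

abbreviation app :: "'a \<times> ('u \<Rightarrow> 'u) \<times> 'b \<Rightarrow> 'u \<Rightarrow> 'u" where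
  "app t \<equiv> fst (snd t)"

lemma Hom_D:
  assumes "f \<in> Hom C a b"
  shows "f \<in> Mor C" "src C f = a" "tgt C f = b"
  using assms by (auto simp: Hom_def)

lemma Mor_in_Hom: "f \<in> Mor C \<Longrightarrow> f \<in> Hom C (src C f) (tgt C f)"
  by (simp add: Hom_def)

lemma Hom_Ob:
  assumes "is_category C" "f \<in> Hom C a b"
  shows "a \<in> Ob C" "b \<in> Ob C"
  using assms by (auto simp: Hom_def is_category_def)

lemma ident_Hom: "is_category C \<Longrightarrow> a \<in> Ob C \<Longrightarrow> ident C a \<in> Hom C a a"
  by (simp add: is_category_def)

lemma cmp_Hom:
  assumes "is_category C" "f \<in> Hom C a b" "g \<in> Hom C b c"
  shows "cmp C g f \<in> Hom C a c"
proof -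
  have "f \<in> Mor C" "g \<in> Mor C" "tgt C f = src C g" "src C f = a" "tgt C g = c"
    using assms(2,3) by (auto simp: Hom_def)
  then show ?thesis using assms(1) unfolding is_category_def by blast
qed

lemma cmp_assoc:
  assumes "is_category C" "f \<in> Hom C a b" "g \<in> Hom C b c" "h \<in> Hom C c d"
  shows "cmp C h (cmp C g f) = cmp C (cmp C h g) f"
proof -
  have "f \<in> Mor C" "g \<in> Mor C" "h \<in> Mor C" "tgt C f = src C g" "tgt C g = src C h"
    using assms(2-4) by (auto simp: Hom_def)
  then show ?thesis using assms(1) unfolding is_category_def by blast
qed

lemma cmp_ident:
  assumes "is_category C" "f \<in> Hom C a b"
  shows "cmp C f (ident C a) = f" "cmp C (ident C b) f = f"
  using assms by (auto simp: is_category_def Hom_def)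

lemma functor_Ob: "is_functor C D F \<Longrightarrow> a \<in> Ob C \<Longrightarrow> fob F a \<in> Ob D"
  by (simp add: is_functor_def)

lemma functor_Hom: "is_functor C D F \<Longrightarrow> f \<in> Hom C a b \<Longrightarrow> fmor F f \<in> Hom D (fob F a) (fob F b)"
  unfolding is_functor_def Hom_def by fastforce

lemma functor_ident: "is_functor C D F \<Longrightarrow> a \<in> Ob C \<Longrightarrow> fmor F (ident C a) = ident D (fob F a)"
  by (simp add: is_functor_def)

lemma functor_cmp:
  assumes "is_functor C D F" "f \<in> Hom C a b" "g \<in> Hom C b c"
  shows "fmor F (cmp C g f) = cmp D (fmor F g) (fmor F f)"
proof -
  have "f \<in> Mor C" "g \<in> Mor C" "tgt C f = src C g"
    using assms(2,3) by (auto simp: Hom_def)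
  then show ?thesis using assms(1) unfolding is_functor_def by blast
qed

lemma is_functor_comp:
  assumes F: "is_functor C D F" and G: "is_functor D E G"
  shows "is_functor C E (functor_comp G F)"
  unfolding is_functor_def
proof (intro conjI ballI impI)
  fix f assume f: "f \<in> Mor C"
  show "fmor (functor_comp G F) f
      \<in> Hom E (fob (functor_comp G F) (src C f)) (fob (functor_comp G F) (tgt C f))"
    using functor_Hom[OF G functor_Hom[OF F Mor_in_Hom[OF f]]] by (simp add: functor_comp_def)
  fix g assume g: "g \<in> Mor C" and fg: "tgt C f = src C g"
  have g': "g \<in> Hom C (tgt C f) (tgt C g)" using Mor_in_Hom[OF g] fg by simp
  show "fmor (functor_comp G F) (cmp C g f) = cmp E (fmor (functor_comp G F) g) (fmor (functor_comp G F) f)"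
    using functor_cmp[OF F Mor_in_Hom[OF f] g']
      functor_cmp[OF G functor_Hom[OF F Mor_in_Hom[OF f]] functor_Hom[OF F g']]
    by (simp add: functor_comp_def)
qed (use F G in \<open>auto simp: functor_comp_def functor_Ob functor_ident\<close>)

lemma nat_trans_Hom: "is_nat_trans C D F G \<tau> \<Longrightarrow> a \<in> Ob C \<Longrightarrow> \<tau> a \<in> Hom D (fob F a) (fob G a)"
  by (simp add: is_nat_trans_def)

lemma nat_trans_natural:
  "is_nat_trans C D F G \<tau> \<Longrightarrow> f \<in> Hom C a b \<Longrightarrow> cmp D (fmor G f) (\<tau> a) = cmp D (\<tau> b) (fmor F f)"
  by (auto simp: is_nat_trans_def Hom_def)

lemma is_nat_transI:
  assumes "\<tau> \<in> extensional (Ob C)"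
    and "\<And>a. a \<in> Ob C \<Longrightarrow> \<tau> a \<in> Hom D (fob F a) (fob G a)"
    and "\<And>a b f. f \<in> Hom C a b \<Longrightarrow> cmp D (fmor G f) (\<tau> a) = cmp D (\<tau> b) (fmor F f)"
  shows "is_nat_trans C D F G \<tau>"
  unfolding is_nat_trans_def using assms(1,2) assms(3)[OF Mor_in_Hom] by simp

lemma nat_trans_ext:
  assumes "is_nat_trans C D F G \<sigma>" "is_nat_trans C D F' G' \<tau>"
    and "\<And>a. a \<in> Ob C \<Longrightarrow> \<sigma> a = \<tau> a"
  shows "\<sigma> = \<tau>"
  by (rule extensionalityI[of \<sigma> "Ob C"]) (use assms in \<open>auto simp: is_nat_trans_def\<close>)

lemma epi_in_cancel:
  assumes "epi_in C f" "f \<in> Hom C a b" "g \<in> Hom C b c" "h \<in> Hom C b c" "cmp C g f = cmp C h f"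
  shows "g = h"
  using assms by (auto simp: epi_in_def Hom_def)

lemma mono_in_cancel:
  assumes "mono_in C f" "f \<in> Hom C b c" "g \<in> Hom C a b" "h \<in> Hom C a b" "cmp C f g = cmp C f h"
  shows "g = h"
  using assms by (auto simp: mono_in_def Hom_def)

lemma epi_inI:
  assumes "f \<in> Hom C a b"
    and "\<And>c g h. g \<in> Hom C b c \<Longrightarrow> h \<in> Hom C b c \<Longrightarrow> cmp C g f = cmp C h f \<Longrightarrow> g = h"
  shows "epi_in C f"
  using assms by (auto simp: epi_in_def Hom_def)

section \<open>Adjunctions\<close>

text \<open>Transposition across the adjunction turns cancellation of \<open>fmor F f\<close> into
  cancellation of \<open>f\<close>. This serves both \<Gamma>, when it has a right adjoint, and the
  inverse image of any point.\<close>

lemma left_adjoint_preserves_epis: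
  assumes adj: "adjunction C D F G \<eta> \<epsilon>" and C: "is_category C" and D: "is_category D"
  shows "preserves_epis C D F"
  unfolding preserves_epis_def
proof (intro allI impI)
  fix f assume epi: "epi_in C f"
  from adj have F: "is_functor C D F" and G: "is_functor D C G"
    and \<eta>: "is_nat_trans C C functor_id (functor_comp G F) \<eta>"
    and \<epsilon>: "is_nat_trans D D (functor_comp F G) functor_id \<epsilon>"
    and tri: "\<And>a. a \<in> Ob C \<Longrightarrow> cmp D (\<epsilon> (fob F a)) (fmor F (\<eta> a)) = ident D (fob F a)"
    by (auto simp: adjunction_def)
  from epi obtain a b where f: "f \<in> Hom C a b"
    using Mor_in_Hom epi_in_def by metis
  have ob: "a \<in> Ob C" "b \<in> Ob C" using Hom_Ob[OF C f] .
  have \<eta>': "\<eta> x \<in> Hom C x (fob G (fob F x))" if "x \<in> Ob C" for x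
    using nat_trans_Hom[OF \<eta> that] by (simp add: functor_id_def functor_comp_def)
  have Ff: "fmor F f \<in> Hom D (fob F a) (fob F b)" using functor_Hom[OF F f] .
  show "epi_in D (fmor F f)"
  proof (rule epi_inI[OF Ff])
    fix d g h assume g: "g \<in> Hom D (fob F b) d" and h: "h \<in> Hom D (fob F b) d"
      and eq: "cmp D g (fmor F f) = cmp D h (fmor F f)"
    have \<epsilon>': "\<epsilon> x \<in> Hom D (fob F (fob G x)) x" if "x \<in> Ob D" for x
      using nat_trans_Hom[OF \<epsilon> that] by (simp add: functor_id_def functor_comp_def)
    \<comment> \<open>Naturality of the unit: the transpose of \<open>k\<close> after
      \<open>fmor F f\<close> is the transpose of \<open>k\<close>, precomposed with
      \<open>f\<close>.\<close>
    have transpose_f: "cmp C (cmp C (fmor G k) (\<eta> b)) f = cmp C (fmor G (cmp D k (fmor F f))) (\<eta> a)"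
      if k: "k \<in> Hom D (fob F b) d" for k
    proof -
      have "cmp C (cmp C (fmor G k) (\<eta> b)) f = cmp C (fmor G k) (cmp C (\<eta> b) f)"
        using cmp_assoc[OF C f \<eta>'[OF ob(2)] functor_Hom[OF G k]] by simp
      also have "cmp C (\<eta> b) f = cmp C (fmor G (fmor F f)) (\<eta> a)"
        using nat_trans_natural[OF \<eta> f] by (simp add: functor_id_def functor_comp_def)
      also have "cmp C (fmor G k) (cmp C (fmor G (fmor F f)) (\<eta> a))
          = cmp C (cmp C (fmor G k) (fmor G (fmor F f))) (\<eta> a)"
        using cmp_assoc[OF C \<eta>'[OF ob(1)] functor_Hom[OF G Ff] functor_Hom[OF G k]] .
      finally show ?thesis using functor_cmp[OF G Ff k] by simp
    qed
    have transpose_Hom: "cmp C (fmor G k) (\<eta> b) \<in> Hom C b (fob G d)"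
      if k: "k \<in> Hom D (fob F b) d" for k
      using cmp_Hom[OF C \<eta>'[OF ob(2)] functor_Hom[OF G k]] .
    \<comment> \<open>The triangle identity at \<open>b\<close> recovers \<open>k\<close> from its
      transpose, so transposition is injective.\<close>
    have untranspose: "cmp D (\<epsilon> d) (fmor F (cmp C (fmor G k) (\<eta> b))) = k"
      if k: "k \<in> Hom D (fob F b) d" for k
    proof -
      have Fb: "fob F b \<in> Ob D" and d: "d \<in> Ob D" using Hom_Ob[OF D k] .
      have FGk: "fmor F (fmor G k) \<in> Hom D (fob F (fob G (fob F b))) (fob F (fob G d))"
        using functor_Hom[OF F functor_Hom[OF G k]] .
      have F\<eta>: "fmor F (\<eta> b) \<in> Hom D (fob F b) (fob F (fob G (fob F b)))"
        using functor_Hom[OF F \<eta>'[OF ob(2)]] .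
      have "cmp D (\<epsilon> d) (fmor F (cmp C (fmor G k) (\<eta> b)))
          = cmp D (\<epsilon> d) (cmp D (fmor F (fmor G k)) (fmor F (\<eta> b)))"
        using functor_cmp[OF F \<eta>'[OF ob(2)] functor_Hom[OF G k]] by simp
      also have "\<dots> = cmp D (cmp D (\<epsilon> d) (fmor F (fmor G k))) (fmor F (\<eta> b))"
        using cmp_assoc[OF D F\<eta> FGk \<epsilon>'[OF d]] .
      also have "cmp D (\<epsilon> d) (fmor F (fmor G k)) = cmp D k (\<epsilon> (fob F b))"
        using nat_trans_natural[OF \<epsilon> k] by (simp add: functor_id_def functor_comp_def)
      also have "cmp D (cmp D k (\<epsilon> (fob F b))) (fmor F (\<eta> b)) = cmp D k (cmp D (\<epsilon> (fob F b)) (fmor F (\<eta> b)))"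
        using cmp_assoc[OF D F\<eta> \<epsilon>'[OF Fb] k] by simp
      also have "\<dots> = k" using tri[OF ob(2)] cmp_ident(1)[OF D k] by simp
      finally show ?thesis .
    qed
    have "cmp C (fmor G g) (\<eta> b) = cmp C (fmor G h) (\<eta> b)"
      by (rule epi_in_cancel[OF epi f transpose_Hom[OF g] transpose_Hom[OF h]])
        (simp only: transpose_f[OF g] transpose_f[OF h] eq)
    then show "g = h" by (metis untranspose[OF g] untranspose[OF h])
  qed
qed

text \<open>The chosen universal arrows \<open>e b\<close> form the counit, the unit at
  \<open>a\<close> is the transpose of the identity of \<open>fob F a\<close>, and G sends g to the
  transpose of g after the counit.\<close>

lemma has_right_adjoint_of_universal_arrows:
  assumes F: "is_functor C D F" and C: "is_category C" and D: "is_category D"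
    and univ: "\<And>b. b \<in> Ob D \<Longrightarrow> \<exists>a\<in>Ob C. \<exists>e\<in>Hom D (fob F a) b.
      \<forall>x\<in>Ob C. \<forall>f\<in>Hom D (fob F x) b. \<exists>!g. g \<in> Hom C x a \<and> cmp D e (fmor F g) = f"
  shows "has_right_adjoint C D F"
proof -
  obtain R where "\<forall>b\<in>Ob D. R b \<in> Ob C \<and> (\<exists>e\<in>Hom D (fob F (R b)) b.
      \<forall>x\<in>Ob C. \<forall>f\<in>Hom D (fob F x) b. \<exists>!g. g \<in> Hom C x (R b) \<and> cmp D e (fmor F g) = f)"
    using univ by metis
  then obtain e where R: "\<And>b. b \<in> Ob D \<Longrightarrow> R b \<in> Ob C"
    and e: "\<And>b. b \<in> Ob D \<Longrightarrow> e b \<in> Hom D (fob F (R b)) b"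
    and ex1: "\<And>b x f. b \<in> Ob D \<Longrightarrow> x \<in> Ob C \<Longrightarrow> f \<in> Hom D (fob F x) b \<Longrightarrow>
      \<exists>!g. g \<in> Hom C x (R b) \<and> cmp D (e b) (fmor F g) = f"
    by metis
  define tr where "tr x b f = (THE g. g \<in> Hom C x (R b) \<and> cmp D (e b) (fmor F g) = f)" for x b f
  have tr: "tr x b f \<in> Hom C x (R b)" "cmp D (e b) (fmor F (tr x b f)) = f"
    if "b \<in> Ob D" "x \<in> Ob C" "f \<in> Hom D (fob F x) b" for x b f
    using theI'[OF ex1[OF that]] unfolding tr_def by auto
  \<comment> \<open>All later equations between morphisms into \<open>R b\<close> (functoriality of
    G, naturality of the unit, the second triangle identity) are proved by comparing composites with
    \<open>e b\<close>.\<close>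
  have uniq: "g = h"
    if "g \<in> Hom C x (R b)" "h \<in> Hom C x (R b)" "cmp D (e b) (fmor F g) = cmp D (e b) (fmor F h)" "b \<in> Ob D"
    for x b g h
  proof -
    have x: "x \<in> Ob C" using Hom_Ob[OF C that(1)] by simp
    have "cmp D (e b) (fmor F g) \<in> Hom D (fob F x) b"
      using cmp_Hom[OF D functor_Hom[OF F that(1)] e[OF that(4)]] .
    from ex1[OF that(4) x this] show ?thesis using that(1-3) by auto
  qed
  define G where "G = \<lparr>fob = R, fmor = (\<lambda>g. tr (R (src D g)) (tgt D g) (cmp D g (e (src D g))))\<rparr>"
  have Gob: "fob G b = R b" for b by (simp add: G_def)
  have Gmor: "fmor G g \<in> Hom C (R b) (R c)" "cmp D (e c) (fmor F (fmor G g)) = cmp D g (e b)"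
    if g: "g \<in> Hom D b c" for g b c
  proof -
    have ge: "cmp D g (e b) \<in> Hom D (fob F (R b)) c"
      using cmp_Hom[OF D e g] Hom_Ob[OF D g] by blast
    show "fmor G g \<in> Hom C (R b) (R c)" "cmp D (e c) (fmor F (fmor G g)) = cmp D g (e b)"
      using tr[OF Hom_Ob(2)[OF D g] R[OF Hom_Ob(1)[OF D g]] ge] Hom_D[OF g] by (simp_all add: G_def)
  qed
  define \<eta> where "\<eta> = (\<lambda>a\<in>Ob C. tr a (fob F a) (ident D (fob F a)))"
  define \<epsilon> where "\<epsilon> = restrict e (Ob D)"
  have \<eta>: "\<eta> a \<in> Hom C a (R (fob F a))" "cmp D (e (fob F a)) (fmor F (\<eta> a)) = ident D (fob F a)"
    if a: "a \<in> Ob C" for a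
    using tr[OF functor_Ob[OF F a] a ident_Hom[OF D functor_Ob[OF F a]]] a by (simp_all add: \<eta>_def)
  have G: "is_functor D C G"
    unfolding is_functor_def Gob
  proof (intro conjI ballI impI)
    fix b assume b: "b \<in> Ob D"
    show "R b \<in> Ob C" using R[OF b] .
    show "fmor G (ident D b) = ident C (R b)"
      using uniq[OF Gmor(1)[OF ident_Hom[OF D b]] ident_Hom[OF C R[OF b]] _ b]
        Gmor(2)[OF ident_Hom[OF D b]] cmp_ident[OF D e[OF b]] functor_ident[OF F R[OF b]] by simp
  next
    fix f assume f: "f \<in> Mor D"
    show "fmor G f \<in> Hom C (R (src D f)) (R (tgt D f))" using Gmor(1)[OF Mor_in_Hom[OF f]] .
    fix g assume g: "g \<in> Mor D" and fg: "tgt D f = src D g"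
    define a b c where "a = src D f" and "b = tgt D f" and "c = tgt D g"
    have f: "f \<in> Hom D a b" and g: "g \<in> Hom D b c"
      using f g fg by (auto simp: Hom_def a_def b_def c_def)
    have ob: "a \<in> Ob D" "b \<in> Ob D" "c \<in> Ob D" using Hom_Ob[OF D f] Hom_Ob[OF D g] by auto
    have gf: "cmp D g f \<in> Hom D a c" using cmp_Hom[OF D f g] .
    have FGf: "fmor F (fmor G f) \<in> Hom D (fob F (R a)) (fob F (R b))"
      and FGg: "fmor F (fmor G g) \<in> Hom D (fob F (R b)) (fob F (R c))"
      using functor_Hom[OF F Gmor(1)[OF f]] functor_Hom[OF F Gmor(1)[OF g]] by auto
    have "cmp D (e c) (fmor F (cmp C (fmor G g) (fmor G f)))
        = cmp D (cmp D (e c) (fmor F (fmor G g))) (fmor F (fmor G f))"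
      using functor_cmp[OF F Gmor(1)[OF f] Gmor(1)[OF g]] cmp_assoc[OF D FGf FGg e[OF ob(3)]] by simp
    also have "\<dots> = cmp D g (cmp D (e b) (fmor F (fmor G f)))"
      using Gmor(2)[OF g] cmp_assoc[OF D FGf e[OF ob(2)] g] by simp
    also have "\<dots> = cmp D (cmp D g f) (e a)"
      using Gmor(2)[OF f] cmp_assoc[OF D e[OF ob(1)] f g] by simp
    finally show "fmor G (cmp D g f) = cmp C (fmor G g) (fmor G f)"
      using uniq[OF Gmor(1)[OF gf] cmp_Hom[OF C Gmor(1)[OF f] Gmor(1)[OF g]] _ ob(3)] Gmor(2)[OF gf]
      by simp
  qed
  have "is_nat_trans C C functor_id (functor_comp G F) \<eta>"
  proof (rule is_nat_transI)
    show "\<eta> \<in> extensional (Ob C)" by (simp add: \<eta>_def)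
    show "\<eta> a \<in> Hom C (fob functor_id a) (fob (functor_comp G F) a)" if "a \<in> Ob C" for a
      using \<eta>(1)[OF that] by (simp add: functor_id_def functor_comp_def Gob)
    fix a b f assume f: "f \<in> Hom C a b"
    have ob: "a \<in> Ob C" "b \<in> Ob C" using Hom_Ob[OF C f] .
    note Fob = functor_Ob[OF F ob(1)] functor_Ob[OF F ob(2)]
    note Ff = functor_Hom[OF F f]
    have "cmp D (e (fob F b)) (fmor F (cmp C (fmor G (fmor F f)) (\<eta> a)))
        = cmp D (e (fob F b)) (cmp D (fmor F (fmor G (fmor F f))) (fmor F (\<eta> a)))"
      using functor_cmp[OF F \<eta>(1)[OF ob(1)] Gmor(1)[OF Ff]] by simp
    also have "\<dots> = cmp D (cmp D (e (fob F b)) (fmor F (fmor G (fmor F f)))) (fmor F (\<eta> a))"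
      using cmp_assoc[OF D functor_Hom[OF F \<eta>(1)[OF ob(1)]] functor_Hom[OF F Gmor(1)[OF Ff]] e[OF Fob(2)]] .
    also have "\<dots> = cmp D (fmor F f) (cmp D (e (fob F a)) (fmor F (\<eta> a)))"
      using Gmor(2)[OF Ff] cmp_assoc[OF D functor_Hom[OF F \<eta>(1)[OF ob(1)]] e[OF Fob(1)] Ff] by simp
    also have "\<dots> = fmor F f" using \<eta>(2)[OF ob(1)] cmp_ident[OF D Ff] by simp
    also have "\<dots> = cmp D (cmp D (e (fob F b)) (fmor F (\<eta> b))) (fmor F f)"
      using \<eta>(2)[OF ob(2)] cmp_ident[OF D Ff] by simp
    also have "\<dots> = cmp D (e (fob F b)) (fmor F (cmp C (\<eta> b) f))"
      using cmp_assoc[OF D Ff functor_Hom[OF F \<eta>(1)[OF ob(2)]] e[OF Fob(2)]]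
        functor_cmp[OF F f \<eta>(1)[OF ob(2)]] by simp
    finally show "cmp C (fmor (functor_comp G F) f) (\<eta> a) = cmp C (\<eta> b) (fmor functor_id f)"
      using uniq[OF cmp_Hom[OF C \<eta>(1)[OF ob(1)] Gmor(1)[OF Ff]] cmp_Hom[OF C f \<eta>(1)[OF ob(2)]] _ Fob(2)]
      by (simp add: functor_id_def functor_comp_def)
  qed
  moreover have "is_nat_trans D D (functor_comp F G) functor_id \<epsilon>"
  proof (rule is_nat_transI)
    show "\<epsilon> \<in> extensional (Ob D)" by (simp add: \<epsilon>_def)
    show "\<epsilon> b \<in> Hom D (fob (functor_comp F G) b) (fob functor_id b)" if "b \<in> Ob D" for b
      using e[OF that] that by (simp add: functor_id_def functor_comp_def Gob \<epsilon>_def)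
    show "cmp D (fmor functor_id f) (\<epsilon> b) = cmp D (\<epsilon> c) (fmor (functor_comp F G) f)"
      if "f \<in> Hom D b c" for b c f
      using Gmor(2)[OF that] Hom_Ob[OF D that] by (simp add: functor_id_def functor_comp_def \<epsilon>_def)
  qed
  moreover have "cmp D (\<epsilon> (fob F a)) (fmor F (\<eta> a)) = ident D (fob F a)" if "a \<in> Ob C" for a
    using \<eta>(2)[OF that] functor_Ob[OF F that] by (simp add: \<epsilon>_def)
  moreover have "cmp C (fmor G (\<epsilon> b)) (\<eta> (fob G b)) = ident C (fob G b)" if b: "b \<in> Ob D" for b
  proof -
    have Rb: "R b \<in> Ob C" using R[OF b] .
    note Fb = functor_Ob[OF F Rb]
    note eb = e[OF b]
    have "cmp D (e b) (fmor F (cmp C (fmor G (e b)) (\<eta> (R b))))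
        = cmp D (cmp D (e b) (fmor F (fmor G (e b)))) (fmor F (\<eta> (R b)))"
      using functor_cmp[OF F \<eta>(1)[OF Rb] Gmor(1)[OF eb]]
        cmp_assoc[OF D functor_Hom[OF F \<eta>(1)[OF Rb]] functor_Hom[OF F Gmor(1)[OF eb]] eb] by simp
    also have "\<dots> = cmp D (e b) (cmp D (e (fob F (R b))) (fmor F (\<eta> (R b))))"
      using Gmor(2)[OF eb] cmp_assoc[OF D functor_Hom[OF F \<eta>(1)[OF Rb]] e[OF Fb] eb] by simp
    also have "\<dots> = cmp D (e b) (fmor F (ident C (R b)))"
      using \<eta>(2)[OF Rb] functor_ident[OF F Rb] by simp
    finally have "cmp C (fmor G (e b)) (\<eta> (R b)) = ident C (R b)"
      using uniq[OF cmp_Hom[OF C \<eta>(1)[OF Rb] Gmor(1)[OF eb]] ident_Hom[OF C Rb] _ b] by simp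
    then show ?thesis using b by (simp add: \<epsilon>_def Gob)
  qed
  ultimately show ?thesis unfolding has_right_adjoint_def adjunction_def using F G by blast
qed

lemma is_limit_empty:
  assumes "Ob J = {}" "Mor J = {}"
  shows "is_limit J C D L \<pi> \<longleftrightarrow> terminal_in C L"
  using assms by (auto simp: is_limit_def is_cone_def terminal_in_def)

text \<open>A terminal object is a limit of the empty shape; the values of the diagram and the legs
  of the cone may then be arbitrary.\<close>

lemma preserves_terminal:
  assumes F: "preserves_finite_limits C E F" and T: "terminal_in C T"
  shows "terminal_in E (fob F T)"
proof -
  define J :: "(nat, nat) category" where
    "J = \<lparr>Ob = {}, Mor = {}, src = id, tgt = id, ident = id, cmp = (\<lambda>g f. f)\<rparr>"
  have J: "finite_category J" by (simp add: finite_category_def is_category_def J_def)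
  let ?D = "\<lparr>fob = \<lambda>_. T, fmor = undefined\<rparr>"
  have "is_functor J C ?D" by (simp add: is_functor_def J_def)
  moreover have "is_limit J C ?D T undefined" using T by (simp add: is_limit_empty J_def)
  ultimately have "is_limit J E (functor_comp F ?D) (fob F T) (\<lambda>j. fmor F (undefined j))"
    using F J unfolding preserves_finite_limits_def preserves_limits_of_shape_def by blast
  then show ?thesis by (simp add: is_limit_empty J_def)
qed

section \<open>Concrete categories with representable forgetful functor\<close>

text \<open>The last assumption says that a jointly injective family of morphisms is initial with respect
  to the forgetful functor.\<close>

locale concrete_category =
  fixes C :: "('o, 'o \<times> ('u \<Rightarrow> 'u) \<times> 'o) category" and el :: "'o \<Rightarrow> 'u set" and Gen :: 'o and gen :: 'u
  assumes category: "is_category C"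
    and app_in: "f \<in> Hom C X Y \<Longrightarrow> x \<in> el X \<Longrightarrow> app f x \<in> el Y"
    and mor_eqI: "f \<in> Hom C X Y \<Longrightarrow> g \<in> Hom C X Y \<Longrightarrow> (\<And>x. x \<in> el X \<Longrightarrow> app f x = app g x) \<Longrightarrow> f = g"
    and app_cmp: "f \<in> Hom C X Y \<Longrightarrow> x \<in> el X \<Longrightarrow> app (cmp C g f) x = app g (app f x)"
    and Gen_Ob: "Gen \<in> Ob C" and gen_in: "gen \<in> el Gen"
    and generic: "X \<in> Ob C \<Longrightarrow> x \<in> el X \<Longrightarrow> \<exists>!f. f \<in> Hom C Gen X \<and> app f gen = x"
    and initial_lift: "X \<in> Ob C \<Longrightarrow> L \<in> Ob C \<Longrightarrow> (\<And>x. x \<in> el X \<Longrightarrow> k x \<in> el L) \<Longrightarrow>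
      (\<And>j :: nat. j \<in> I \<Longrightarrow> \<pi> j \<in> Hom C L (D j)) \<Longrightarrow>
      (\<And>l l'. l \<in> el L \<Longrightarrow> l' \<in> el L \<Longrightarrow> (\<forall>j\<in>I. app (\<pi> j) l = app (\<pi> j) l') \<Longrightarrow> l = l') \<Longrightarrow>
      (\<And>j. j \<in> I \<Longrightarrow> \<sigma> j \<in> Hom C X (D j)) \<Longrightarrow>
      (\<And>j x. j \<in> I \<Longrightarrow> x \<in> el X \<Longrightarrow> app (\<sigma> j) x = app (\<pi> j) (k x)) \<Longrightarrow>
      \<exists>f\<in>Hom C X L. \<forall>x\<in>el X. app f x = k x"
begin

text \<open>Two elements with the same image correspond to two morphisms from \<open>Gen\<close>
  with the same composite with \<open>m\<close>.\<close>

lemma mono_inj: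
  assumes m: "mono_in C m" "m \<in> Hom C X Y"
  shows "inj_on (app m) (el X)"
proof (rule inj_onI)
  fix x y assume x: "x \<in> el X" and y: "y \<in> el X" and eq: "app m x = app m y"
  have X: "X \<in> Ob C" and Y: "Y \<in> Ob C" using Hom_Ob[OF category m(2)] .
  obtain f g where f: "f \<in> Hom C Gen X" "app f gen = x" and g: "g \<in> Hom C Gen X" "app g gen = y"
    using generic[OF X x] generic[OF X y] by blast
  have "cmp C m f = cmp C m g"
    using generic[OF Y app_in[OF m(2) x]] cmp_Hom[OF category f(1) m(2)] cmp_Hom[OF category g(1) m(2)]
      app_cmp[OF f(1) gen_in, of m] app_cmp[OF g(1) gen_in, of m] f g eq by metis
  then have "f = g" using mono_in_cancel[OF m f(1) g(1)] by simp
  then show "x = y" using f g by simp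
qed

lemma epi_of_surj:
  assumes f: "f \<in> Hom C X Y" and surj: "\<And>y. y \<in> el Y \<Longrightarrow> \<exists>x\<in>el X. app f x = y"
  shows "epi_in C f"
proof (rule epi_inI[OF f])
  fix Z g h assume g: "g \<in> Hom C Y Z" and h: "h \<in> Hom C Y Z" and eq: "cmp C g f = cmp C h f"
  show "g = h"
    using g h
  proof (rule mor_eqI)
    fix y assume "y \<in> el Y"
    then obtain x where x: "x \<in> el X" "app f x = y" using surj by blast
    then show "app g y = app h y" using eq app_cmp[OF f x(1), of g] app_cmp[OF f x(1), of h] by simp
  qed
qed

text \<open>Representable functors preserve limits: a compatible family of elements is a cone with
  apex \<open>Gen\<close>, and its unique factorization through L is the required element.\<close>

lemma limit_elements:
  assumes D: "is_functor J C D" and lim: "is_limit J C D L \<pi>"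
    and x: "\<And>j. j \<in> Ob J \<Longrightarrow> x j \<in> el (fob D j)"
    and compat: "\<And>u. u \<in> Mor J \<Longrightarrow> src J u \<in> Ob J \<Longrightarrow> tgt J u \<in> Ob J \<Longrightarrow>
      app (fmor D u) (x (src J u)) = x (tgt J u)"
    and J: "is_category J"
  shows "\<exists>!l. l \<in> el L \<and> (\<forall>j\<in>Ob J. app (\<pi> j) l = x j)"
proof -
  have L: "L \<in> Ob C" and \<pi>: "\<And>j. j \<in> Ob J \<Longrightarrow> \<pi> j \<in> Hom C L (fob D j)"
    and univ: "\<And>X \<sigma>. is_cone J C D X \<sigma> \<Longrightarrow> \<exists>!f. f \<in> Hom C X L \<and> (\<forall>j\<in>Ob J. cmp C (\<pi> j) f = \<sigma> j)"
    using lim by (auto simp: is_limit_def is_cone_def)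
  define \<sigma> where "\<sigma> j = (THE f. f \<in> Hom C Gen (fob D j) \<and> app f gen = x j)" for j
  have \<sigma>: "\<sigma> j \<in> Hom C Gen (fob D j)" "app (\<sigma> j) gen = x j" if "j \<in> Ob J" for j
    using theI'[OF generic[OF functor_Ob[OF D that] x[OF that]]] unfolding \<sigma>_def by auto
  have factor: "cmp C (\<pi> j) f = \<sigma> j \<longleftrightarrow> app (\<pi> j) (app f gen) = x j"
    if f: "f \<in> Hom C Gen L" and j: "j \<in> Ob J" for f j
    using generic[OF functor_Ob[OF D j] x[OF j]] cmp_Hom[OF category f \<pi>[OF j]] \<sigma>[OF j]
      app_cmp[OF f gen_in, of "\<pi> j"] by metis
  have "is_cone J C D Gen \<sigma>"
    unfolding is_cone_def
  proof (intro conjI ballI)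
    fix u assume u: "u \<in> Mor J"
    have ob: "src J u \<in> Ob J" "tgt J u \<in> Ob J" using J u by (auto simp: is_category_def)
    have Du: "fmor D u \<in> Hom C (fob D (src J u)) (fob D (tgt J u))"
      using functor_Hom[OF D Mor_in_Hom[OF u]] .
    show "cmp C (fmor D u) (\<sigma> (src J u)) = \<sigma> (tgt J u)"
      using generic[OF functor_Ob[OF D ob(2)] x[OF ob(2)]] cmp_Hom[OF category \<sigma>(1)[OF ob(1)] Du]
        \<sigma>[OF ob(2)] \<sigma>(2)[OF ob(1)] app_cmp[OF \<sigma>(1)[OF ob(1)] gen_in, of "fmor D u"] compat[OF u ob] by metis
  qed (use Gen_Ob \<sigma> in auto)
  then obtain f where f: "f \<in> Hom C Gen L" "\<And>j. j \<in> Ob J \<Longrightarrow> cmp C (\<pi> j) f = \<sigma> j"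
    and uniq: "\<And>g. g \<in> Hom C Gen L \<Longrightarrow> \<forall>j\<in>Ob J. cmp C (\<pi> j) g = \<sigma> j \<Longrightarrow> g = f"
    using univ by (metis (no_types, lifting))
  show ?thesis
  proof (rule ex1I[of _ "app f gen"])
    show "app f gen \<in> el L \<and> (\<forall>j\<in>Ob J. app (\<pi> j) (app f gen) = x j)"
      using app_in[OF f(1) gen_in] f(2) factor[OF f(1)] by blast
    fix l assume l: "l \<in> el L \<and> (\<forall>j\<in>Ob J. app (\<pi> j) l = x j)"
    then obtain g where g: "g \<in> Hom C Gen L" "app g gen = l" using generic[OF L] by blast
    then have "\<forall>j\<in>Ob J. cmp C (\<pi> j) g = \<sigma> j" using factor[OF g(1)] l by blast
    then show "l = app f gen" using uniq[OF g(1)] g by simp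
  qed
qed

lemma cone_compat:
  assumes J: "is_category J" and cone: "is_cone J C D L \<pi>" and u: "u \<in> Mor J" and l: "l \<in> el L"
  shows "app (fmor D u) (app (\<pi> (src J u)) l) = app (\<pi> (tgt J u)) l"
proof -
  have "src J u \<in> Ob J" using J u by (auto simp: is_category_def)
  then have "\<pi> (src J u) \<in> Hom C L (fob D (src J u))" using cone by (simp add: is_cone_def)
  then show ?thesis using app_cmp[of "\<pi> (src J u)" L _ l "fmor D u"] cone u l by (simp add: is_cone_def)
qed

text \<open>The coordinates of \<open>l\<close> form a compatible family, which comes from only one
  element of the limit.\<close>

lemma limit_jointly_inj:
  assumes D: "is_functor J C D" and lim: "is_limit J C D L \<pi>" and J: "is_category J"
    and l: "l \<in> el L" "l' \<in> el L" and eq: "\<And>j. j \<in> Ob J \<Longrightarrow> app (\<pi> j) l = app (\<pi> j) l'"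
  shows "l = l'"
proof -
  have cone: "is_cone J C D L \<pi>" using lim by (simp add: is_limit_def)
  have "\<exists>!k. k \<in> el L \<and> (\<forall>j\<in>Ob J. app (\<pi> j) k = app (\<pi> j) l)"
  proof (rule limit_elements[OF D lim _ _ J])
    show "app (\<pi> j) l \<in> el (fob D j)" if "j \<in> Ob J" for j
      using app_in[OF _ l(1)] cone that by (simp add: is_cone_def)
    show "app (fmor D u) (app (\<pi> (src J u)) l) = app (\<pi> (tgt J u)) l" if "u \<in> Mor J" for u
      using cone_compat[OF J cone that l(1)] .
  qed
  then obtain k where k: "\<And>k'. k' \<in> el L \<Longrightarrow> \<forall>j\<in>Ob J. app (\<pi> j) k' = app (\<pi> j) l \<Longrightarrow> k' = k"
    by (elim ex1E) blast
  have "l = k" by (rule k) (use l in simp_all)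
  moreover have "l' = k" by (rule k) (simp_all add: l eq)
  ultimately show ?thesis by simp
qed

text \<open>Converse of \<open>limit_elements\<close>: a jointly injective cone realizing every
  compatible family is a limit. Objects of J are natural numbers because
  \<open>initial_lift\<close>, being a locale assumption, cannot be polymorphic in its index
  type.\<close>

lemma is_limitI:
  fixes J :: "(nat, 'j) category"
  assumes D: "is_functor J C D" and J: "is_category J" and L: "L \<in> Ob C"
    and \<pi>: "\<And>j. j \<in> Ob J \<Longrightarrow> \<pi> j \<in> Hom C L (fob D j)"
    and \<pi>_compat: "\<And>u l. u \<in> Mor J \<Longrightarrow> l \<in> el L \<Longrightarrow> app (fmor D u) (app (\<pi> (src J u)) l) = app (\<pi> (tgt J u)) l"
    and ex: "\<And>x. (\<And>j. j \<in> Ob J \<Longrightarrow> x j \<in> el (fob D j)) \<Longrightarrow>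
      (\<And>u. u \<in> Mor J \<Longrightarrow> app (fmor D u) (x (src J u)) = x (tgt J u)) \<Longrightarrow>
      \<exists>l\<in>el L. \<forall>j\<in>Ob J. app (\<pi> j) l = x j"
    and inj: "\<And>l l'. l \<in> el L \<Longrightarrow> l' \<in> el L \<Longrightarrow> (\<forall>j\<in>Ob J. app (\<pi> j) l = app (\<pi> j) l') \<Longrightarrow> l = l'"
  shows "is_limit J C D L \<pi>"
proof -
  have cone: "is_cone J C D L \<pi>"
    unfolding is_cone_def
  proof (intro conjI ballI)
    fix u assume u: "u \<in> Mor J"
    have ob: "src J u \<in> Ob J" "tgt J u \<in> Ob J" using J u by (auto simp: is_category_def)
    have Du: "fmor D u \<in> Hom C (fob D (src J u)) (fob D (tgt J u))"
      using functor_Hom[OF D Mor_in_Hom[OF u]] .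
    show "cmp C (fmor D u) (\<pi> (src J u)) = \<pi> (tgt J u)"
      using cmp_Hom[OF category \<pi>[OF ob(1)] Du] \<pi>[OF ob(2)]
      by (rule mor_eqI) (simp add: app_cmp[OF \<pi>[OF ob(1)]] \<pi>_compat[OF u])
  qed (use L \<pi> in auto)
  moreover have "\<exists>!f. f \<in> Hom C X L \<and> (\<forall>j\<in>Ob J. cmp C (\<pi> j) f = \<sigma> j)"
    if \<sigma>: "is_cone J C D X \<sigma>" for X \<sigma>
  proof -
    have X: "X \<in> Ob C" and \<sigma>_Hom: "\<And>j. j \<in> Ob J \<Longrightarrow> \<sigma> j \<in> Hom C X (fob D j)"
      and \<sigma>_cone: "\<And>u. u \<in> Mor J \<Longrightarrow> cmp C (fmor D u) (\<sigma> (src J u)) = \<sigma> (tgt J u)"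
      using \<sigma> by (auto simp: is_cone_def)
    have "\<exists>l\<in>el L. \<forall>j\<in>Ob J. app (\<pi> j) l = app (\<sigma> j) x" if x: "x \<in> el X" for x
    proof (rule ex)
      show "app (\<sigma> j) x \<in> el (fob D j)" if "j \<in> Ob J" for j using app_in[OF \<sigma>_Hom[OF that] x] .
      show "app (fmor D u) (app (\<sigma> (src J u)) x) = app (\<sigma> (tgt J u)) x" if u: "u \<in> Mor J" for u
      proof -
        have "src J u \<in> Ob J" using J u by (auto simp: is_category_def)
        then show ?thesis using app_cmp[OF \<sigma>_Hom x, of "src J u" "fmor D u"] \<sigma>_cone[OF u] by simp
      qed
    qed
    \<comment> \<open>So far \<open>k\<close> is a mere function on elements;
      \<open>initial_lift\<close> promotes it to a morphism because the legs \<open>\<pi> j\<close>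
      are jointly injective.\<close>
    then obtain k where k: "\<And>x. x \<in> el X \<Longrightarrow> k x \<in> el L"
      "\<And>x j. x \<in> el X \<Longrightarrow> j \<in> Ob J \<Longrightarrow> app (\<pi> j) (k x) = app (\<sigma> j) x"
      by metis
    have "\<exists>f\<in>Hom C X L. \<forall>x\<in>el X. app f x = k x"
      by (rule initial_lift[where I = "Ob J" and \<pi> = \<pi> and D = "fob D" and \<sigma> = \<sigma>])
        (use X L k \<pi> inj \<sigma>_Hom in auto)
    then obtain f where f: "f \<in> Hom C X L" "\<And>x. x \<in> el X \<Longrightarrow> app f x = k x"
      by blast
    show ?thesis
    proof (rule ex1I[of _ f], intro conjI ballI)
      show "f \<in> Hom C X L" using f(1) .
      fix j assume j: "j \<in> Ob J"
      show "cmp C (\<pi> j) f = \<sigma> j"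
        using cmp_Hom[OF category f(1) \<pi>[OF j]] \<sigma>_Hom[OF j]
        by (rule mor_eqI) (simp add: app_cmp[OF f(1)] f(2) k(2) j)
    next
      fix g assume g: "g \<in> Hom C X L \<and> (\<forall>j\<in>Ob J. cmp C (\<pi> j) g = \<sigma> j)"
      then have gH: "g \<in> Hom C X L" by simp
      show "g = f"
        using gH f(1)
      proof (rule mor_eqI)
        fix x assume x: "x \<in> el X"
        have "\<forall>j\<in>Ob J. app (\<pi> j) (app g x) = app (\<pi> j) (k x)"
          using app_cmp[OF gH x] g k(2)[OF x] by metis
        then show "app g x = app f x" using inj[OF app_in[OF gH x] k(1)[OF x]] f(2)[OF x] by simp
      qed
    qed
  qed
  ultimately show ?thesis by (simp add: is_limit_def)
qed

end

text \<open>A compatible family in the subsets \<open>el' (fob F (fob D j))\<close> comes from an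
  element of L by \<open>limit_elements\<close>, and \<open>closed\<close> puts that element into
  the subset belonging to L. The criterion covers \<Delta>, where the subsets are everything, and
  the functors of elements fixed by an idempotent.\<close>

lemma preserves_finite_limits_subfunctor:
  assumes C: "concrete_category C el Gen gen" and E: "concrete_category E el' Gen' gen'"
    and F: "is_functor C E F"
    and sub: "\<And>X. X \<in> Ob C \<Longrightarrow> el' (fob F X) \<subseteq> el X"
    and app_F: "\<And>f X Y x. f \<in> Hom C X Y \<Longrightarrow> x \<in> el' (fob F X) \<Longrightarrow> app (fmor F f) x = app f x"
    and closed: "\<And>(I :: nat set) L \<pi> D l. L \<in> Ob C \<Longrightarrow> (\<And>j. j \<in> I \<Longrightarrow> \<pi> j \<in> Hom C L (D j)) \<Longrightarrow>
      (\<And>l l'. l \<in> el L \<Longrightarrow> l' \<in> el L \<Longrightarrow> (\<And>j. j \<in> I \<Longrightarrow> app (\<pi> j) l = app (\<pi> j) l') \<Longrightarrow> l = l') \<Longrightarrow>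
      l \<in> el L \<Longrightarrow> (\<And>j. j \<in> I \<Longrightarrow> app (\<pi> j) l \<in> el' (fob F (D j))) \<Longrightarrow> l \<in> el' (fob F L)"
  shows "preserves_finite_limits C E F"
  unfolding preserves_finite_limits_def preserves_limits_of_shape_def
proof (intro allI impI)
  interpret C: concrete_category C el Gen gen by (rule C)
  interpret E: concrete_category E el' Gen' gen' by (rule E)
  fix J :: "(nat, nat) category" and D L \<pi>
  assume J: "finite_category J" and D: "is_functor J C D" and lim: "is_limit J C D L \<pi>"
  have J: "is_category J" using J by (simp add: finite_category_def)
  have cone: "is_cone J C D L \<pi>" using lim by (simp add: is_limit_def)
  have L: "L \<in> Ob C" and \<pi>: "\<And>j. j \<in> Ob J \<Longrightarrow> \<pi> j \<in> Hom C L (fob D j)"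
    using cone by (auto simp: is_cone_def)
  have J_ob: "src J u \<in> Ob J" "tgt J u \<in> Ob J" if "u \<in> Mor J" for u
    using J that by (auto simp: is_category_def)
  have Du: "fmor D u \<in> Hom C (fob D (src J u)) (fob D (tgt J u))" if "u \<in> Mor J" for u
    using functor_Hom[OF D Mor_in_Hom[OF that]] .
  have F\<pi>: "app (fmor F (\<pi> j)) l = app (\<pi> j) l" if "j \<in> Ob J" "l \<in> el' (fob F L)" for j l
    using app_F[OF \<pi>[OF that(1)] that(2)] .
  have F\<pi>_in: "app (\<pi> j) l \<in> el' (fob F (fob D j))" if "j \<in> Ob J" "l \<in> el' (fob F L)" for j l
    using E.app_in[OF functor_Hom[OF F \<pi>[OF that(1)]] that(2)] F\<pi>[OF that] by simp
  show "is_limit J E (functor_comp F D) (fob F L) (\<lambda>j. fmor F (\<pi> j))"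
  proof (rule E.is_limitI[OF is_functor_comp[OF D F] J functor_Ob[OF F L]])
    show "fmor F (\<pi> j) \<in> Hom E (fob F L) (fob (functor_comp F D) j)" if "j \<in> Ob J" for j
      using functor_Hom[OF F \<pi>[OF that]] by (simp add: functor_comp_def)
    show "app (fmor (functor_comp F D) u) (app (fmor F (\<pi> (src J u))) l) = app (fmor F (\<pi> (tgt J u))) l"
      if u: "u \<in> Mor J" and l: "l \<in> el' (fob F L)" for u l
    proof -
      have "l \<in> el L" using sub[OF L] l by blast
      then show ?thesis
        using C.cone_compat[OF J cone u] app_F[OF Du[OF u] F\<pi>_in[OF J_ob(1)[OF u] l]]
          F\<pi>[OF J_ob(1)[OF u] l] F\<pi>[OF J_ob(2)[OF u] l] by (simp add: functor_comp_def)
    qed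
    show "l = l'" if l: "l \<in> el' (fob F L)" "l' \<in> el' (fob F L)"
      and eq: "\<forall>j\<in>Ob J. app (fmor F (\<pi> j)) l = app (fmor F (\<pi> j)) l'" for l l'
      by (rule C.limit_jointly_inj[OF D lim J]) (use sub[OF L] l eq F\<pi> in auto)
    fix x assume x: "\<And>j. j \<in> Ob J \<Longrightarrow> x j \<in> el' (fob (functor_comp F D) j)"
      and compat: "\<And>u. u \<in> Mor J \<Longrightarrow> app (fmor (functor_comp F D) u) (x (src J u)) = x (tgt J u)"
    have x': "x j \<in> el' (fob F (fob D j))" if "j \<in> Ob J" for j
      using x[OF that] by (simp add: functor_comp_def)
    have "\<exists>!l. l \<in> el L \<and> (\<forall>j\<in>Ob J. app (\<pi> j) l = x j)"
    proof (rule C.limit_elements[OF D lim _ _ J])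
      show "x j \<in> el (fob D j)" if "j \<in> Ob J" for j
        using x'[OF that] sub[OF functor_Ob[OF D that]] by blast
      show "app (fmor D u) (x (src J u)) = x (tgt J u)" if "u \<in> Mor J" for u
        using compat[OF that] app_F[OF Du[OF that] x'[OF J_ob(1)[OF that]]] by (simp add: functor_comp_def)
    qed
    then obtain l where l: "l \<in> el L" "\<And>j. j \<in> Ob J \<Longrightarrow> app (\<pi> j) l = x j" by blast
    have "l \<in> el' (fob F L)"
      by (rule closed[where I = "Ob J" and D = "fob D" and \<pi> = \<pi>])
        (use L \<pi> C.limit_jointly_inj[OF D lim J] l x' in auto)
    then show "\<exists>l\<in>el' (fob F L). \<forall>j\<in>Ob J. app (fmor F (\<pi> j)) l = x j"
      using F\<pi> l(2) by force
  qed
qed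

section \<open>Small sets and small \<open>M\<close>-sets\<close>

lemma small_subset: "small U A \<Longrightarrow> B \<subseteq> A \<Longrightarrow> small U B"
  unfolding small_def using subset_imp_lepoll lesspoll_trans1 by blast

lemma small_finite: "infinite U \<Longrightarrow> finite A \<Longrightarrow> A \<subseteq> U \<Longrightarrow> small U A"
  unfolding small_def using finite_lesspoll_infinite by blast

lemma Ob_Set [simp]: "A \<in> Ob (Set_cat U) \<longleftrightarrow> small U A"
  by (simp add: Set_cat_def)

lemma Hom_Set: "f \<in> Hom (Set_cat U) A B \<longleftrightarrow>
    small U A \<and> small U B \<and> fst f = A \<and> snd (snd f) = B \<and> app f \<in> A \<rightarrow>\<^sub>E B"
  by (cases f) (auto simp: Hom_def Set_cat_def)

lemma cmp_Set: "cmp (Set_cat U) g f = (fst f, compose (fst f) (app g) (app f), snd (snd g))"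
  by (simp add: Set_cat_def)

lemma ident_Set: "ident (Set_cat U) A = (A, \<lambda>x\<in>A. x, A)"
  by (simp add: Set_cat_def)

lemma src_Set [simp]: "src (Set_cat U) = fst" and tgt_Set [simp]: "tgt (Set_cat U) = (\<lambda>t. snd (snd t))"
  by (simp_all add: Set_cat_def)

lemma app_cmp_Set: "x \<in> fst f \<Longrightarrow> app (cmp (Set_cat U) g f) x = app g (app f x)"
  by (simp add: cmp_Set compose_def)

lemma is_category_Set: "is_category (Set_cat U)"
  unfolding is_category_def Hom_def
  by (auto simp: Set_cat_def compose_def PiE_iff extensional_def fun_eq_iff)

lemma Set_mor_eqI:
  assumes "f \<in> Hom (Set_cat U) A B" "g \<in> Hom (Set_cat U) A B" "\<And>x. x \<in> A \<Longrightarrow> app f x = app g x"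
  shows "f = g"
proof -
  have "app f = app g"
    by (rule PiE_ext[of _ A "\<lambda>_. B"]) (use assms in \<open>auto simp: Hom_Set\<close>)
  then show ?thesis using assms(1,2) by (auto simp: Hom_Set prod_eq_iff)
qed

section \<open>The category of small right M-sets\<close>

lemma Ob_PSh: "X \<in> Ob (PSh M U) \<longleftrightarrow> right_mset M X \<and> small U (pts X)"
  by (simp add: PSh_def)

lemma Hom_PSh: "f \<in> Hom (PSh M U) X Y \<longleftrightarrow> X \<in> Ob (PSh M U) \<and> Y \<in> Ob (PSh M U) \<and>
    fst f = X \<and> snd (snd f) = Y \<and> app f \<in> pts X \<rightarrow>\<^sub>E pts Y \<and> equivariant M X Y (app f)"
  by (cases f) (auto simp: Hom_def PSh_def)

lemma cmp_PSh: "cmp (PSh M U) g f = (fst f, compose (pts (fst f)) (app g) (app f), snd (snd g))"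
  by (simp add: PSh_def)

lemma ident_PSh: "ident (PSh M U) X = (X, \<lambda>x\<in>pts X. x, X)"
  by (simp add: PSh_def)

lemma src_PSh [simp]: "src (PSh M U) = fst" and tgt_PSh [simp]: "tgt (PSh M U) = (\<lambda>t. snd (snd t))"
  by (simp_all add: PSh_def)

lemma app_cmp_PSh: "x \<in> pts (fst f) \<Longrightarrow> app (cmp (PSh M U) g f) x = app g (app f x)"
  by (simp add: cmp_PSh compose_def)

lemma act_in: "X \<in> Ob (PSh M U) \<Longrightarrow> x \<in> pts X \<Longrightarrow> m \<in> carrier M \<Longrightarrow> act X x m \<in> pts X"
  by (simp add: Ob_PSh right_mset_def)

lemma act_one: "X \<in> Ob (PSh M U) \<Longrightarrow> x \<in> pts X \<Longrightarrow> act X x \<one>\<^bsub>M\<^esub> = x"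
  by (simp add: Ob_PSh right_mset_def)

lemma act_mult: "X \<in> Ob (PSh M U) \<Longrightarrow> x \<in> pts X \<Longrightarrow> m \<in> carrier M \<Longrightarrow> n \<in> carrier M \<Longrightarrow>
    act X x (m \<otimes>\<^bsub>M\<^esub> n) = act X (act X x m) n"
  by (simp add: Ob_PSh right_mset_def)

lemma app_PSh_in: "f \<in> Hom (PSh M U) X Y \<Longrightarrow> x \<in> pts X \<Longrightarrow> app f x \<in> pts Y"
  by (auto simp: Hom_PSh)

lemma app_act: "f \<in> Hom (PSh M U) X Y \<Longrightarrow> x \<in> pts X \<Longrightarrow> m \<in> carrier M \<Longrightarrow>
    app f (act X x m) = act Y (app f x) m"
  by (simp add: Hom_PSh equivariant_def)

lemma PSh_homI:
  assumes "X \<in> Ob (PSh M U)" "Y \<in> Ob (PSh M U)" "\<And>x. x \<in> pts X \<Longrightarrow> k x \<in> pts Y"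
    and "\<And>x m. x \<in> pts X \<Longrightarrow> m \<in> carrier M \<Longrightarrow> k (act X x m) = act Y (k x) m"
  shows "(X, restrict k (pts X), Y) \<in> Hom (PSh M U) X Y"
  using assms by (auto simp: Hom_PSh equivariant_def act_in)

lemma Set_homI:
  assumes "small U A" "small U B" "\<And>x. x \<in> A \<Longrightarrow> k x \<in> B"
  shows "(A, restrict k A, B) \<in> Hom (Set_cat U) A B"
  using assms by (auto simp: Hom_Set)

lemma PSh_mor_eqI:
  assumes "f \<in> Hom (PSh M U) X Y" "g \<in> Hom (PSh M U) X Y" "\<And>x. x \<in> pts X \<Longrightarrow> app f x = app g x"
  shows "f = g"
proof -
  have "app f = app g"
    by (rule PiE_ext[of _ "pts X" "\<lambda>_. pts Y"]) (use assms in \<open>auto simp: Hom_PSh\<close>)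
  then show ?thesis using assms(1,2) by (auto simp: Hom_PSh prod_eq_iff)
qed

lemma fixed_points_act: "x \<in> fixed_points M X \<Longrightarrow> m \<in> carrier M \<Longrightarrow> act X x m = x"
  by (simp add: fixed_points_def)

lemma fixed_points_subset: "fixed_points M X \<subseteq> pts X"
  by (auto simp: fixed_points_def)

lemma app_fixed_points:
  "f \<in> Hom (PSh M U) X Y \<Longrightarrow> x \<in> fixed_points M X \<Longrightarrow> app f x \<in> fixed_points M Y"
  using app_act[of f M U X Y x] app_PSh_in[of f M U X Y x] by (auto simp: fixed_points_def)

lemma right_absorbingD: "right_absorbing M r \<Longrightarrow> r \<in> carrier M"
  "right_absorbing M r \<Longrightarrow> n \<in> carrier M \<Longrightarrow> r \<otimes>\<^bsub>M\<^esub> n = r"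
  by (auto simp: right_absorbing_def)

lemma act_right_absorbing:
  assumes "X \<in> Ob (PSh M U)" "x \<in> pts X" "right_absorbing M r"
  shows "act X x r \<in> fixed_points M X"
  using assms by (auto simp: fixed_points_def act_in right_absorbingD simp flip: act_mult)

context monoid
begin

lemma is_category_PSh: "is_category (PSh G U)"
  unfolding is_category_def
proof (intro conjI ballI impI)
  fix f assume "f \<in> Mor (PSh G U)"
  then have f: "f \<in> Hom (PSh G U) (fst f) (snd (snd f))" using Mor_in_Hom[of f "PSh G U"] by simp
  show "src (PSh G U) f \<in> Ob (PSh G U)" "tgt (PSh G U) f \<in> Ob (PSh G U)" using f by (auto simp: Hom_PSh)
  show "cmp (PSh G U) f (ident (PSh G U) (src (PSh G U) f)) = f"
    "cmp (PSh G U) (ident (PSh G U) (tgt (PSh G U) f)) f = f"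
    using f by (auto simp: Hom_PSh cmp_PSh ident_PSh compose_def prod_eq_iff PiE_iff extensional_def fun_eq_iff)
  fix g assume "g \<in> Mor (PSh G U)" "tgt (PSh G U) f = src (PSh G U) g"
  then have g: "g \<in> Hom (PSh G U) (snd (snd f)) (snd (snd g))" using Mor_in_Hom[of g "PSh G U"] by simp
  show gf: "cmp (PSh G U) g f \<in> Hom (PSh G U) (src (PSh G U) f) (tgt (PSh G U) g)"
    using f g by (auto simp: Hom_PSh cmp_PSh compose_def equivariant_def act_in)
  fix h assume "h \<in> Mor (PSh G U)" "tgt (PSh G U) g = src (PSh G U) h"
  then have h: "h \<in> Hom (PSh G U) (snd (snd g)) (snd (snd h))" using Mor_in_Hom[of h "PSh G U"] by simp
  show "cmp (PSh G U) h (cmp (PSh G U) g f) = cmp (PSh G U) (cmp (PSh G U) h g) f"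
    using f g h by (auto simp: Hom_PSh cmp_PSh compose_def fun_eq_iff)
next
  fix X assume X: "X \<in> Ob (PSh G U)"
  then show "ident (PSh G U) X \<in> Hom (PSh G U) X X"
    by (auto simp: ident_PSh Hom_PSh equivariant_def act_in)
qed

end

locale mset_universe = monoid M for M :: "('m, 'z) monoid_scheme" (structure) +
  fixes U :: "'u set"
  assumes universe: "universe_for M U"
begin

lemma infinite_U: "infinite U"
  using universe by (simp add: universe_for_def)

lemma maps_lesspoll: "small U A \<Longrightarrow> (carrier M \<rightarrow>\<^sub>E A) \<prec> U"
  using universe by (simp add: universe_for_def)

text \<open>Names a point of U, from which the generator \<open>{base}\<close> of sets and the
  terminal M-set are made; together with \<open>other\<close> it gives a two-element small
  set.\<close>

definition base :: 'u where "base = (SOME u. u \<in> U)"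

lemma base_in: "base \<in> U"
  unfolding base_def using infinite_U by (metis infinite_imp_nonempty someI_ex ex_in_conv)

definition other :: 'u where "other = (SOME u. u \<in> U - {base})"

lemma other_in: "other \<in> U" and other_neq: "other \<noteq> base"
proof -
  have "U - {base} \<noteq> {}" using infinite_U by (metis finite.emptyI infinite_remove)
  then have "other \<in> U - {base}" unfolding other_def by (metis someI_ex ex_in_conv)
  then show "other \<in> U" "other \<noteq> base" by auto
qed

text \<open>Indicator functions of single elements embed M into the maps from M to
  \<open>{base, other}\<close>, a set that the universe condition bounds.\<close>

lemma carrier_lesspoll: "carrier M \<prec> U"
proof -
  have inj: "inj_on (\<lambda>m. \<lambda>n\<in>carrier M. if n = m then base else other) (carrier M)"
  proof (rule inj_onI)
    fix m m' assume m: "m \<in> carrier M"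
      and eq: "(\<lambda>n\<in>carrier M. if n = m then base else other) = (\<lambda>n\<in>carrier M. if n = m' then base else other)"
    from fun_cong[OF eq, of m] show "m = m'" using m other_neq by (simp split: if_splits)
  qed
  have "(\<lambda>m. \<lambda>n\<in>carrier M. if n = m then base else other) ` carrier M \<subseteq> carrier M \<rightarrow>\<^sub>E {base, other}"
    by auto
  then have "carrier M \<lesssim> (carrier M \<rightarrow>\<^sub>E {base, other})" using inj unfolding lepoll_def by blast
  moreover have "small U {base, other}" using small_finite[OF infinite_U] base_in other_in by simp
  ultimately show ?thesis using maps_lesspoll lesspoll_trans1 by blast
qed

section \<open>The regular M-set\<close>

text \<open>Elements of M have a type of their own, so the regular M-set lives on a copy of M inside
  U.\<close>

definition reg_code :: "'m \<Rightarrow> 'u" where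
  "reg_code = (SOME g. inj_on g (carrier M) \<and> g ` carrier M \<subseteq> U)"

lemma reg_code: "inj_on reg_code (carrier M)" "reg_code ` carrier M \<subseteq> U"
proof -
  have "\<exists>g. inj_on g (carrier M) \<and> g ` carrier M \<subseteq> U"
    using carrier_lesspoll unfolding lesspoll_def lepoll_def by blast
  from someI_ex[OF this] show "inj_on reg_code (carrier M)" "reg_code ` carrier M \<subseteq> U"
    unfolding reg_code_def by auto
qed

definition Reg :: "('u, 'm) rset" where
  "Reg = \<lparr>pts = reg_code ` carrier M, act = (\<lambda>x m. reg_code (inv_into (carrier M) reg_code x \<otimes> m))\<rparr>"

lemma pts_Reg: "pts Reg = reg_code ` carrier M"
  by (simp add: Reg_def)

lemma act_Reg: "m \<in> carrier M \<Longrightarrow> act Reg (reg_code m) n = reg_code (m \<otimes> n)"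
  by (simp add: Reg_def reg_code(1))

lemma reg_code_in: "m \<in> carrier M \<Longrightarrow> reg_code m \<in> pts Reg"
  by (simp add: pts_Reg)

lemma Reg_Ob: "Reg \<in> Ob (PSh M U)"
proof -
  have "reg_code ` carrier M \<prec> U" using image_lepoll carrier_lesspoll lesspoll_trans1 by blast
  then have "small U (pts Reg)" using reg_code by (simp add: small_def pts_Reg)
  moreover have "right_mset M Reg"
    unfolding right_mset_def pts_Reg by (auto simp: act_Reg m_assoc)
  ultimately show ?thesis by (simp add: Ob_PSh)
qed

text \<open>Equivariance forces the value at \<open>reg_code m\<close> to be xm. This is what makes
  \<open>Reg\<close> represent the underlying-set functor.\<close>

lemma Reg_generic:
  assumes X: "X \<in> Ob (PSh M U)" and x: "x \<in> pts X"
  shows "\<exists>!f. f \<in> Hom (PSh M U) Reg X \<and> app f (reg_code \<one>) = x"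
proof (rule ex_ex1I)
  let ?f = "(Reg, \<lambda>z\<in>pts Reg. act X x (inv_into (carrier M) reg_code z), X)"
  have "?f \<in> Hom (PSh M U) Reg X"
    by (rule PSh_homI[OF Reg_Ob X])
      (use x reg_code(1) in \<open>auto simp: pts_Reg act_Reg act_in[OF X] act_mult[OF X]\<close>)
  moreover have "app ?f (reg_code \<one>) = x"
    using reg_code(1) x by (simp add: pts_Reg act_one[OF X])
  ultimately show "\<exists>f. f \<in> Hom (PSh M U) Reg X \<and> app f (reg_code \<one>) = x" by blast
next
  fix f g assume f: "f \<in> Hom (PSh M U) Reg X \<and> app f (reg_code \<one>) = x"
    and g: "g \<in> Hom (PSh M U) Reg X \<and> app g (reg_code \<one>) = x"
  show "f = g"
  proof (rule PSh_mor_eqI)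
    fix z assume "z \<in> pts Reg"
    then obtain m where m: "m \<in> carrier M" "z = act Reg (reg_code \<one>) m"
      by (auto simp: pts_Reg act_Reg)
    then show "app f z = app g z"
      using f g app_act[of f M U Reg X "reg_code \<one>" m] app_act[of g M U Reg X "reg_code \<one>" m]
      by (simp add: reg_code_in)
  qed (use f g in auto)
qed

lemma fixed_points_Reg:
  assumes "z \<in> fixed_points M Reg"
  shows "\<exists>r. right_absorbing M r"
proof -
  obtain r where r: "r \<in> carrier M" "z = reg_code r" using assms by (auto simp: fixed_points_def pts_Reg)
  have "r \<otimes> n = r" if n: "n \<in> carrier M" for n
    using fixed_points_act[OF assms n] r act_Reg[OF r(1)] inj_onD[OF reg_code(1), of "r \<otimes> n" r] n by simp
  then show ?thesis using r by (auto simp: right_absorbing_def)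
qed

sublocale PSh: concrete_category "PSh M U" pts Reg "reg_code \<one>"
proof
  show "is_category (PSh M U)" using is_category_PSh .
  show "reg_code \<one> \<in> pts Reg" by (simp add: reg_code_in)
  show "Reg \<in> Ob (PSh M U)" using Reg_Ob .
  show "\<exists>!f. f \<in> Hom (PSh M U) Reg X \<and> app f (reg_code \<one>) = x" if "X \<in> Ob (PSh M U)" "x \<in> pts X" for X x
    using Reg_generic[OF that] .
  show "app (cmp (PSh M U) g f) x = app g (app f x)" if "f \<in> Hom (PSh M U) X Y" "x \<in> pts X" for f X Y x g
    using that by (simp add: app_cmp_PSh Hom_PSh)
next
  fix X L :: "('u, 'm) rset" and k \<pi> D \<sigma> and I :: "nat set"
  assume X: "X \<in> Ob (PSh M U)" and L: "L \<in> Ob (PSh M U)" and k: "\<And>x. x \<in> pts X \<Longrightarrow> k x \<in> pts L"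
    and \<pi>: "\<And>j. j \<in> I \<Longrightarrow> \<pi> j \<in> Hom (PSh M U) L (D j)"
    and inj: "\<And>l l'. l \<in> pts L \<Longrightarrow> l' \<in> pts L \<Longrightarrow> \<forall>j\<in>I. app (\<pi> j) l = app (\<pi> j) l' \<Longrightarrow> l = l'"
    and \<sigma>: "\<And>j. j \<in> I \<Longrightarrow> \<sigma> j \<in> Hom (PSh M U) X (D j)"
    and k\<sigma>: "\<And>j x. j \<in> I \<Longrightarrow> x \<in> pts X \<Longrightarrow> app (\<sigma> j) x = app (\<pi> j) (k x)"
  \<comment> \<open>Equivariance of \<open>k\<close> can be tested after the jointly injective
    \<open>\<pi> j\<close>, where it follows from that of \<open>\<sigma> j\<close> and
    \<open>\<pi> j\<close>.\<close>
  have "(X, restrict k (pts X), L) \<in> Hom (PSh M U) X L"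
  proof (rule PSh_homI[OF X L k])
    fix x m assume x: "x \<in> pts X" and m: "m \<in> carrier M"
    show "k (act X x m) = act L (k x) m"
      by (rule inj[OF k[OF act_in[OF X x m]] act_in[OF L k[OF x] m]])
        (simp add: k\<sigma>[OF _ act_in[OF X x m], symmetric] app_act[OF \<sigma> x m] app_act[OF \<pi> k[OF x] m] k\<sigma>[OF _ x])
  qed
  then show "\<exists>f\<in>Hom (PSh M U) X L. \<forall>x\<in>pts X. app f x = k x" by (rule bexI[rotated]) simp
qed (fact app_PSh_in PSh_mor_eqI)+

sublocale Set: concrete_category "Set_cat U" "\<lambda>A. A" "{base}" base
proof
  show "is_category (Set_cat U)" using is_category_Set .
  show "{base} \<in> Ob (Set_cat U)" using small_finite[OF infinite_U, of "{base}"] base_in by simp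
  show "base \<in> {base}" by simp
  show "app f x \<in> Y" if "f \<in> Hom (Set_cat U) X Y" "x \<in> X" for f X Y x
    using that by (auto simp: Hom_Set)
  show "app (cmp (Set_cat U) g f) x = app g (app f x)" if "f \<in> Hom (Set_cat U) X Y" "x \<in> X" for f X Y x g
    using that by (simp add: app_cmp_Set Hom_Set)
  show "f = g" if "f \<in> Hom (Set_cat U) X Y" "g \<in> Hom (Set_cat U) X Y" "\<And>x. x \<in> X \<Longrightarrow> app f x = app g x" for f g X Y
    using Set_mor_eqI that .
next
  fix X :: "'u set" and x assume X: "X \<in> Ob (Set_cat U)" and x: "x \<in> X"
  have "({base}, restrict (\<lambda>_. x) {base}, X) \<in> Hom (Set_cat U) {base} X"
    using Set_homI[of U "{base}" X "\<lambda>_. x"] X x small_finite[OF infinite_U, of "{base}"] base_in by simp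
  moreover have "f = g" if "f \<in> Hom (Set_cat U) {base} X" "app f base = x"
    "g \<in> Hom (Set_cat U) {base} X" "app g base = x" for f g
    using Set_mor_eqI[OF that(1,3)] that(2,4) by simp
  ultimately show "\<exists>!f. f \<in> Hom (Set_cat U) {base} X \<and> app f base = x"
    by (intro ex_ex1I exI[of _ "({base}, restrict (\<lambda>_. x) {base}, X)"]) auto
next
  fix X L :: "'u set" and k
  assume "X \<in> Ob (Set_cat U)" "L \<in> Ob (Set_cat U)" "\<And>x. x \<in> X \<Longrightarrow> k x \<in> L"
  then have "(X, restrict k X, L) \<in> Hom (Set_cat U) X L" by (intro Set_homI) simp_all
  then show "\<exists>f\<in>Hom (Set_cat U) X L. \<forall>x\<in>X. app f x = k x" by (rule bexI[rotated]) simp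
qed

subsection \<open>Doubling away from a subset\<close>

text \<open>Epimorphisms are shown to be surjective by comparing the two maps from the codomain into two
  copies of it glued along the image.\<close>

definition dbl :: "bool \<times> 'u \<Rightarrow> 'u" where
  "dbl = (SOME d. inj_on d (UNIV \<times> U) \<and> d ` (UNIV \<times> U) \<subseteq> U)"

lemma dbl: "inj_on dbl (UNIV \<times> U)" "dbl ` (UNIV \<times> U) \<subseteq> U"
proof -
  have "(UNIV :: bool set) \<lesssim> U" 
    by (rule lesspoll_imp_lepoll[OF finite_lesspoll_infinite[OF infinite_U]]) simp
  then have "(UNIV :: bool set) \<times> U \<lesssim> U \<times> U" by (intro times_lepoll_mono) auto
  moreover have "U \<times> U \<lesssim> U"
    unfolding lepoll_iff_ordLeq by (rule ordIso_imp_ordLeq[OF card_of_Times_same_infinite[OF infinite_U]])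
  ultimately have "(UNIV :: bool set) \<times> U \<lesssim> U" using lepoll_trans by blast
  then have "\<exists>d. inj_on d ((UNIV :: bool set) \<times> U) \<and> d ` (UNIV \<times> U) \<subseteq> U" unfolding lepoll_def .
  from someI_ex[OF this] show "inj_on dbl (UNIV \<times> U)" "dbl ` (UNIV \<times> U) \<subseteq> U"
    unfolding dbl_def by auto
qed

text \<open>The pushout of two copies of A along S: elements of S occur only with tag
  \<open>False\<close>, all others with both tags.\<close>

definition double :: "'u set \<Rightarrow> 'u set \<Rightarrow> 'u set" where
  "double A S = dbl ` {(b, y). y \<in> A \<and> (b \<longrightarrow> y \<notin> S)}"

text \<open>The map of glued doubles induced by f, where S is the glued subset on the codomain side:
  the tag is kept, but reset to \<open>False\<close> once the value lies in S.\<close>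

definition double_map :: "('u \<Rightarrow> 'u) \<Rightarrow> 'u set \<Rightarrow> 'u \<Rightarrow> 'u" where
  "double_map f S z = (let (b, y) = inv_into (UNIV \<times> U) dbl z in dbl (b \<and> f y \<notin> S, f y))"

lemma double_map_dbl: "y \<in> U \<Longrightarrow> double_map f S (dbl (b, y)) = dbl (b \<and> f y \<notin> S, f y)"
  by (simp add: double_map_def dbl(1))

lemma dbl_eq_iff: "y \<in> U \<Longrightarrow> y' \<in> U \<Longrightarrow> dbl (b, y) = dbl (b', y') \<longleftrightarrow> b = b' \<and> y = y'"
  using inj_on_eq_iff[OF dbl(1), of "(b, y)" "(b', y')"] by simp

lemma doubleE:
  assumes "z \<in> double A S"
  obtains b y where "z = dbl (b, y)" "y \<in> A" "b \<longrightarrow> y \<notin> S"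
  using assms by (auto simp: double_def)

lemma doubleI: "y \<in> A \<Longrightarrow> b \<longrightarrow> y \<notin> S \<Longrightarrow> dbl (b, y) \<in> double A S"
  by (auto simp: double_def)

lemma small_double:
  assumes "small U A"
  shows "small U (double A S)"
proof -
  have A: "A \<subseteq> U" "A \<prec> U" using assms by (auto simp: small_def)
  have "(UNIV :: bool set) \<times> A \<prec> U"
    by (rule times_lesspoll[OF infinite_U _ A(2)]) (rule finite_lesspoll_infinite[OF infinite_U], simp)
  then have "dbl ` (UNIV \<times> A) \<prec> U" using image_lepoll lesspoll_trans1 by blast
  moreover have "dbl ` (UNIV \<times> A) \<subseteq> U" using dbl(2) A(1) by blast
  ultimately have "small U (dbl ` (UNIV \<times> A))" by (simp add: small_def)
  then show ?thesis by (rule small_subset) (auto simp: double_def)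
qed

lemma PSh_epi_surj:
  assumes epi: "epi_in (PSh M U) f" and f: "f \<in> Hom (PSh M U) X Y" and y: "y \<in> pts Y"
  shows "\<exists>x\<in>pts X. app f x = y"
proof (rule ccontr)
  define S where "S = app f ` pts X"
  assume "\<not> (\<exists>x\<in>pts X. app f x = y)"
  then have yS: "y \<notin> S" by (auto simp: S_def)
  have X: "X \<in> Ob (PSh M U)" and Y: "Y \<in> Ob (PSh M U)" using f by (auto simp: Hom_PSh)
  have YU: "u \<in> U" if "u \<in> pts Y" for u using that Y by (auto simp: Ob_PSh small_def)
  \<comment> \<open>The image is closed under the action. A point that has entered S and lost its
    tag therefore stays in S, which is what associativity of the action on Z requires.\<close>
  have Sact: "act Y s m \<in> S" if "s \<in> S" "m \<in> carrier M" for s m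
    using that app_act[OF f] act_in[OF X] by (auto simp: S_def image_iff) metis
  define Z where "Z = \<lparr>pts = double (pts Y) S, act = (\<lambda>z m. double_map (\<lambda>v. act Y v m) S z)\<rparr>"
  have actZ: "act Z (dbl (b, v)) m = dbl (b \<and> act Y v m \<notin> S, act Y v m)" if "v \<in> pts Y" for b v m
    using YU[OF that] by (simp add: Z_def double_map_dbl)
  have "right_mset M Z"
    unfolding right_mset_def
  proof (intro conjI ballI)
    fix z assume "z \<in> pts Z"
    then obtain b v where z: "z = dbl (b, v)" "v \<in> pts Y" "b \<longrightarrow> v \<notin> S"
      by (auto simp: Z_def elim: doubleE)
    show "act Z z \<one> = z" using z by (cases b) (simp_all add: actZ act_one[OF Y])
    fix m assume m: "m \<in> carrier M"
    show "act Z z m \<in> pts Z" using z m by (simp add: actZ act_in[OF Y]) (simp add: Z_def doubleI act_in[OF Y])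
    fix n assume n: "n \<in> carrier M"
    show "act Z z (m \<otimes> n) = act Z (act Z z m) n"
      using z m n Sact[OF _ n] by (cases "act Y v m \<in> S") (simp_all add: actZ act_in[OF Y] act_mult[OF Y])
  qed
  then have Z: "Z \<in> Ob (PSh M U)" using small_double Y by (simp add: Ob_PSh Z_def)
  \<comment> \<open>The two inclusions of Y into the double; they agree exactly on the image
    S.\<close>
  define g where "g b = (Y, restrict (\<lambda>v. dbl (b \<and> v \<notin> S, v)) (pts Y), Z)" for b
  have g: "g b \<in> Hom (PSh M U) Y Z" for b
    unfolding g_def
  proof (rule PSh_homI[OF Y Z])
    show "dbl (b \<and> v \<notin> S, v) \<in> pts Z" if "v \<in> pts Y" for v
      using that by (simp add: Z_def doubleI)
    show "dbl (b \<and> act Y v m \<notin> S, act Y v m) = act Z (dbl (b \<and> v \<notin> S, v)) m"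
      if "v \<in> pts Y" "m \<in> carrier M" for v m
      using that Sact by (cases "v \<in> S") (simp_all add: actZ)
  qed
  have "cmp (PSh M U) (g False) f = cmp (PSh M U) (g True) f"
  proof (rule PSh_mor_eqI[OF cmp_Hom[OF is_category_PSh f g] cmp_Hom[OF is_category_PSh f g]])
    fix x assume x: "x \<in> pts X"
    then have "app f x \<in> S" by (simp add: S_def)
    then show "app (cmp (PSh M U) (g False) f) x = app (cmp (PSh M U) (g True) f) x"
      using app_PSh_in[OF f x] by (simp add: PSh.app_cmp[OF f x] g_def)
  qed
  then have "g False = g True" by (rule epi_in_cancel[OF epi f g g])
  then have "app (g False) y = app (g True) y" by simp
  then show False using y yS YU[OF y] by (simp add: g_def dbl_eq_iff)
qed

text \<open>A missed point y is detected by two maps to a two-element set that differ only at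
  y.\<close>

lemma Set_epi_surj:
  assumes epi: "epi_in (Set_cat U) f" and f: "f \<in> Hom (Set_cat U) A B" and y: "y \<in> B"
  shows "\<exists>x\<in>A. app f x = y"
proof (rule ccontr)
  assume no: "\<not> (\<exists>x\<in>A. app f x = y)"
  define Z where "Z = {base, other}"
  have Z: "small U Z" using small_finite[OF infinite_U] base_in other_in by (simp add: Z_def)
  have B: "small U B" using f by (simp add: Hom_Set)
  define g where "g w = (B, restrict (\<lambda>v. if v = y then w else base) B, Z)" for w
  have g: "g w \<in> Hom (Set_cat U) B Z" if "w \<in> Z" for w
    unfolding g_def by (rule Set_homI[OF B Z]) (use that in \<open>auto simp: Z_def\<close>)
  have gs: "g base \<in> Hom (Set_cat U) B Z" "g other \<in> Hom (Set_cat U) B Z"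
    by (rule g, simp add: Z_def)+
  have "cmp (Set_cat U) (g base) f = cmp (Set_cat U) (g other) f"
  proof (rule Set_mor_eqI[OF cmp_Hom[OF is_category_Set f gs(1)] cmp_Hom[OF is_category_Set f gs(2)]])
    fix x assume x: "x \<in> A"
    then show "app (cmp (Set_cat U) (g base) f) x = app (cmp (Set_cat U) (g other) f) x"
      using Set.app_in[OF f x] no by (auto simp: Set.app_cmp[OF f x] g_def)
  qed
  then have "g base = g other" by (rule epi_in_cancel[OF epi f gs])
  then have "app (g base) y = app (g other) y" by simp
  then show False using y other_neq by (simp add: g_def)
qed

end

section \<open>Discrete objects, fixed points and components\<close>

lemma pts_Delta [simp]: "pts (fob Delta A) = A" and act_Delta [simp]: "act (fob Delta A) x m = x"
  by (simp_all add: Delta_def)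

lemma fmor_Delta: "fmor Delta f = (fob Delta (fst f), app f, fob Delta (snd (snd f)))"
  by (cases f) (simp add: Delta_def)

lemma Delta_Ob: "fob Delta A \<in> Ob (PSh M U) \<longleftrightarrow> small U A"
  by (simp add: Ob_PSh right_mset_def)

lemma Delta_Hom: "fmor Delta f \<in> Hom (PSh M U) (fob Delta A) (fob Delta B)" if "f \<in> Hom (Set_cat U) A B"
  using that by (auto simp: Hom_Set Hom_PSh Delta_Ob fmor_Delta equivariant_def)

lemma is_functor_Delta: "is_functor (Set_cat U) (PSh M U) Delta"
  unfolding is_functor_def
proof (intro conjI ballI impI)
  fix f assume "f \<in> Mor (Set_cat U)"
  then show "fmor Delta f \<in> Hom (PSh M U) (fob Delta (src (Set_cat U) f)) (fob Delta (tgt (Set_cat U) f))"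
    by (rule Delta_Hom[OF Mor_in_Hom])
qed (auto simp: Delta_Ob fmor_Delta ident_Set ident_PSh cmp_Set cmp_PSh)

lemma Gamma_ob [simp]: "fob (Gamma M) X = fixed_points M X"
  by (simp add: Gamma_def)

lemma fmor_Gamma: "fmor (Gamma M) f =
    (fixed_points M (fst f), restrict (app f) (fixed_points M (fst f)), fixed_points M (snd (snd f)))"
  by (cases f) (simp add: Gamma_def)

lemma small_fixed_points: "X \<in> Ob (PSh M U) \<Longrightarrow> small U (fixed_points M X)"
  by (simp add: Ob_PSh small_subset[OF _ fixed_points_subset])

lemma Gamma_Hom:
  assumes f: "f \<in> Hom (PSh M U) X Y"
  shows "fmor (Gamma M) f \<in> Hom (Set_cat U) (fixed_points M X) (fixed_points M Y)"
proof -
  have XY: "X \<in> Ob (PSh M U)" "Y \<in> Ob (PSh M U)" and f': "fst f = X" "snd (snd f) = Y"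
    using f by (auto simp: Hom_PSh)
  show ?thesis
    unfolding fmor_Gamma f'
    by (rule Set_homI[OF small_fixed_points[OF XY(1)] small_fixed_points[OF XY(2)] app_fixed_points[OF f]])
qed

lemma app_Gamma: "f \<in> Hom (PSh M U) X Y \<Longrightarrow> x \<in> fixed_points M X \<Longrightarrow> app (fmor (Gamma M) f) x = app f x"
  by (simp add: fmor_Gamma Hom_PSh)

lemma fixed_points_Delta [simp]: "fixed_points M (fob Delta A) = A"
  by (simp add: fixed_points_def)

lemma equiv_conn_rel: "equiv (pts X) (conn_rel M X)"
proof (rule equivI)
  show "conn_rel M X \<subseteq> pts X \<times> pts X" by (auto simp: conn_rel_def)
  show "refl_on (pts X) (conn_rel M X)" by (auto simp: conn_rel_def refl_on_def)
  show "sym (conn_rel M X)" by (auto simp: conn_rel_def sym_def intro: equivclp_sym)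
  show "trans (conn_rel M X)" by (auto simp: conn_rel_def trans_def intro: equivclp_trans)
qed

lemma conn_rel_act:
  assumes "X \<in> Ob (PSh M U)" "x \<in> pts X" "m \<in> carrier M"
  shows "(x, act X x m) \<in> conn_rel M X"
  unfolding conn_rel_def using assms by (intro CollectI case_prodI conjI r_into_equivclp) (auto simp: act_in)

text \<open>The universal property of the generated equivalence relation; statements about
  components are proved by exhibiting an invariant function.\<close>

lemma conn_rel_invariant:
  assumes inv: "\<And>x m. x \<in> pts X \<Longrightarrow> m \<in> carrier M \<Longrightarrow> h (act X x m) = h x" and xy: "(x, y) \<in> conn_rel M X"
  shows "h x = h y"
proof -
  have "equivclp (\<lambda>a b. a \<in> pts X \<and> (\<exists>m\<in>carrier M. b = act X a m)) x y" using xy by (simp add: conn_rel_def)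
  then show ?thesis
    by (induction rule: equivclp_induct) (auto simp: inv)
qed

lemma component_conn: "x \<in> pts X \<Longrightarrow> (x, component M X x) \<in> conn_rel M X"
  unfolding component_def code_def
  using someI[of "\<lambda>k. k \<in> conn_rel M X `` {x}" x] equiv_class_self[OF equiv_conn_rel, of x X M] by auto

lemma component_in_pts: "x \<in> pts X \<Longrightarrow> component M X x \<in> pts X"
  using component_conn[of x X M] by (simp add: conn_rel_def)

lemma component_eq_iff:
  assumes "x \<in> pts X" "y \<in> pts X"
  shows "component M X x = component M X y \<longleftrightarrow> (x, y) \<in> conn_rel M X"
proof
  assume "component M X x = component M X y"
  then show "(x, y) \<in> conn_rel M X"
    using component_conn[OF assms(1), of M] component_conn[OF assms(2), of M]
      equivE[OF equiv_conn_rel[of X M]] symD[of "conn_rel M X"] transD[of "conn_rel M X"] by metis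
next
  assume "(x, y) \<in> conn_rel M X"
  then have "conn_rel M X `` {x} = conn_rel M X `` {y}"
    by (rule equiv_class_eq[OF equiv_conn_rel])
  then show "component M X x = component M X y" by (simp add: component_def)
qed

lemma component_act:
  "X \<in> Ob (PSh M U) \<Longrightarrow> x \<in> pts X \<Longrightarrow> m \<in> carrier M \<Longrightarrow> component M X (act X x m) = component M X x"
  using component_eq_iff[OF _ act_in] conn_rel_act by metis

lemma components_eq: "components M X = component M X ` pts X"
  by (auto simp: components_def component_def quotient_def)

lemma component_component: "x \<in> pts X \<Longrightarrow> component M X (component M X x) = component M X x"
  using component_eq_iff[OF _ component_in_pts] component_conn by metis

lemma components_subset: "components M X \<subseteq> pts X"
  by (auto simp: components_eq component_in_pts)

lemma component_of_components: "c \<in> components M X \<Longrightarrow> component M X c = c"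
  by (auto simp: components_eq component_component)

lemma component_in: "x \<in> pts X \<Longrightarrow> component M X x \<in> components M X"
  by (simp add: components_eq)

lemma component_invariant:
  assumes "\<And>x m. x \<in> pts X \<Longrightarrow> m \<in> carrier M \<Longrightarrow> h (act X x m) = h x"
    and "x \<in> pts X" "y \<in> pts X" "component M X x = component M X y"
  shows "h x = h y"
  using conn_rel_invariant[of X M h x y] assms component_eq_iff[of x X y M] by blast

lemma component_hom_cong:
  assumes f: "f \<in> Hom (PSh M U) X Y" and x: "x \<in> pts X" "y \<in> pts X" "component M X x = component M X y"
  shows "component M Y (app f x) = component M Y (app f y)"
proof (rule component_invariant[of X M "\<lambda>x. component M Y (app f x)", OF _ x])
  have Y: "Y \<in> Ob (PSh M U)" using f by (simp add: Hom_PSh)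
  show "component M Y (app f (act X x m)) = component M Y (app f x)" if "x \<in> pts X" "m \<in> carrier M" for x m
    using app_act[OF f that] component_act[OF Y app_PSh_in[OF f that(1)] that(2)] by simp
qed

lemma Comps_ob [simp]: "fob (Comps M) X = components M X"
  by (simp add: Comps_def)

lemma fmor_Comps: "fmor (Comps M) f =
    (components M (fst f), restrict (\<lambda>c. component M (snd (snd f)) (app f c)) (components M (fst f)), components M (snd (snd f)))"
  by (cases f) (simp add: Comps_def)

lemma small_components: "X \<in> Ob (PSh M U) \<Longrightarrow> small U (components M X)"
  by (simp add: Ob_PSh small_subset[OF _ components_subset])

lemma Comps_Hom:
  assumes f: "f \<in> Hom (PSh M U) X Y"
  shows "fmor (Comps M) f \<in> Hom (Set_cat U) (components M X) (components M Y)"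
proof -
  have XY: "X \<in> Ob (PSh M U)" "Y \<in> Ob (PSh M U)" and f': "fst f = X" "snd (snd f) = Y"
    using f by (auto simp: Hom_PSh)
  have "component M Y (app f c) \<in> components M Y" if "c \<in> components M X" for c
    by (rule component_in[OF app_PSh_in[OF f subsetD[OF components_subset that]]])
  then show ?thesis
    unfolding fmor_Comps f' by (rule Set_homI[OF small_components[OF XY(1)] small_components[OF XY(2)]])
qed

text \<open>\<open>fmor (Comps M) f\<close> is defined through the chosen representative of a
  component; here any point of that component may be used instead.\<close>

lemma app_Comps: "f \<in> Hom (PSh M U) X Y \<Longrightarrow> x \<in> pts X \<Longrightarrow>
    app (fmor (Comps M) f) (component M X x) = component M Y (app f x)"
  using component_hom_cong[of f M U X Y "component M X x" x, OF _ component_in_pts _ component_component]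
  by (simp add: fmor_Comps Hom_PSh component_in)

text \<open>The identity function is invariant under a trivial action, so components are singletons
  and each is coded by its own point. Thus C\<Delta>A equals A literally.\<close>

lemma component_Delta [simp]:
  assumes "x \<in> A"
  shows "component M (fob Delta A) x = x"
proof -
  have "(x, component M (fob Delta A) x) \<in> conn_rel M (fob Delta A)" using assms by (simp add: component_conn)
  from conn_rel_invariant[of "fob Delta A" M "\<lambda>y. y", OF _ this] show ?thesis by simp
qed

lemma components_Delta [simp]: "components M (fob Delta A) = A"
  by (force simp: components_eq)

context mset_universe
begin

lemma is_functor_Gamma: "is_functor (PSh M U) (Set_cat U) (Gamma M)"
  unfolding is_functor_def
proof (intro conjI ballI impI)
  fix f assume "f \<in> Mor (PSh M U)"
  then have f: "f \<in> Hom (PSh M U) (fst f) (snd (snd f))" using Mor_in_Hom[of f "PSh M U"] by simp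
  show "fmor (Gamma M) f \<in> Hom (Set_cat U) (fob (Gamma M) (src (PSh M U) f)) (fob (Gamma M) (tgt (PSh M U) f))"
    using Gamma_Hom[OF f] by simp
  fix g assume "g \<in> Mor (PSh M U)" "tgt (PSh M U) f = src (PSh M U) g"
  then have g: "g \<in> Hom (PSh M U) (snd (snd f)) (snd (snd g))" using Mor_in_Hom[of g "PSh M U"] by simp
  show "fmor (Gamma M) (cmp (PSh M U) g f) = cmp (Set_cat U) (fmor (Gamma M) g) (fmor (Gamma M) f)"
  proof (rule Set_mor_eqI[OF Gamma_Hom[OF cmp_Hom[OF is_category_PSh f g]]
        cmp_Hom[OF is_category_Set Gamma_Hom[OF f] Gamma_Hom[OF g]]])
    fix x assume x: "x \<in> fixed_points M (fst f)"
    then have "x \<in> pts (fst f)" by (rule subsetD[OF fixed_points_subset])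
    then show "app (fmor (Gamma M) (cmp (PSh M U) g f)) x = app (cmp (Set_cat U) (fmor (Gamma M) g) (fmor (Gamma M) f)) x"
      using x app_fixed_points[OF f x]
      by (simp add: app_Gamma[OF cmp_Hom[OF is_category_PSh f g]] PSh.app_cmp[OF f] Set.app_cmp[OF Gamma_Hom[OF f]]
          app_Gamma[OF f] app_Gamma[OF g])
  qed
next
  fix X assume X: "X \<in> Ob (PSh M U)"
  show "fmor (Gamma M) (ident (PSh M U) X) = ident (Set_cat U) (fob (Gamma M) X)"
    by (auto simp: fmor_Gamma ident_PSh ident_Set fun_eq_iff subsetD[OF fixed_points_subset])
qed (auto simp: small_fixed_points)

lemma is_functor_Comps: "is_functor (PSh M U) (Set_cat U) (Comps M)"
  unfolding is_functor_def
proof (intro conjI ballI impI)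
  fix f assume "f \<in> Mor (PSh M U)"
  then have f: "f \<in> Hom (PSh M U) (fst f) (snd (snd f))" using Mor_in_Hom[of f "PSh M U"] by simp
  show "fmor (Comps M) f \<in> Hom (Set_cat U) (fob (Comps M) (src (PSh M U) f)) (fob (Comps M) (tgt (PSh M U) f))"
    using Comps_Hom[OF f] by simp
  fix g assume "g \<in> Mor (PSh M U)" "tgt (PSh M U) f = src (PSh M U) g"
  then have g: "g \<in> Hom (PSh M U) (snd (snd f)) (snd (snd g))" using Mor_in_Hom[of g "PSh M U"] by simp
  show "fmor (Comps M) (cmp (PSh M U) g f) = cmp (Set_cat U) (fmor (Comps M) g) (fmor (Comps M) f)"
  proof (rule Set_mor_eqI[OF Comps_Hom[OF cmp_Hom[OF is_category_PSh f g]]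
        cmp_Hom[OF is_category_Set Comps_Hom[OF f] Comps_Hom[OF g]]])
    fix c assume c: "c \<in> components M (fst f)"
    then obtain x where x: "x \<in> pts (fst f)" "c = component M (fst f) x" by (auto simp: components_eq)
    then show "app (fmor (Comps M) (cmp (PSh M U) g f)) c = app (cmp (Set_cat U) (fmor (Comps M) g) (fmor (Comps M) f)) c"
      using c app_PSh_in[OF f]
      by (simp add: app_Comps[OF cmp_Hom[OF is_category_PSh f g]] PSh.app_cmp[OF f] Set.app_cmp[OF Comps_Hom[OF f]]
          app_Comps[OF f] app_Comps[OF g])
  qed
next
  fix X assume X: "X \<in> Ob (PSh M U)"
  show "fmor (Comps M) (ident (PSh M U) X) = ident (Set_cat U) (fob (Comps M) X)"
    using components_subset[of M X] by (auto simp: fmor_Comps ident_PSh ident_Set component_of_components fun_eq_iff)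
qed (auto simp: small_components)

section \<open>The global sections geometric morphism\<close>

text \<open>Since \<Gamma>\<Delta>A equals A literally, the unit can be an identity. Finite limits
  are preserved because \<Delta> keeps underlying sets and functions.\<close>

lemma global_sections_geometric: "geometric_morphism (PSh M U) (Set_cat U) (global_sections M U)"
proof -
  let ?\<eta> = "\<lambda>A\<in>Ob (Set_cat U). (A, \<lambda>x\<in>A. x, A)"
  let ?\<epsilon> = "\<lambda>X\<in>Ob (PSh M U). (fob Delta (fixed_points M X), \<lambda>x\<in>fixed_points M X. x, X)"
  have \<epsilon>: "?\<epsilon> X \<in> Hom (PSh M U) (fob Delta (fixed_points M X)) X" if "X \<in> Ob (PSh M U)" for X
    using that PSh_homI[of "fob Delta (fixed_points M X)" M U X "\<lambda>x. x"] fixed_points_subset[of M X]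
    by (auto simp: Delta_Ob small_fixed_points fixed_points_act)
  have "adjunction (Set_cat U) (PSh M U) Delta (Gamma M) ?\<eta> ?\<epsilon>"
    unfolding adjunction_def
  proof (intro conjI ballI)
    show "is_nat_trans (Set_cat U) (Set_cat U) functor_id (functor_comp (Gamma M) Delta) ?\<eta>"
    proof (rule is_nat_transI)
      fix A B f assume f: "f \<in> Hom (Set_cat U) A B"
      then have "small U A" "small U B" "fst f = A" "snd (snd f) = B" "app f \<in> A \<rightarrow>\<^sub>E B"
        by (auto simp: Hom_Set)
      then show "cmp (Set_cat U) (fmor (functor_comp (Gamma M) Delta) f) (?\<eta> A) = cmp (Set_cat U) (?\<eta> B) (fmor functor_id f)"
        by (auto simp: functor_comp_def functor_id_def fmor_Gamma fmor_Delta cmp_Set compose_def fun_eq_iff)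
    qed (auto simp: functor_comp_def functor_id_def Hom_Set)
    show "is_nat_trans (PSh M U) (PSh M U) (functor_comp Delta (Gamma M)) functor_id ?\<epsilon>"
    proof (rule is_nat_transI)
      fix X Y f assume f: "f \<in> Hom (PSh M U) X Y"
      then have XY: "X \<in> Ob (PSh M U)" "Y \<in> Ob (PSh M U)" and f': "fst f = X" "snd (snd f) = Y"
        by (auto simp: Hom_PSh)
      show "cmp (PSh M U) (fmor functor_id f) (?\<epsilon> X) = cmp (PSh M U) (?\<epsilon> Y) (fmor (functor_comp Delta (Gamma M)) f)"
        using XY f' app_fixed_points[OF f]
        by (auto simp: functor_comp_def functor_id_def fmor_Gamma fmor_Delta cmp_PSh compose_def fun_eq_iff)
    qed (use \<epsilon> in \<open>auto simp: functor_comp_def functor_id_def\<close>)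
  qed (auto simp: is_functor_Delta is_functor_Gamma Delta_Ob small_fixed_points fmor_Delta cmp_PSh compose_def
      ident_PSh ident_Set fmor_Gamma cmp_Set)
  moreover have "preserves_finite_limits (Set_cat U) (PSh M U) Delta"
    by (rule preserves_finite_limits_subfunctor[OF Set.concrete_category_axioms PSh.concrete_category_axioms is_functor_Delta])
      (auto simp: fmor_Delta)
  ultimately show ?thesis by (simp add: geometric_morphism_def global_sections_def)
qed

text \<open>The unit sends a point to its coded component; the counit is an identity because
  C\<Delta>A equals A.\<close>

lemma global_sections_essential: "essential_via (PSh M U) (Set_cat U) (global_sections M U) (Comps M)"
proof -
  let ?\<eta> = "\<lambda>X\<in>Ob (PSh M U). (X, restrict (component M X) (pts X), fob Delta (components M X))"
  let ?\<epsilon> = "\<lambda>A\<in>Ob (Set_cat U). (A, \<lambda>x\<in>A. x, A)"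
  have \<eta>: "?\<eta> X \<in> Hom (PSh M U) X (fob Delta (components M X))" if "X \<in> Ob (PSh M U)" for X
    using that PSh_homI[of X M U "fob Delta (components M X)" "component M X"]
    by (auto simp: Delta_Ob small_components component_in component_act)
  have "adjunction (PSh M U) (Set_cat U) (Comps M) Delta ?\<eta> ?\<epsilon>"
    unfolding adjunction_def
  proof (intro conjI ballI)
    show "is_nat_trans (PSh M U) (PSh M U) functor_id (functor_comp Delta (Comps M)) ?\<eta>"
    proof (rule is_nat_transI)
      fix X Y f assume f: "f \<in> Hom (PSh M U) X Y"
      then have XY: "X \<in> Ob (PSh M U)" "Y \<in> Ob (PSh M U)" and f': "fst f = X" "snd (snd f) = Y"
        by (auto simp: Hom_PSh)
      show "cmp (PSh M U) (fmor (functor_comp Delta (Comps M)) f) (?\<eta> X) = cmp (PSh M U) (?\<eta> Y) (fmor functor_id f)"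
        using XY f' app_PSh_in[OF f] app_Comps[OF f]
        by (auto simp: functor_comp_def functor_id_def fmor_Comps fmor_Delta cmp_PSh compose_def fun_eq_iff component_in)
    qed (use \<eta> in \<open>auto simp: functor_comp_def functor_id_def\<close>)
    show "is_nat_trans (Set_cat U) (Set_cat U) (functor_comp (Comps M) Delta) functor_id ?\<epsilon>"
    proof (rule is_nat_transI)
      fix A B f assume f: "f \<in> Hom (Set_cat U) A B"
      then have "small U A" "small U B" "fst f = A" "snd (snd f) = B" "app f \<in> A \<rightarrow>\<^sub>E B"
        "\<And>x. x \<in> A \<Longrightarrow> app f x \<in> B"
        by (auto simp: Hom_Set)
      then show "cmp (Set_cat U) (fmor functor_id f) (?\<epsilon> A) = cmp (Set_cat U) (?\<epsilon> B) (fmor (functor_comp (Comps M) Delta) f)"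
        by (auto simp: functor_comp_def functor_id_def fmor_Comps fmor_Delta cmp_Set compose_def fun_eq_iff)
    qed (auto simp: functor_comp_def functor_id_def Hom_Set)
  next
    fix X assume X: "X \<in> Ob (PSh M U)"
    show "cmp (Set_cat U) (?\<epsilon> (fob (Comps M) X)) (fmor (Comps M) (?\<eta> X)) = ident (Set_cat U) (fob (Comps M) X)"
      using X components_subset[of M X]
      by (auto simp: small_components fmor_Comps cmp_Set ident_Set compose_def fun_eq_iff component_of_components
          component_in)
  qed (auto simp: is_functor_Delta is_functor_Comps Delta_Ob fmor_Delta cmp_PSh compose_def
      ident_PSh fun_eq_iff)
  then show ?thesis using global_sections_geometric by (auto simp: essential_via_def global_sections_def)
qed

lemma global_sections_connected: "connected_geom (PSh M U) (Set_cat U) (global_sections M U)"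
proof -
  have "full_functor (Set_cat U) (PSh M U) Delta"
    unfolding full_functor_def
  proof (intro ballI)
    fix A B g assume "g \<in> Hom (PSh M U) (fob Delta A) (fob Delta B)"
    then have "(A, app g, B) \<in> Hom (Set_cat U) A B" "fmor Delta (A, app g, B) = g"
      by (auto simp: Hom_PSh Hom_Set Delta_Ob fmor_Delta prod_eq_iff)
    then show "\<exists>f\<in>Hom (Set_cat U) A B. fmor Delta f = g" by blast
  qed
  moreover have "faithful_functor (Set_cat U) (PSh M U) Delta"
    unfolding faithful_functor_def by (intro ballI inj_onI) (auto simp: Hom_Set fmor_Delta prod_eq_iff)
  ultimately show ?thesis
    using global_sections_geometric by (simp add: connected_geom_def global_sections_def)
qed

text \<open>Turns membership in the essential image of \<Delta> into triviality of the action, the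
  form in which hyperconnectedness can be tested on elements.\<close>

lemma isomorphic_Delta_iff:
  assumes X: "X \<in> Ob (PSh M U)"
  shows "(\<exists>A\<in>Ob (Set_cat U). isomorphic_in (PSh M U) X (fob Delta A)) \<longleftrightarrow>
    (\<forall>x\<in>pts X. \<forall>m\<in>carrier M. act X x m = x)"
proof (intro iffI ballI)
  fix x m assume x: "x \<in> pts X" and m: "m \<in> carrier M"
  assume "\<exists>A\<in>Ob (Set_cat U). isomorphic_in (PSh M U) X (fob Delta A)"
  then obtain A f g where f: "f \<in> Hom (PSh M U) X (fob Delta A)"
    and gf: "cmp (PSh M U) g f = ident (PSh M U) X"
    unfolding isomorphic_in_def by blast
  have gf': "app g (app f y) = y" if "y \<in> pts X" for y
    using arg_cong[OF gf, of "\<lambda>h. app h y"] PSh.app_cmp[OF f that] that by (simp add: ident_PSh)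
  have "app f (act X x m) = app f x" using app_act[OF f x m] by simp
  then show "act X x m = x" using gf'[OF x] gf'[OF act_in[OF X x m]] by simp
next
  assume triv: "\<forall>x\<in>pts X. \<forall>m\<in>carrier M. act X x m = x"
  let ?D = "fob Delta (pts X)"
  have D: "small U (pts X)" using X by (simp add: Ob_PSh)
  then have D: "small U (pts X)" "?D \<in> Ob (PSh M U)" by (simp_all only: Delta_Ob)
  have "(X, \<lambda>x\<in>pts X. x, ?D) \<in> Hom (PSh M U) X ?D" "(?D, \<lambda>x\<in>pts X. x, X) \<in> Hom (PSh M U) ?D X"
    using PSh_homI[OF X D(2), of "\<lambda>x. x"] PSh_homI[OF D(2) X, of "\<lambda>x. x"] triv by auto
  moreover have "cmp (PSh M U) (?D, \<lambda>x\<in>pts X. x, X) (X, \<lambda>x\<in>pts X. x, ?D) = ident (PSh M U) X"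
    "cmp (PSh M U) (X, \<lambda>x\<in>pts X. x, ?D) (?D, \<lambda>x\<in>pts X. x, X) = ident (PSh M U) ?D"
    by (auto simp: cmp_PSh ident_PSh compose_def)
  ultimately have "isomorphic_in (PSh M U) X ?D" unfolding isomorphic_in_def using X D(2) by blast
  then show "\<exists>A\<in>Ob (Set_cat U). isomorphic_in (PSh M U) X (fob Delta A)" using D(1) by auto
qed

text \<open>A trivial action passes back along injective maps and forward along surjective ones;
  monomorphisms and epimorphisms of M-sets are such maps.\<close>

lemma global_sections_hyperconnected: "hyperconnected_geom (PSh M U) (Set_cat U) (global_sections M U)"
proof -
  have "\<exists>A\<in>Ob (Set_cat U). isomorphic_in (PSh M U) (src (PSh M U) m) (fob Delta A)"
    if m: "mono_in (PSh M U) m"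
      and triv: "\<exists>A\<in>Ob (Set_cat U). isomorphic_in (PSh M U) (tgt (PSh M U) m) (fob Delta A)" for m
  proof -
    obtain X Y where mH: "m \<in> Hom (PSh M U) X Y" using m Mor_in_Hom[of m] by (auto simp: mono_in_def)
    have X: "X \<in> Ob (PSh M U)" and Y: "Y \<in> Ob (PSh M U)" using mH by (auto simp: Hom_PSh)
    have "act X x n = x" if x: "x \<in> pts X" and n: "n \<in> carrier M" for x n
      using inj_onD[OF PSh.mono_inj[OF m mH] _ act_in[OF X x n] x] app_act[OF mH x n]
        isomorphic_Delta_iff[OF Y] triv Hom_D(3)[OF mH] app_PSh_in[OF mH x] n by simp
    then show ?thesis using isomorphic_Delta_iff[OF X] Hom_D(2)[OF mH] by blast
  qed
  moreover have "\<exists>A\<in>Ob (Set_cat U). isomorphic_in (PSh M U) (tgt (PSh M U) e) (fob Delta A)"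
    if e: "epi_in (PSh M U) e"
      and triv: "\<exists>A\<in>Ob (Set_cat U). isomorphic_in (PSh M U) (src (PSh M U) e) (fob Delta A)" for e
  proof -
    obtain X Y where eH: "e \<in> Hom (PSh M U) X Y" using e Mor_in_Hom[of e] by (auto simp: epi_in_def)
    have X: "X \<in> Ob (PSh M U)" and Y: "Y \<in> Ob (PSh M U)" using eH by (auto simp: Hom_PSh)
    have "act Y y n = y" if y: "y \<in> pts Y" and n: "n \<in> carrier M" for y n
    proof -
      obtain x where x: "x \<in> pts X" "app e x = y" using PSh_epi_surj[OF e eH y] by blast
      then show ?thesis using app_act[OF eH x(1) n] isomorphic_Delta_iff[OF X] triv Hom_D(2)[OF eH] n by simp
    qed
    then show ?thesis using isomorphic_Delta_iff[OF Y] Hom_D(3)[OF eH] by blast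
  qed
  ultimately show ?thesis
    using global_sections_connected by (simp add: hyperconnected_geom_def global_sections_def)
qed

lemma alpha_nat: "is_nat_trans (PSh M U) (Set_cat U) (Gamma M) (Comps M) (alpha M U)"
proof (rule is_nat_transI)
  show \<alpha>: "alpha M U X \<in> Hom (Set_cat U) (fob (Gamma M) X) (fob (Comps M) X)" if "X \<in> Ob (PSh M U)" for X
    by (simp add: alpha_def that)
      (rule Set_homI[OF small_fixed_points[OF that] small_components[OF that]
          component_in[OF subsetD[OF fixed_points_subset]]])
  fix X Y f assume f: "f \<in> Hom (PSh M U) X Y"
  have X: "X \<in> Ob (PSh M U)" and Y: "Y \<in> Ob (PSh M U)" using f by (auto simp: Hom_PSh)
  show "cmp (Set_cat U) (fmor (Comps M) f) (alpha M U X) = cmp (Set_cat U) (alpha M U Y) (fmor (Gamma M) f)"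
  proof (rule Set_mor_eqI)
    show "cmp (Set_cat U) (fmor (Comps M) f) (alpha M U X) \<in> Hom (Set_cat U) (fixed_points M X) (components M Y)"
      using cmp_Hom[OF is_category_Set \<alpha>[OF X]] Comps_Hom[OF f] by simp
    show "cmp (Set_cat U) (alpha M U Y) (fmor (Gamma M) f) \<in> Hom (Set_cat U) (fixed_points M X) (components M Y)"
      using cmp_Hom[OF is_category_Set Gamma_Hom[OF f]] \<alpha>[OF Y] by simp
    fix x assume x: "x \<in> fixed_points M X"
    then have "x \<in> pts X" by (rule subsetD[OF fixed_points_subset])
    then show "app (cmp (Set_cat U) (fmor (Comps M) f) (alpha M U X)) x
        = app (cmp (Set_cat U) (alpha M U Y) (fmor (Gamma M) f)) x"
      using x X Y app_Comps[OF f] app_fixed_points[OF f x]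
      by (simp add: Set.app_cmp[OF Gamma_Hom[OF f]] app_Gamma[OF f] app_cmp_Set alpha_def)
  qed
qed (simp add: alpha_def)

subsection \<open>Functors of elements fixed by an idempotent\<close>

context
  fixes e F
  assumes e: "e \<in> carrier M" and idem: "e \<otimes> e = e"
    and F: "is_functor (PSh M U) (Set_cat U) F"
    and Fob: "\<And>X. X \<in> Ob (PSh M U) \<Longrightarrow> fob F X = {x \<in> pts X. act X x e = x}"
    and Fapp: "\<And>f X Y x. f \<in> Hom (PSh M U) X Y \<Longrightarrow> x \<in> fob F X \<Longrightarrow> app (fmor F f) x = app f x"
begin

text \<open>The functor is \<open>X \<mapsto> X \<otimes>\<^sub>M Me\<close>, so its right adjoint sends \<open>S\<close> to the set of maps
  \<open>Me \<rightarrow> S\<close> with the action \<open>(\<phi> m) \<rho> = \<phi> (m \<rho>)\<close>.\<close>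

lemma idempotent_functor_right_adjoint: "has_right_adjoint (PSh M U) (Set_cat U) F"
proof (rule has_right_adjoint_of_universal_arrows[OF F is_category_PSh is_category_Set])
  fix S assume "S \<in> Ob (Set_cat U)"
  then have S: "small U S" by simp
  define N where "N = (\<lambda>m. m \<otimes> e) ` carrier M"
  have N: "\<rho> \<in> carrier M" "\<rho> \<otimes> e = \<rho>" if "\<rho> \<in> N" for \<rho>
    using that e by (auto simp: N_def m_assoc idem)
  have mN: "m \<otimes> \<rho> \<in> N" if "m \<in> carrier M" "\<rho> \<in> N" for m \<rho>
    using that e unfolding N_def by (auto simp flip: m_assoc)
  have eN: "e \<in> N" using e idem by (force simp: N_def)
  define \<Phi> where "\<Phi> = N \<rightarrow>\<^sub>E S"
  \<comment> \<open>Precomposition with the surjection from M to Me, sending m to me, embeds the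
    maps on Me into the maps on M, whose number \<open>universe_for\<close> controls.\<close>
  have "inj_on (\<lambda>\<phi>. \<lambda>m\<in>carrier M. \<phi> (m \<otimes> e)) \<Phi>"
  proof (rule inj_onI)
    fix \<phi> \<psi> assume \<phi>: "\<phi> \<in> \<Phi>" and \<psi>: "\<psi> \<in> \<Phi>"
      and eq: "(\<lambda>m\<in>carrier M. \<phi> (m \<otimes> e)) = (\<lambda>m\<in>carrier M. \<psi> (m \<otimes> e))"
    show "\<phi> = \<psi>"
    proof (rule PiE_ext[OF \<phi>[unfolded \<Phi>_def] \<psi>[unfolded \<Phi>_def]])
      fix \<rho> assume "\<rho> \<in> N"
      then show "\<phi> \<rho> = \<psi> \<rho>" using fun_cong[OF eq, of \<rho>] N by simp
    qed
  qed
  moreover have "(\<lambda>\<phi>. \<lambda>m\<in>carrier M. \<phi> (m \<otimes> e)) ` \<Phi> \<subseteq> carrier M \<rightarrow>\<^sub>E S"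
    by (auto simp: \<Phi>_def N_def)
  ultimately have "\<Phi> \<lesssim> (carrier M \<rightarrow>\<^sub>E S)" unfolding lepoll_def by blast
  then have \<Phi>: "\<Phi> \<prec> U" using maps_lesspoll[OF S] lesspoll_trans1 by blast
  then obtain enc where enc: "inj_on enc \<Phi>" "enc ` \<Phi> \<subseteq> U"
    unfolding lesspoll_def lepoll_def by blast
  have "enc ` \<Phi> \<prec> U" by (rule lesspoll_trans1[OF image_lepoll \<Phi>])
  then have small_enc: "small U (enc ` \<Phi>)" using enc(2) by (simp add: small_def)
  define dec where "dec = inv_into \<Phi> enc"
  have dec: "dec (enc \<phi>) = \<phi>" if "\<phi> \<in> \<Phi>" for \<phi> using that enc(1) by (simp add: dec_def)
  define shift where "shift \<phi> m = (\<lambda>\<rho>\<in>N. \<phi> (m \<otimes> \<rho>))" for \<phi> :: "'m \<Rightarrow> 'u" and m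
  have shift: "shift \<phi> m \<in> \<Phi>" if "\<phi> \<in> \<Phi>" "m \<in> carrier M" for \<phi> m
    using that mN by (auto simp: shift_def \<Phi>_def)
  define GS where "GS = \<lparr>pts = enc ` \<Phi>, act = (\<lambda>z m. enc (shift (dec z) m))\<rparr>"
  have actG: "act GS (enc \<phi>) m = enc (shift \<phi> m)" if "\<phi> \<in> \<Phi>" for \<phi> m
    using that by (simp add: GS_def dec)
  have "right_mset M GS"
    unfolding right_mset_def
  proof (intro conjI ballI)
    fix z assume "z \<in> pts GS"
    then obtain \<phi> where \<phi>: "\<phi> \<in> \<Phi>" "z = enc \<phi>" by (auto simp: GS_def)
    have "shift \<phi> \<one> = \<phi>"
      using \<phi>(1) N(1) by (auto simp: shift_def \<Phi>_def PiE_iff extensional_def fun_eq_iff)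
    then show "act GS z \<one> = z" using \<phi> by (simp add: actG)
    fix m assume m: "m \<in> carrier M"
    show "act GS z m \<in> pts GS" using \<phi> shift[OF \<phi>(1) m] by (simp add: actG) (simp add: GS_def)
    fix n assume n: "n \<in> carrier M"
    have "shift \<phi> (m \<otimes> n) = shift (shift \<phi> m) n"
      using m n N(1) mN by (auto simp: shift_def m_assoc fun_eq_iff)
    then show "act GS z (m \<otimes> n) = act GS (act GS z m) n" using \<phi> shift[OF \<phi>(1) m] by (simp add: actG)
  qed
  then have G: "GS \<in> Ob (PSh M U)" using small_enc by (simp add: Ob_PSh GS_def)
  \<comment> \<open>The counit decodes a map on Me and evaluates it at e.\<close>
  define \<epsilon> where "\<epsilon> = (fob F GS, \<lambda>z\<in>fob F GS. dec z e, S)"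
  have FG: "fob F GS \<subseteq> enc ` \<Phi>" using Fob[OF G] by (auto simp: GS_def)
  have "dec z e \<in> S" if z: "z \<in> fob F GS" for z
  proof -
    obtain \<phi> where "\<phi> \<in> \<Phi>" "z = enc \<phi>" using FG z by blast
    then show ?thesis using eN by (auto simp: dec) (auto simp: \<Phi>_def)
  qed
  then have \<epsilon>: "\<epsilon> \<in> Hom (Set_cat U) (fob F GS) S"
    unfolding \<epsilon>_def using functor_Ob[OF F G] S by (intro Set_homI) simp_all
  have "\<exists>!g. g \<in> Hom (PSh M U) X GS \<and> cmp (Set_cat U) \<epsilon> (fmor F g) = f"
    if X: "X \<in> Ob (PSh M U)" and f: "f \<in> Hom (Set_cat U) (fob F X) S" for X f
  proof -
    have XN: "act X x \<rho> \<in> fob F X" if "x \<in> pts X" "\<rho> \<in> N" for x \<rho>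
      using that N e act_mult[OF X that(1) N(1)[OF that(2)] e] by (simp add: Fob[OF X] act_in[OF X])
    have FX: "x \<in> pts X" "act X x e = x" if "x \<in> fob F X" for x using that by (simp_all add: Fob[OF X])
    have \<epsilon>F: "app (cmp (Set_cat U) \<epsilon> (fmor F g)) x = dec (app g x) e"
      if g: "g \<in> Hom (PSh M U) X GS" and x: "x \<in> fob F X" for g x
      using Set.app_cmp[OF functor_Hom[OF F g] x, of \<epsilon>] Set.app_in[OF functor_Hom[OF F g] x] Fapp[OF g x]
      by (simp add: \<epsilon>_def)
    \<comment> \<open>The transpose of f: each x\<rho> with \<rho> in Me is fixed by e, because
      \<rho>e = \<rho>, so f applies to it.\<close>
    define k where "k x = (\<lambda>\<rho>\<in>N. app f (act X x \<rho>))" for x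
    have k: "k x \<in> \<Phi>" if "x \<in> pts X" for x
      using Set.app_in[OF f XN[OF that]] by (auto simp: k_def \<Phi>_def)
    show ?thesis
    proof (rule ex1I[of _ "(X, restrict (\<lambda>x. enc (k x)) (pts X), GS)"])
      have g: "(X, restrict (\<lambda>x. enc (k x)) (pts X), GS) \<in> Hom (PSh M U) X GS"
      proof (rule PSh_homI[OF X G])
        show "enc (k x) \<in> pts GS" if "x \<in> pts X" for x using k[OF that] by (simp add: GS_def)
        show "enc (k (act X x m)) = act GS (enc (k x)) m" if x: "x \<in> pts X" and m: "m \<in> carrier M" for x m
        proof -
          have "k (act X x m) = shift (k x) m"
            using x m N(1) mN act_mult[OF X x m] by (auto simp: k_def shift_def fun_eq_iff)
          then show ?thesis using k[OF x] by (simp add: actG)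
        qed
      qed
      moreover have "cmp (Set_cat U) \<epsilon> (fmor F (X, restrict (\<lambda>x. enc (k x)) (pts X), GS)) = f"
      proof (rule Set_mor_eqI[OF cmp_Hom[OF is_category_Set functor_Hom[OF F g] \<epsilon>] f])
        fix x assume x: "x \<in> fob F X"
        show "app (cmp (Set_cat U) \<epsilon> (fmor F (X, restrict (\<lambda>x. enc (k x)) (pts X), GS))) x = app f x"
          using \<epsilon>F[OF g x] FX[OF x] k eN by (simp add: dec) (simp add: k_def)
      qed
      ultimately show "(X, restrict (\<lambda>x. enc (k x)) (pts X), GS) \<in> Hom (PSh M U) X GS \<and>
          cmp (Set_cat U) \<epsilon> (fmor F (X, restrict (\<lambda>x. enc (k x)) (pts X), GS)) = f" by blast
      fix g' assume "g' \<in> Hom (PSh M U) X GS \<and> cmp (Set_cat U) \<epsilon> (fmor F g') = f"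
      then have g': "g' \<in> Hom (PSh M U) X GS" and g'f: "cmp (Set_cat U) \<epsilon> (fmor F g') = f" by auto
      show "g' = (X, restrict (\<lambda>x. enc (k x)) (pts X), GS)"
      proof (rule PSh_mor_eqI[OF g' g])
        fix x assume x: "x \<in> pts X"
        obtain \<phi> where \<phi>: "\<phi> \<in> \<Phi>" "app g' x = enc \<phi>" using app_PSh_in[OF g' x] by (auto simp: GS_def)
        have "\<phi> = k x"
        proof (rule PiE_ext[OF \<phi>(1)[unfolded \<Phi>_def] k[OF x, unfolded \<Phi>_def]])
          fix \<rho> assume \<rho>: "\<rho> \<in> N"
          \<comment> \<open>Uniqueness: applying the counit at x\<rho> evaluates
            \<open>shift \<phi> \<rho>\<close> at e, which is \<phi> at \<rho>e = \<rho>. Hence f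
            determines every value of \<phi>.\<close>
          have "app f (act X x \<rho>) = dec (app g' (act X x \<rho>)) e"
            using \<epsilon>F[OF g' XN[OF x \<rho>]] g'f by simp
          also have "\<dots> = shift \<phi> \<rho> e"
            using app_act[OF g' x N(1)[OF \<rho>]] \<phi> shift[OF \<phi>(1) N(1)[OF \<rho>]] by (simp add: actG dec)
          also have "\<dots> = \<phi> \<rho>" using eN N(2)[OF \<rho>] by (simp add: shift_def)
          finally show "\<phi> \<rho> = k x \<rho>" using \<rho> by (simp add: k_def)
        qed
        then show "app g' x = app (X, restrict (\<lambda>x. enc (k x)) (pts X), GS) x" using \<phi> x by simp
      qed
    qed
  qed
  then show "\<exists>a\<in>Ob (PSh M U). \<exists>\<epsilon>\<in>Hom (Set_cat U) (fob F a) S. \<forall>x\<in>Ob (PSh M U).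
      \<forall>f\<in>Hom (Set_cat U) (fob F x) S. \<exists>!g. g \<in> Hom (PSh M U) x a \<and> cmp (Set_cat U) \<epsilon> (fmor F g) = f"
    using G \<epsilon> by blast
qed

text \<open>If every coordinate of l is fixed by e, then le and l have the same coordinates, so they
  are equal.\<close>

lemma idempotent_functor_limits: "preserves_finite_limits (PSh M U) (Set_cat U) F"
proof (rule preserves_finite_limits_subfunctor[OF PSh.concrete_category_axioms Set.concrete_category_axioms F])
  fix I :: "nat set" and L \<pi> D l
  assume L: "L \<in> Ob (PSh M U)" and \<pi>: "\<And>j. j \<in> I \<Longrightarrow> \<pi> j \<in> Hom (PSh M U) L (D j)"
    and inj: "\<And>l l'. l \<in> pts L \<Longrightarrow> l' \<in> pts L \<Longrightarrow> (\<And>j. j \<in> I \<Longrightarrow> app (\<pi> j) l = app (\<pi> j) l') \<Longrightarrow> l = l'"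
    and l: "l \<in> pts L" and in_F: "\<And>j. j \<in> I \<Longrightarrow> app (\<pi> j) l \<in> fob F (D j)"
  have "act L l e = l"
  proof (rule inj[OF act_in[OF L l e] l])
    fix j assume j: "j \<in> I"
    show "app (\<pi> j) (act L l e) = app (\<pi> j) l"
      using app_act[OF \<pi>[OF j] l e] in_F[OF j] Fob Hom_Ob(2)[OF is_category_PSh \<pi>[OF j]] by simp
  qed
  then show "l \<in> fob F L" using l by (simp add: Fob[OF L])
qed (use Fob Fapp in auto)

lemma idempotent_functor_point: "\<exists>p. geometric_morphism (Set_cat U) (PSh M U) p \<and> inv_im p = F"
proof -
  obtain G \<eta> \<epsilon> where "adjunction (PSh M U) (Set_cat U) F G \<eta> \<epsilon>"
    using idempotent_functor_right_adjoint by (auto simp: has_right_adjoint_def)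
  then have "geometric_morphism (Set_cat U) (PSh M U)
      \<lparr>inv_im = F, dir_im = G, gunit = \<eta>, gcounit = \<epsilon>\<rparr>"
    using idempotent_functor_limits by (simp add: geometric_morphism_def)
  then show ?thesis by (metis geom.select_convs(1))
qed

end

definition Forget :: "(('u, 'm) rset, ('u, 'm) rmap, 'u set, 'u set \<times> ('u \<Rightarrow> 'u) \<times> 'u set) functr" where
  "Forget = \<lparr>fob = pts, fmor = (\<lambda>f. (pts (fst f), app f, pts (snd (snd f))))\<rparr>"

lemma Forget_Hom: "f \<in> Hom (PSh M U) X Y \<Longrightarrow> fmor Forget f \<in> Hom (Set_cat U) (pts X) (pts Y)"
  by (auto simp: Forget_def Hom_PSh Hom_Set Ob_PSh)

lemma forgetful_point: "\<exists>p. geometric_morphism (Set_cat U) (PSh M U) p \<and> inv_im p = Forget"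
proof (rule idempotent_functor_point[of \<one>])
  show "is_functor (PSh M U) (Set_cat U) Forget"
    unfolding is_functor_def
  proof (intro conjI ballI impI)
    fix f assume "f \<in> Mor (PSh M U)"
    from Forget_Hom[OF Mor_in_Hom[OF this]]
    show "fmor Forget f \<in> Hom (Set_cat U) (fob Forget (src (PSh M U) f)) (fob Forget (tgt (PSh M U) f))"
      by (simp add: Forget_def)
  qed (auto simp: Forget_def Ob_PSh ident_PSh ident_Set cmp_PSh cmp_Set)
qed (auto simp: Forget_def act_one)

text \<open>An x with xr = x is fixed because every xr is. This presents \<Gamma> as the functor
  belonging to the idempotent r.\<close>

lemma fixed_points_right_absorbing:
  assumes r: "right_absorbing M r" and X: "X \<in> Ob (PSh M U)"
  shows "fixed_points M X = {x \<in> pts X. act X x r = x}"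
proof (intro equalityI subsetI)
  fix x assume "x \<in> {x \<in> pts X. act X x r = x}"
  then have "x \<in> pts X" "act X x r = x" by auto
  then show "x \<in> fixed_points M X" using act_right_absorbing[OF X _ r, of x] by simp
qed (auto simp: fixed_points_def right_absorbingD[OF r])

lemma Gamma_right_adjoint:
  assumes r: "right_absorbing M r"
  shows "has_right_adjoint (PSh M U) (Set_cat U) (Gamma M)"
  by (rule idempotent_functor_right_adjoint[of r])
    (auto simp: right_absorbingD[OF r] is_functor_Gamma fixed_points_right_absorbing[OF r] intro: app_Gamma)

lemma Gamma_point:
  assumes r: "right_absorbing M r"
  shows "\<exists>p. geometric_morphism (Set_cat U) (PSh M U) p \<and> inv_im p = Gamma M"
  by (rule idempotent_functor_point[of r])
    (auto simp: right_absorbingD[OF r] is_functor_Gamma fixed_points_right_absorbing[OF r] intro: app_Gamma)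

section \<open>The terminal M-set and its maps to other M-sets\<close>

definition One :: "('u, 'm) rset" where
  "One = fob Delta {base}"

definition to_One :: "('u, 'm) rset \<Rightarrow> ('u, 'm) rmap" where
  "to_One X = (X, \<lambda>x\<in>pts X. base, One)"

definition from_One :: "('u, 'm) rset \<Rightarrow> 'u \<Rightarrow> ('u, 'm) rmap" where
  "from_One X x = (One, \<lambda>z\<in>pts One. x, X)"

lemma pts_One: "pts One = {base}" and act_One: "act One x m = x"
  by (simp_all add: One_def)

lemma One_Ob: "One \<in> Ob (PSh M U)"
  using Set.Gen_Ob by (simp add: One_def Delta_Ob)

lemma fixed_points_One: "fixed_points M One = {base}"
  by (simp add: One_def)

lemma to_One: "X \<in> Ob (PSh M U) \<Longrightarrow> to_One X \<in> Hom (PSh M U) X One"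
  unfolding to_One_def by (rule PSh_homI) (auto simp: One_Ob pts_One act_One)

lemma from_One: "X \<in> Ob (PSh M U) \<Longrightarrow> x \<in> fixed_points M X \<Longrightarrow> from_One X x \<in> Hom (PSh M U) One X"
  unfolding from_One_def
  by (rule PSh_homI[OF One_Ob]) (auto simp: fixed_points_act act_One intro: subsetD[OF fixed_points_subset])

lemma app_from_One: "app (from_One X x) base = x"
  by (simp add: from_One_def pts_One)

text \<open>With \<open>from_One\<close>, this identifies fixed points of X with maps from
  \<open>One\<close> to X, so \<open>One\<close> represents \<Gamma>.\<close>

lemma from_One_eqI:
  assumes f: "f \<in> Hom (PSh M U) One X" and x: "app f base = x"
  shows "f = from_One X x"
proof -
  have "x \<in> fixed_points M X" using app_fixed_points[OF f, of base] fixed_points_One x by simp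
  from PSh_mor_eqI[OF f from_One[OF Hom_Ob(2)[OF is_category_PSh f] this]] show ?thesis
    using x by (simp add: pts_One app_from_One)
qed

lemma One_terminal: "terminal_in (PSh M U) One"
  unfolding terminal_in_def
proof (intro conjI ballI)
  fix X assume X: "X \<in> Ob (PSh M U)"
  show "\<exists>!f. f \<in> Hom (PSh M U) X One"
  proof (rule ex1I[of _ "to_One X"])
    show "f = to_One X" if "f \<in> Hom (PSh M U) X One" for f
      using that to_One[OF X] by (rule PSh_mor_eqI) (use app_PSh_in[OF that] in \<open>auto simp: to_One_def pts_One\<close>)
  qed (rule to_One[OF X])
qed (rule One_Ob)

text \<open>Surjective because the regular M-set contains the unit. A functor that preserves this
  epimorphism and is non-empty at \<open>One\<close> is non-empty at \<open>Reg\<close>.\<close>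

lemma to_One_Reg_epi: "epi_in (PSh M U) (to_One Reg)"
  using PSh.gen_in by (intro PSh.epi_of_surj[OF to_One[OF Reg_Ob]]) (auto simp: to_One_def pts_One)

text \<open>Elements of T correspond to maps from \<open>{base}\<close> to T, of which there is
  exactly one.\<close>

lemma Set_terminal: "terminal_in (Set_cat U) T \<Longrightarrow> \<exists>t. T = {t}"
proof -
  assume T: "terminal_in (Set_cat U) T"
  then have TOb: "T \<in> Ob (Set_cat U)" and ex1: "\<exists>!f. f \<in> Hom (Set_cat U) {base} T"
    using Set.Gen_Ob by (auto simp: terminal_in_def)
  then obtain f where f: "f \<in> Hom (Set_cat U) {base} T" by blast
  have "x = app f base" if "x \<in> T" for x
    using Set.generic[OF TOb that] ex1 f by blast
  moreover have "app f base \<in> T" using Set.app_in[OF f] by simp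
  ultimately have "T = {app f base}" by blast
  then show ?thesis by blast
qed

subsection \<open>Epimorphisms and projectivity\<close>

lemma Gamma_preserves_epis:
  assumes r: "right_absorbing M r"
  shows "preserves_epis (PSh M U) (Set_cat U) (Gamma M)"
  using left_adjoint_preserves_epis[OF _ is_category_PSh is_category_Set] Gamma_right_adjoint[OF r]
  by (auto simp: has_right_adjoint_def)

text \<open>Applied to the epimorphism from \<open>Reg\<close> to \<open>One\<close>, \<Gamma> gives
  a surjection onto a singleton, so \<open>Reg\<close> has a fixed point.\<close>

lemma preserves_epis_right_absorbing:
  assumes "preserves_epis (PSh M U) (Set_cat U) (Gamma M)"
  shows "\<exists>r. right_absorbing M r"
proof -
  have "epi_in (Set_cat U) (fmor (Gamma M) (to_One Reg))"
    using assms to_One_Reg_epi unfolding preserves_epis_def by blast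
  from Set_epi_surj[OF this Gamma_Hom[OF to_One[OF Reg_Ob]]] fixed_points_One
  obtain x where "x \<in> fixed_points M Reg" by auto
  then show ?thesis by (rule fixed_points_Reg)
qed

text \<open>A preimage x of a fixed point y may fail to be fixed, but xr is fixed and p(xr) = p(x)r
  = yr = y.\<close>

lemma One_projective:
  assumes r: "right_absorbing M r"
  shows "projective_in (PSh M U) One"
  unfolding projective_in_def
proof (intro conjI allI impI equalityI subsetI)
  fix p g assume p: "epi_in (PSh M U) p" and "g \<in> Hom (PSh M U) One (tgt (PSh M U) p)"
  obtain X Y where pH: "p \<in> Hom (PSh M U) X Y" using p Mor_in_Hom[of p] by (auto simp: epi_in_def)
  then have g: "g \<in> Hom (PSh M U) One Y"
    using \<open>g \<in> Hom (PSh M U) One (tgt (PSh M U) p)\<close> Hom_D(3)[OF pH] by simp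
  have X: "X \<in> Ob (PSh M U)" using pH by (simp add: Hom_PSh)
  have y: "app g base \<in> fixed_points M Y" using app_fixed_points[OF g] fixed_points_One by simp
  obtain x where x: "x \<in> pts X" "app p x = app g base"
    using PSh_epi_surj[OF p pH subsetD[OF fixed_points_subset y]] by blast
  define f where "f = from_One X (act X x r)"
  have f: "f \<in> Hom (PSh M U) One X"
    unfolding f_def by (rule from_One[OF X act_right_absorbing[OF X x(1) r]])
  have "cmp (PSh M U) p f = g"
  proof (rule PSh_mor_eqI[OF cmp_Hom[OF is_category_PSh f pH] g])
    fix z assume "z \<in> pts One"
    then show "app (cmp (PSh M U) p f) z = app g z"
      using PSh.app_cmp[OF f, of z p] app_act[OF pH x(1)] right_absorbingD(1)[OF r] x(2) fixed_points_act[OF y]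
      by (simp add: pts_One f_def app_from_One)
  qed
  then show "g \<in> (\<lambda>f. cmp (PSh M U) p f) ` Hom (PSh M U) One (src (PSh M U) p)"
    using f Hom_D(2)[OF pH] by blast
next
  fix p g assume p: "epi_in (PSh M U) p" and "g \<in> (\<lambda>f. cmp (PSh M U) p f) ` Hom (PSh M U) One (src (PSh M U) p)"
  then obtain f where f: "f \<in> Hom (PSh M U) One (src (PSh M U) p)" "g = cmp (PSh M U) p f" by blast
  have "p \<in> Mor (PSh M U)" using p by (simp add: epi_in_def)
  from cmp_Hom[OF is_category_PSh f(1) Mor_in_Hom[OF this]]
  show "g \<in> Hom (PSh M U) One (tgt (PSh M U) p)" by (simp only: f(2))
qed (rule One_Ob)

text \<open>Projectivity lifts the identity of T along the epimorphism from \<open>Reg\<close> to T;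
  the lift carries the only point of T, which is fixed, to a fixed point of
  \<open>Reg\<close>.\<close>

lemma projective_terminal_right_absorbing:
  assumes T: "terminal_in (PSh M U) T" and proj: "projective_in (PSh M U) T"
  shows "\<exists>r. right_absorbing M r"
proof -
  have TOb: "T \<in> Ob (PSh M U)" and ex1: "\<And>X. X \<in> Ob (PSh M U) \<Longrightarrow> \<exists>!f. f \<in> Hom (PSh M U) X T"
    using T by (auto simp: terminal_in_def)
  have single: "t = t'" if "t \<in> pts T" "t' \<in> pts T" for t t'
    using PSh.generic[OF TOb that(1)] PSh.generic[OF TOb that(2)] ex1[OF Reg_Ob] by blast
  obtain p where p: "p \<in> Hom (PSh M U) Reg T" using ex1[OF Reg_Ob] by blast
  have pt: "app p (reg_code \<one>) \<in> pts T" using app_PSh_in[OF p PSh.gen_in] .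
  have "epi_in (PSh M U) p"
    using single pt PSh.gen_in by (intro PSh.epi_of_surj[OF p]) blast
  then have "(\<lambda>f. cmp (PSh M U) p f) ` Hom (PSh M U) T (src (PSh M U) p) = Hom (PSh M U) T (tgt (PSh M U) p)"
    using proj unfolding projective_in_def by blast
  then have "(\<lambda>f. cmp (PSh M U) p f) ` Hom (PSh M U) T Reg = Hom (PSh M U) T T"
    by (simp only: Hom_D[OF p])
  then obtain s where s: "s \<in> Hom (PSh M U) T Reg" using ident_Hom[OF is_category_PSh TOb] by blast
  have "app p (reg_code \<one>) \<in> fixed_points M T"
    unfolding fixed_points_def using pt single act_in[OF TOb pt] by blast
  from fixed_points_Reg[OF app_fixed_points[OF s this]] show ?thesis .
qed

subsection \<open>Surjectivity of \<open>\<alpha>\<close>\<close>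

lemma app_alpha: "X \<in> Ob (PSh M U) \<Longrightarrow> x \<in> fixed_points M X \<Longrightarrow> app (alpha M U X) x = component M X x"
  by (simp add: alpha_def)

lemma alpha_Hom: "X \<in> Ob (PSh M U) \<Longrightarrow> alpha M U X \<in> Hom (Set_cat U) (fixed_points M X) (components M X)"
  using nat_trans_Hom[OF alpha_nat] by simp

text \<open>Each \<open>alpha M U X\<close> is surjective, since xr is a fixed point in the
  component of x, and natural transformations can be cancelled objectwise.\<close>

lemma right_absorbing_alpha_epi:
  assumes r: "right_absorbing M r"
  shows "epi_in (functor_category (PSh M U) (Set_cat U)) (Gamma M, alpha M U, Comps M)"
proof (rule epi_inI)
  show "(Gamma M, alpha M U, Comps M) \<in> Hom (functor_category (PSh M U) (Set_cat U)) (Gamma M) (Comps M)"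
    using is_functor_Gamma is_functor_Comps alpha_nat by (simp add: Hom_def functor_category_def)
  fix H g h
  assume g: "g \<in> Hom (functor_category (PSh M U) (Set_cat U)) (Comps M) H"
    and h: "h \<in> Hom (functor_category (PSh M U) (Set_cat U)) (Comps M) H"
    and eq: "cmp (functor_category (PSh M U) (Set_cat U)) g (Gamma M, alpha M U, Comps M)
      = cmp (functor_category (PSh M U) (Set_cat U)) h (Gamma M, alpha M U, Comps M)"
  obtain \<sigma> \<tau> where g': "g = (Comps M, \<sigma>, H)" and h': "h = (Comps M, \<tau>, H)"
    using g h by (cases g, cases h) (auto simp: Hom_def functor_category_def)
  have \<sigma>: "is_nat_trans (PSh M U) (Set_cat U) (Comps M) H \<sigma>"
    and \<tau>: "is_nat_trans (PSh M U) (Set_cat U) (Comps M) H \<tau>"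
    using g h by (auto simp: g' h' Hom_def functor_category_def)
  have eq': "nat_trans_comp (PSh M U) (Set_cat U) \<sigma> (alpha M U) = nat_trans_comp (PSh M U) (Set_cat U) \<tau> (alpha M U)"
    using eq by (simp add: g' h' functor_category_def)
  have "\<sigma> X = \<tau> X" if X: "X \<in> Ob (PSh M U)" for X
  proof (rule epi_in_cancel)
    show "alpha M U X \<in> Hom (Set_cat U) (fixed_points M X) (components M X)" using alpha_Hom[OF X] .
    then show "epi_in (Set_cat U) (alpha M U X)"
    proof (rule Set.epi_of_surj)
      fix c assume c: "c \<in> components M X"
      then have cX: "c \<in> pts X" by (rule subsetD[OF components_subset])
      have "component M X (act X c r) = c"
        using component_act[OF X cX right_absorbingD(1)[OF r]] component_of_components[OF c] by simp
      then show "\<exists>x\<in>fixed_points M X. app (alpha M U X) x = c"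
        using act_right_absorbing[OF X cX r] app_alpha[OF X] by metis
    qed
    show "\<sigma> X \<in> Hom (Set_cat U) (components M X) (fob H X)" "\<tau> X \<in> Hom (Set_cat U) (components M X) (fob H X)"
      using nat_trans_Hom[OF \<sigma> X] nat_trans_Hom[OF \<tau> X] by simp_all
    show "cmp (Set_cat U) (\<sigma> X) (alpha M U X) = cmp (Set_cat U) (\<tau> X) (alpha M U X)"
      using fun_cong[OF eq', of X] X by (simp add: nat_trans_comp_def)
  qed
  then show "g = h" using nat_trans_ext[OF \<sigma> \<tau>] by (simp add: g' h')
qed

text \<open>The image of \<alpha> at X.\<close>

definition fixed_components :: "('u, 'm) rset \<Rightarrow> 'u set" where
  "fixed_components X = component M X ` fixed_points M X"

text \<open>The cokernel pair of \<alpha>, formed objectwise: two copies of C glued along the image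
  of \<alpha>.\<close>

definition Comps_double :: "(('u, 'm) rset, ('u, 'm) rmap, 'u set, 'u set \<times> ('u \<Rightarrow> 'u) \<times> 'u set) functr" where
  "Comps_double = (let D = (\<lambda>X. double (components M X) (fixed_components X)) in
     \<lparr>fob = D, fmor = (\<lambda>f. (D (fst f),
        restrict (double_map (app (fmor (Comps M) f)) (fixed_components (snd (snd f)))) (D (fst f)), D (snd (snd f))))\<rparr>)"

lemma Comps_double_ob: "fob Comps_double X = double (components M X) (fixed_components X)"
  by (simp add: Comps_double_def)

lemma components_U: "X \<in> Ob (PSh M U) \<Longrightarrow> c \<in> components M X \<Longrightarrow> c \<in> U"
  using small_components[of X M U] by (auto simp: small_def)

lemma app_Comps_double:
  assumes f: "f \<in> Hom (PSh M U) X Y" and c: "c \<in> components M X" "b \<longrightarrow> c \<notin> fixed_components X"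
  shows "app (fmor Comps_double f) (dbl (b, c)) =
    dbl (b \<and> app (fmor (Comps M) f) c \<notin> fixed_components Y, app (fmor (Comps M) f) c)"
  using assms components_U[of X c]
  by (simp add: Comps_double_def Let_def Hom_PSh doubleI double_map_dbl)

lemma app_Comps_fixed_components:
  assumes f: "f \<in> Hom (PSh M U) X Y" and c: "c \<in> fixed_components X"
  shows "app (fmor (Comps M) f) c \<in> fixed_components Y"
proof -
  obtain x where x: "x \<in> fixed_points M X" "c = component M X x" using c by (auto simp: fixed_components_def)
  then show ?thesis
    using app_Comps[OF f subsetD[OF fixed_points_subset x(1)]] app_fixed_points[OF f x(1)]
    by (simp add: fixed_components_def)
qed

lemma Comps_double_Hom:
  assumes f: "f \<in> Hom (PSh M U) X Y"
  shows "fmor Comps_double f \<in> Hom (Set_cat U) (fob Comps_double X) (fob Comps_double Y)"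
proof -
  have XY: "X \<in> Ob (PSh M U)" "Y \<in> Ob (PSh M U)" and f': "fst f = X" "snd (snd f) = Y"
    using f by (auto simp: Hom_PSh)
  have "double_map (app (fmor (Comps M) f)) (fixed_components Y) z \<in> double (components M Y) (fixed_components Y)"
    if "z \<in> double (components M X) (fixed_components X)" for z
    using that
  proof (rule doubleE)
    fix b c assume z: "z = dbl (b, c)" "c \<in> components M X"
    show ?thesis
      using z components_U[OF XY(1) z(2)] Set.app_in[OF Comps_Hom[OF f] z(2)]
      by (simp add: double_map_dbl doubleI)
  qed
  then have "(fob Comps_double X, restrict (double_map (app (fmor (Comps M) f)) (fixed_components Y)) (fob Comps_double X), fob Comps_double Y)
      \<in> Hom (Set_cat U) (fob Comps_double X) (fob Comps_double Y)"
    by (intro Set_homI) (simp_all add: Comps_double_ob small_double small_components XY)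
  then show ?thesis by (simp add: Comps_double_def Let_def f')
qed

lemma is_functor_Comps_double: "is_functor (PSh M U) (Set_cat U) Comps_double"
  unfolding is_functor_def
proof (intro conjI ballI impI)
  fix f assume "f \<in> Mor (PSh M U)"
  then have f: "f \<in> Hom (PSh M U) (fst f) (snd (snd f))" using Mor_in_Hom[of f "PSh M U"] by simp
  show "fmor Comps_double f \<in> Hom (Set_cat U) (fob Comps_double (src (PSh M U) f)) (fob Comps_double (tgt (PSh M U) f))"
    using Comps_double_Hom[OF f] by simp
  fix g assume "g \<in> Mor (PSh M U)" "tgt (PSh M U) f = src (PSh M U) g"
  then have g: "g \<in> Hom (PSh M U) (snd (snd f)) (snd (snd g))" using Mor_in_Hom[of g "PSh M U"] by simp
  note gf = cmp_Hom[OF is_category_PSh f g]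
  show "fmor Comps_double (cmp (PSh M U) g f) = cmp (Set_cat U) (fmor Comps_double g) (fmor Comps_double f)"
  proof (rule Set_mor_eqI[OF Comps_double_Hom[OF gf]
        cmp_Hom[OF is_category_Set Comps_double_Hom[OF f] Comps_double_Hom[OF g]]])
    fix z assume z: "z \<in> fob Comps_double (fst f)"
    then obtain b c where bc: "z = dbl (b, c)" "c \<in> components M (fst f)" "b \<longrightarrow> c \<notin> fixed_components (fst f)"
      by (auto simp: Comps_double_ob elim: doubleE)
    let ?d = "app (fmor (Comps M) f) c"
    have d: "?d \<in> components M (snd (snd f))" using Set.app_in[OF Comps_Hom[OF f] bc(2)] .
    have gfc: "app (fmor (Comps M) (cmp (PSh M U) g f)) c = app (fmor (Comps M) g) ?d"
      using functor_cmp[OF is_functor_Comps f g] Set.app_cmp[OF Comps_Hom[OF f] bc(2)] by simp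
    show "app (fmor Comps_double (cmp (PSh M U) g f)) z = app (cmp (Set_cat U) (fmor Comps_double g) (fmor Comps_double f)) z"
      using app_Comps_fixed_components[OF g, of ?d] d bc z
      by (cases "?d \<in> fixed_components (snd (snd f))")
        (simp_all add: Set.app_cmp[OF Comps_double_Hom[OF f]] app_Comps_double[OF gf] app_Comps_double[OF f]
          app_Comps_double[OF g] gfc)
  qed
next
  fix X assume X: "X \<in> Ob (PSh M U)"
  show "fmor Comps_double (ident (PSh M U) X) = ident (Set_cat U) (fob Comps_double X)"
  proof (rule Set_mor_eqI[OF Comps_double_Hom[OF ident_Hom[OF is_category_PSh X]]])
    show "ident (Set_cat U) (fob Comps_double X) \<in> Hom (Set_cat U) (fob Comps_double X) (fob Comps_double X)"
      by (rule ident_Hom[OF is_category_Set]) (simp add: Comps_double_ob small_double small_components X)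
    fix z assume z: "z \<in> fob Comps_double X"
    then obtain b c where bc: "z = dbl (b, c)" "c \<in> components M X" "b \<longrightarrow> c \<notin> fixed_components X"
      by (auto simp: Comps_double_ob elim: doubleE)
    then show "app (fmor Comps_double (ident (PSh M U) X)) z = app (ident (Set_cat U) (fob Comps_double X)) z"
      using z app_Comps_double[OF ident_Hom[OF is_category_PSh X] bc(2,3)] functor_ident[OF is_functor_Comps X]
      by (cases b) (simp_all add: ident_Set)
  qed
qed (simp add: Comps_double_ob small_double small_components)

text \<open>The two inclusions of C into \<open>Comps_double\<close> agree after \<alpha>, so they
  coincide; but they can coincide only at components that contain a fixed point.\<close>

lemma alpha_epi_right_absorbing:
  assumes epi: "epi_in (functor_category (PSh M U) (Set_cat U)) (Gamma M, alpha M U, Comps M)"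
  shows "\<exists>r. right_absorbing M r"
proof -
  define g where "g b = (\<lambda>X\<in>Ob (PSh M U). (components M X,
    restrict (\<lambda>c. dbl (b \<and> c \<notin> fixed_components X, c)) (components M X), fob Comps_double X))" for b
  have g_Hom: "g b X \<in> Hom (Set_cat U) (components M X) (fob Comps_double X)" if X: "X \<in> Ob (PSh M U)" for b X
    using Set_homI[OF small_components[OF X] functor_Ob[OF is_functor_Comps_double X, unfolded Ob_Set],
        of "\<lambda>c. dbl (b \<and> c \<notin> fixed_components X, c)"] X
    by (simp add: g_def Comps_double_ob doubleI)
  have app_g: "app (g b X) c = dbl (b \<and> c \<notin> fixed_components X, c)"
    if "X \<in> Ob (PSh M U)" "c \<in> components M X" for b X c
    using that by (simp add: g_def)
  have g_nat: "is_nat_trans (PSh M U) (Set_cat U) (Comps M) Comps_double (g b)" for b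
  proof (rule is_nat_transI)
    fix X Y f assume f: "f \<in> Hom (PSh M U) X Y"
    have X: "X \<in> Ob (PSh M U)" and Y: "Y \<in> Ob (PSh M U)" using f by (auto simp: Hom_PSh)
    show "cmp (Set_cat U) (fmor Comps_double f) (g b X) = cmp (Set_cat U) (g b Y) (fmor (Comps M) f)"
    proof (rule Set_mor_eqI[OF cmp_Hom[OF is_category_Set g_Hom[OF X] Comps_double_Hom[OF f]]
          cmp_Hom[OF is_category_Set Comps_Hom[OF f] g_Hom[OF Y]]])
      fix c assume c: "c \<in> components M X"
      show "app (cmp (Set_cat U) (fmor Comps_double f) (g b X)) c = app (cmp (Set_cat U) (g b Y) (fmor (Comps M) f)) c"
        using Set.app_in[OF Comps_Hom[OF f] c] app_Comps_fixed_components[OF f, of c]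
        by (cases "c \<in> fixed_components X")
          (simp_all add: Set.app_cmp[OF g_Hom[OF X] c] Set.app_cmp[OF Comps_Hom[OF f] c] app_g[OF X c] app_g[OF Y]
            app_Comps_double[OF f c])
    qed
  qed (use g_Hom in \<open>auto simp: g_def\<close>)
  let ?FC = "functor_category (PSh M U) (Set_cat U)"
  have \<alpha>: "(Gamma M, alpha M U, Comps M) \<in> Hom ?FC (Gamma M) (Comps M)"
    using epi by (simp add: epi_in_def Hom_def functor_category_def)
  have gH: "(Comps M, g b, Comps_double) \<in> Hom ?FC (Comps M) Comps_double" for b
    using g_nat is_functor_Comps is_functor_Comps_double by (simp add: Hom_def functor_category_def)
  have "cmp (Set_cat U) (g False X) (alpha M U X) = cmp (Set_cat U) (g True X) (alpha M U X)"
    if X: "X \<in> Ob (PSh M U)" for X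
  proof (rule Set_mor_eqI[OF cmp_Hom[OF is_category_Set alpha_Hom[OF X] g_Hom[OF X]]
        cmp_Hom[OF is_category_Set alpha_Hom[OF X] g_Hom[OF X]]])
    fix x assume x: "x \<in> fixed_points M X"
    then have "component M X x \<in> fixed_components X" "component M X x \<in> components M X"
      using component_in[OF subsetD[OF fixed_points_subset x]] by (auto simp: fixed_components_def)
    then show "app (cmp (Set_cat U) (g False X) (alpha M U X)) x = app (cmp (Set_cat U) (g True X) (alpha M U X)) x"
      by (simp add: Set.app_cmp[OF alpha_Hom[OF X] x] app_alpha[OF X x] app_g[OF X])
  qed
  then have "cmp ?FC (Comps M, g False, Comps_double) (Gamma M, alpha M U, Comps M)
      = cmp ?FC (Comps M, g True, Comps_double) (Gamma M, alpha M U, Comps M)"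
    by (auto simp: functor_category_def nat_trans_comp_def)
  from epi_in_cancel[OF epi \<alpha> gH gH this] have eq: "g False = g True" by simp
  \<comment> \<open>Evaluation at the regular M-set is enough: the component of its generator must
    contain a fixed point.\<close>
  define c where "c = component M Reg (reg_code \<one>)"
  have c: "c \<in> components M Reg" unfolding c_def by (rule component_in[OF PSh.gen_in])
  have "app (g False Reg) c = app (g True Reg) c" using eq by simp
  then have "c \<in> fixed_components Reg"
    using components_U[OF Reg_Ob c] by (simp add: app_g[OF Reg_Ob c] dbl_eq_iff)
  then show ?thesis using fixed_points_Reg by (auto simp: fixed_components_def)
qed

subsection \<open>Products of components\<close>

text \<open>Surjectivity onto families of components follows by choosing representatives.
  Injectivity first moves both points into fixed points by acting with r, without leaving their
  components.\<close>

lemma Comps_preserves_finite_products: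
  assumes r: "right_absorbing M r"
  shows "preserves_finite_products (PSh M U) (Set_cat U) (Comps M)"
  unfolding preserves_finite_products_def preserves_limits_of_shape_def
proof (intro allI impI)
  fix J :: "(nat, nat) category" and D L \<pi>
  assume fin: "finite_category J" and disc: "discrete_category J"
    and D: "is_functor J (PSh M U) D" and lim: "is_limit J (PSh M U) D L \<pi>"
  have J: "is_category J" and fin_J: "finite (Ob J)" using fin by (auto simp: finite_category_def)
  have L: "L \<in> Ob (PSh M U)" and \<pi>: "\<And>j. j \<in> Ob J \<Longrightarrow> \<pi> j \<in> Hom (PSh M U) L (fob D j)"
    and cone: "\<And>u. u \<in> Mor J \<Longrightarrow> cmp (PSh M U) (fmor D u) (\<pi> (src J u)) = \<pi> (tgt J u)"
    using lim by (auto simp: is_limit_def is_cone_def)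
  have DOb: "fob D j \<in> Ob (PSh M U)" if "j \<in> Ob J" for j using functor_Ob[OF D that] .
  have \<pi>_in: "app (\<pi> j) l \<in> pts (fob D j)" if "j \<in> Ob J" "l \<in> pts L" for j l
    using app_PSh_in[OF \<pi>[OF that(1)] that(2)] .
  have \<pi>_inj: "l = l'" if "l \<in> pts L" "l' \<in> pts L" "\<And>j. j \<in> Ob J \<Longrightarrow> app (\<pi> j) l = app (\<pi> j) l'" for l l'
    using PSh.limit_jointly_inj[OF D lim J that] .
  have J_ob: "src J u \<in> Ob J" "tgt J u \<in> Ob J" if "u \<in> Mor J" for u
    using J that by (auto simp: is_category_def)
  \<comment> \<open>The only arrows of the shape are identities, so every family of elements is
    compatible.\<close>
  have family: "\<exists>l\<in>pts L. \<forall>j\<in>Ob J. app (\<pi> j) l = x j" if x: "\<And>j. j \<in> Ob J \<Longrightarrow> x j \<in> pts (fob D j)" for x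
  proof -
    have "\<exists>!l. l \<in> pts L \<and> (\<forall>j\<in>Ob J. app (\<pi> j) l = x j)"
    proof (rule PSh.limit_elements[OF D lim x _ J])
      fix u assume "u \<in> Mor J"
      then obtain j where j: "j \<in> Ob J" "u = ident J j" using disc by (auto simp: discrete_category_def)
      then have "src J u = j" "tgt J u = j" using Hom_D[OF ident_Hom[OF J j(1)]] by simp_all
      then show "app (fmor D u) (x (src J u)) = x (tgt J u)"
        using j functor_ident[OF D j(1)] x[OF j(1)] by (simp add: ident_PSh)
    qed
    then show ?thesis by blast
  qed
  have C\<pi>: "app (fmor (Comps M) (\<pi> j)) (component M L l) = component M (fob D j) (app (\<pi> j) l)"
    if "j \<in> Ob J" "l \<in> pts L" for j l
    using app_Comps[OF \<pi>[OF that(1)] that(2)] .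
  text \<open>Fixed points of \<open>L\<close> in equal components of all factors are connected by changing one
    coordinate at a time; the other coordinates being fixed, this is a homomorphism from a factor
    to \<open>L\<close>.\<close>
  have fixed_connected: "component M L a = component M L a'"
    if "finite T" "T \<subseteq> Ob J" "a \<in> fixed_points M L" "a' \<in> fixed_points M L"
      "\<And>j. j \<in> Ob J \<Longrightarrow> component M (fob D j) (app (\<pi> j) a) = component M (fob D j) (app (\<pi> j) a')"
      "\<And>j. j \<in> Ob J - T \<Longrightarrow> app (\<pi> j) a = app (\<pi> j) a'" for T a a'
    using that
  proof (induction T arbitrary: a)
    case empty
    have "a = a'"
      by (rule \<pi>_inj) (use empty in \<open>auto intro: subsetD[OF fixed_points_subset]\<close>)
    then show ?case by simp
  next
    case (insert k T)
    have k: "k \<in> Ob J" and a: "a \<in> pts L" and a': "a' \<in> pts L"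
      using insert.prems by (auto intro: subsetD[OF fixed_points_subset])
    have "\<exists>l\<in>pts L. \<forall>j\<in>Ob J. app (\<pi> j) l = (if j = k then y else app (\<pi> j) a)"
      if "y \<in> pts (fob D k)" for y
      using that a by (intro family) (auto intro: \<pi>_in)
    then obtain \<iota> where \<iota>: "\<And>y. y \<in> pts (fob D k) \<Longrightarrow> \<iota> y \<in> pts L"
      "\<And>y j. y \<in> pts (fob D k) \<Longrightarrow> j \<in> Ob J \<Longrightarrow> app (\<pi> j) (\<iota> y) = (if j = k then y else app (\<pi> j) a)"
      by metis
    have \<iota>_act: "\<iota> (act (fob D k) y m) = act L (\<iota> y) m" if y: "y \<in> pts (fob D k)" and m: "m \<in> carrier M" for y m
    proof (rule \<pi>_inj)
      have ym: "act (fob D k) y m \<in> pts (fob D k)" using act_in[OF DOb[OF k] y m] .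
      show "\<iota> (act (fob D k) y m) \<in> pts L" "act L (\<iota> y) m \<in> pts L"
        using \<iota>(1)[OF ym] act_in[OF L \<iota>(1)[OF y] m] .
      fix j assume j: "j \<in> Ob J"
      have "act (fob D j) (app (\<pi> j) a) m = app (\<pi> j) a"
        using app_fixed_points[OF \<pi>[OF j] insert.prems(2)] fixed_points_act m by metis
      then show "app (\<pi> j) (\<iota> (act (fob D k) y m)) = app (\<pi> j) (act L (\<iota> y) m)"
        using \<iota>(2)[OF ym j] \<iota>(2)[OF y j] app_act[OF \<pi>[OF j] \<iota>(1)[OF y] m] by simp
    qed
    have ka: "app (\<pi> k) a \<in> pts (fob D k)" and ka': "app (\<pi> k) a' \<in> pts (fob D k)"
      using \<pi>_in[OF k] a a' by auto
    \<comment> \<open>The intermediate point: it has the k-th coordinate of a' and the other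
      coordinates of a. It is fixed, lies in the component of a, and can differ from a' only at
      coordinates in T.\<close>
    define b where "b = \<iota> (app (\<pi> k) a')"
    have b: "b \<in> pts L" unfolding b_def by (rule \<iota>(1)[OF ka'])
    have \<pi>b: "app (\<pi> j) b = (if j = k then app (\<pi> k) a' else app (\<pi> j) a)" if "j \<in> Ob J" for j
      unfolding b_def using \<iota>(2)[OF ka' that] .
    have "\<iota> (app (\<pi> k) a) = a"
      by (rule \<pi>_inj) (use \<iota> ka a in auto)
    moreover have "component M L (\<iota> (app (\<pi> k) a)) = component M L (\<iota> (app (\<pi> k) a'))"
    proof (rule component_invariant[of "fob D k" M "\<lambda>y. component M L (\<iota> y)", OF _ ka ka' insert.prems(4)[OF k]])
      show "component M L (\<iota> (act (fob D k) y m)) = component M L (\<iota> y)"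
        if "y \<in> pts (fob D k)" "m \<in> carrier M" for y m
        using \<iota>_act[OF that] component_act[OF L \<iota>(1)[OF that(1)] that(2)] by simp
    qed
    moreover have "component M L b = component M L a'"
    proof (rule insert.IH)
      show "T \<subseteq> Ob J" "a' \<in> fixed_points M L" using insert.prems by auto
      have "act (fob D k) (app (\<pi> k) a') m = app (\<pi> k) a'" if "m \<in> carrier M" for m
        using fixed_points_act[OF app_fixed_points[OF \<pi>[OF k] insert.prems(3)] that] .
      then have "act L b m = b" if "m \<in> carrier M" for m
        using \<iota>_act[OF ka' that] that by (simp add: b_def)
      then show "b \<in> fixed_points M L" using b by (simp add: fixed_points_def)
      show "component M (fob D j) (app (\<pi> j) b) = component M (fob D j) (app (\<pi> j) a')" if "j \<in> Ob J" for j
        using \<pi>b[OF that] insert.prems(4)[OF that] by simp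
      show "app (\<pi> j) b = app (\<pi> j) a'" if "j \<in> Ob J - T" for j
        using \<pi>b[of j] insert.prems(5)[of j] that by auto
    qed
    ultimately show ?case by (simp add: b_def)
  qed
  show "is_limit J (Set_cat U) (functor_comp (Comps M) D) (fob (Comps M) L) (\<lambda>j. fmor (Comps M) (\<pi> j))"
  proof (rule Set.is_limitI[OF is_functor_comp[OF D is_functor_Comps] J functor_Ob[OF is_functor_Comps L]])
    show "fmor (Comps M) (\<pi> j) \<in> Hom (Set_cat U) (fob (Comps M) L) (fob (functor_comp (Comps M) D) j)"
      if "j \<in> Ob J" for j
      using functor_Hom[OF is_functor_Comps \<pi>[OF that]] by (simp add: functor_comp_def)
    show "app (fmor (functor_comp (Comps M) D) u) (app (fmor (Comps M) (\<pi> (src J u))) c)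
        = app (fmor (Comps M) (\<pi> (tgt J u))) c" if u: "u \<in> Mor J" and c: "c \<in> fob (Comps M) L" for u c
      using functor_cmp[OF is_functor_Comps \<pi>[OF J_ob(1)[OF u]] functor_Hom[OF D Mor_in_Hom[OF u]]] cone[OF u]
        Set.app_cmp[OF functor_Hom[OF is_functor_Comps \<pi>[OF J_ob(1)[OF u]]] c, of "fmor (Comps M) (fmor D u)"]
      by (simp add: functor_comp_def)
  next
    fix x assume "\<And>j. j \<in> Ob J \<Longrightarrow> x j \<in> fob (functor_comp (Comps M) D) j"
    then have x: "x j \<in> components M (fob D j)" if "j \<in> Ob J" for j using that by (simp add: functor_comp_def)
    have "x j \<in> pts (fob D j)" if "j \<in> Ob J" for j using subsetD[OF components_subset x[OF that]] .
    then obtain l where l: "l \<in> pts L" "\<And>j. j \<in> Ob J \<Longrightarrow> app (\<pi> j) l = x j" using family by blast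
    have "app (fmor (Comps M) (\<pi> j)) (component M L l) = x j" if "j \<in> Ob J" for j
      using C\<pi>[OF that l(1)] l(2)[OF that] component_of_components[OF x[OF that]] by simp
    then show "\<exists>c\<in>fob (Comps M) L. \<forall>j\<in>Ob J. app (fmor (Comps M) (\<pi> j)) c = x j"
      using component_in[OF l(1), of M] by auto
  next
    fix c c' assume c: "c \<in> fob (Comps M) L" "c' \<in> fob (Comps M) L"
      and eq: "\<forall>j\<in>Ob J. app (fmor (Comps M) (\<pi> j)) c = app (fmor (Comps M) (\<pi> j)) c'"
    have rM: "r \<in> carrier M" using right_absorbingD(1)[OF r] .
    have cL: "c \<in> pts L" "c' \<in> pts L" using c components_subset[of M L] by auto
    have cc: "component M L c = c" "component M L c' = c'" using c by (simp_all add: component_of_components)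
    have "component M L (act L c r) = component M L (act L c' r)"
    proof (rule fixed_connected[OF fin_J subset_refl])
      show "act L c r \<in> fixed_points M L" "act L c' r \<in> fixed_points M L"
        using act_right_absorbing[OF L _ r] cL by auto
      fix j assume j: "j \<in> Ob J"
      have "component M (fob D j) (app (\<pi> j) (act L d r)) = app (fmor (Comps M) (\<pi> j)) (component M L d)"
        if "d \<in> pts L" for d
        using app_act[OF \<pi>[OF j] that rM] component_act[OF DOb[OF j] \<pi>_in[OF j that] rM] C\<pi>[OF j that] by simp
      then show "component M (fob D j) (app (\<pi> j) (act L c r)) = component M (fob D j) (app (\<pi> j) (act L c' r))"
        using cL cc eq j by simp
    qed simp
    then show "c = c'" using component_act[OF L _ rM] cL cc by metis
  qed
qed

subsection \<open>Fullness and non-empty objects\<close>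

text \<open>A map g on components is induced by sending x to the representative of g's value at the
  component of x, acted on by r. This is constant on components with fixed values, hence
  equivariant.\<close>

lemma Comps_full:
  assumes r: "right_absorbing M r"
  shows "full_functor (PSh M U) (Set_cat U) (Comps M)"
  unfolding full_functor_def Comps_ob
proof (intro ballI)
  fix X Y g assume X: "X \<in> Ob (PSh M U)" and Y: "Y \<in> Ob (PSh M U)"
    and g: "g \<in> Hom (Set_cat U) (components M X) (components M Y)"
  define k where "k x = act Y (app g (component M X x)) r" for x
  have gx: "app g (component M X x) \<in> components M Y" if "x \<in> pts X" for x
    using Set.app_in[OF g component_in[OF that]] .
  have k: "k x \<in> fixed_points M Y" if "x \<in> pts X" for x
    unfolding k_def by (rule act_right_absorbing[OF Y subsetD[OF components_subset gx[OF that]] r])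
  have f: "(X, restrict k (pts X), Y) \<in> Hom (PSh M U) X Y"
  proof (rule PSh_homI[OF X Y])
    show "k x \<in> pts Y" if "x \<in> pts X" for x using subsetD[OF fixed_points_subset k[OF that]] .
    show "k (act X x m) = act Y (k x) m" if "x \<in> pts X" "m \<in> carrier M" for x m
      using fixed_points_act[OF k[OF that(1)] that(2)] component_act[OF X that] by (simp add: k_def)
  qed
  have "fmor (Comps M) (X, restrict k (pts X), Y) = g"
  proof (rule Set_mor_eqI[OF Comps_Hom[OF f] g])
    fix c assume "c \<in> components M X"
    then obtain x where x: "x \<in> pts X" "c = component M X x" by (auto simp: components_eq)
    have "component M Y (k x) = app g c"
      unfolding k_def x(2)
      using component_act[OF Y subsetD[OF components_subset gx[OF x(1)]] right_absorbingD(1)[OF r]]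
        component_of_components[OF gx[OF x(1)]] by simp
    then show "app (fmor (Comps M) (X, restrict k (pts X), Y)) c = app g c"
      using app_Comps[OF f x(1)] x by simp
  qed
  then show "\<exists>f\<in>Hom (PSh M U) X Y. fmor (Comps M) f = g" using f by blast
qed

text \<open>The components of \<open>Reg\<close> form a non-empty set, so there is a map to it from
  those of \<open>One\<close>; fullness yields a map from \<open>One\<close> to
  \<open>Reg\<close>.\<close>

lemma full_right_absorbing:
  assumes full: "full_functor (PSh M U) (Set_cat U) (Comps M)"
  shows "\<exists>r. right_absorbing M r"
proof -
  define c where "c = component M Reg (reg_code \<one>)"
  have c: "c \<in> components M Reg" unfolding c_def by (rule component_in[OF PSh.gen_in])
  have "(components M One, restrict (\<lambda>_. c) (components M One), components M Reg)
      \<in> Hom (Set_cat U) (components M One) (components M Reg)"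
    by (rule Set_homI[OF small_components[OF One_Ob] small_components[OF Reg_Ob] c])
  then obtain f where f: "f \<in> Hom (PSh M U) One Reg"
    using full One_Ob Reg_Ob unfolding full_functor_def Comps_ob by blast
  show ?thesis
    by (rule fixed_points_Reg[OF app_fixed_points[OF f]]) (simp add: fixed_points_One)
qed

lemma PSh_initial_iff: "X \<in> Ob (PSh M U) \<Longrightarrow> initial_in (PSh M U) X \<longleftrightarrow> pts X = {}"
proof
  assume X: "X \<in> Ob (PSh M U)" and "initial_in (PSh M U) X"
  moreover have "fob Delta {} \<in> Ob (PSh M U)"
    using small_finite[OF infinite_U, of "{}"] by (simp add: Delta_Ob)
  ultimately obtain f where "f \<in> Hom (PSh M U) X (fob Delta {})" unfolding initial_in_def by blast
  then show "pts X = {}" using app_PSh_in by fastforce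
next
  assume X: "X \<in> Ob (PSh M U)" and empty: "pts X = {}"
  have "\<exists>!f. f \<in> Hom (PSh M U) X Y" if Y: "Y \<in> Ob (PSh M U)" for Y
  proof (rule ex1I)
    show f: "(X, restrict undefined (pts X), Y) \<in> Hom (PSh M U) X Y"
      by (rule PSh_homI[OF X Y]) (simp_all add: empty)
    show "g = (X, restrict undefined (pts X), Y)" if "g \<in> Hom (PSh M U) X Y" for g
      by (rule PSh_mor_eqI[OF that f]) (simp add: empty)
  qed
  then show "initial_in (PSh M U) X" using X by (simp add: initial_in_def)
qed

lemma Set_initial_iff: "small U A \<Longrightarrow> initial_in (Set_cat U) A \<longleftrightarrow> A = {}"
proof
  assume A: "small U A" and "initial_in (Set_cat U) A"
  moreover have "{} \<in> Ob (Set_cat U)" using small_finite[OF infinite_U, of "{}"] by simp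
  ultimately obtain f where "f \<in> Hom (Set_cat U) A {}" unfolding initial_in_def by blast
  then show "A = {}" by (auto simp: Hom_Set)
next
  assume A: "small U A" and empty: "A = {}"
  have "\<exists>!f. f \<in> Hom (Set_cat U) A B" if B: "B \<in> Ob (Set_cat U)" for B
  proof (rule ex1I)
    show f: "(A, restrict undefined A, B) \<in> Hom (Set_cat U) A B"
      by (rule Set_homI) (use A B empty in simp_all)
    show "g = (A, restrict undefined A, B)" if "g \<in> Hom (Set_cat U) A B" for g
      by (rule Set_mor_eqI[OF that f]) (simp add: empty)
  qed
  then show "initial_in (Set_cat U) A" using A by (simp add: initial_in_def)
qed

text \<open>Initial objects are exactly the empty ones in both categories, so this is a
  contraposition.\<close>

lemma reflects_initial_Gamma_iff: "reflects_initial (PSh M U) (Set_cat U) (Gamma M) \<longleftrightarrow>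
    (\<forall>X\<in>Ob (PSh M U). pts X \<noteq> {} \<longrightarrow> fixed_points M X \<noteq> {})"
  unfolding reflects_initial_def Gamma_ob
  using PSh_initial_iff Set_initial_iff[OF small_fixed_points] by metis

lemma right_absorbing_iff_nonempty_fixed_points:
  "(\<exists>r. right_absorbing M r) \<longleftrightarrow> (\<forall>X\<in>Ob (PSh M U). pts X \<noteq> {} \<longrightarrow> fixed_points M X \<noteq> {})"
proof
  assume "\<exists>r. right_absorbing M r"
  then obtain r where "right_absorbing M r" by blast
  then show "\<forall>X\<in>Ob (PSh M U). pts X \<noteq> {} \<longrightarrow> fixed_points M X \<noteq> {}"
    using act_right_absorbing[of _ M U _ r] by blast
next
  assume "\<forall>X\<in>Ob (PSh M U). pts X \<noteq> {} \<longrightarrow> fixed_points M X \<noteq> {}"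
  then have "fixed_points M Reg \<noteq> {}" using Reg_Ob PSh.gen_in by blast
  then show "\<exists>r. right_absorbing M r" using fixed_points_Reg by blast
qed

subsection \<open>Points\<close>

text \<open>All that the argument uses of an arbitrary point: its inverse image is a left adjoint,
  hence keeps epimorphisms, and is left exact, hence keeps the terminal object.\<close>

lemma point_inverse_image:
  assumes p: "geometric_morphism (Set_cat U) (PSh M U) p"
  shows "is_functor (PSh M U) (Set_cat U) (inv_im p)" "preserves_epis (PSh M U) (Set_cat U) (inv_im p)"
    "\<exists>t. fob (inv_im p) One = {t}"
proof -
  have adj: "adjunction (PSh M U) (Set_cat U) (inv_im p) (dir_im p) (gunit p) (gcounit p)"
    and lim: "preserves_finite_limits (PSh M U) (Set_cat U) (inv_im p)"
    using p by (auto simp: geometric_morphism_def)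
  show "is_functor (PSh M U) (Set_cat U) (inv_im p)" using adj by (simp add: adjunction_def)
  show "preserves_epis (PSh M U) (Set_cat U) (inv_im p)"
    by (rule left_adjoint_preserves_epis[OF adj is_category_PSh is_category_Set])
  show "\<exists>t. fob (inv_im p) One = {t}"
    by (rule Set_terminal[OF preserves_terminal[OF lim One_terminal]])
qed

lemma Hom_points: "f \<in> Hom (points_category M U) p q \<longleftrightarrow>
    (\<exists>\<tau>. f = (p, \<tau>, q) \<and> geometric_morphism (Set_cat U) (PSh M U) p \<and>
      geometric_morphism (Set_cat U) (PSh M U) q \<and>
      is_nat_trans (PSh M U) (Set_cat U) (inv_im p) (inv_im q) \<tau>)"
  by (cases f) (auto simp: Hom_def points_category_def)

text \<open>Since \<open>\<Gamma>\<close> is represented by the terminal object, this is the Yoneda lemma.\<close>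

lemma ex1_nat_trans_from_Gamma:
  assumes F: "is_functor (PSh M U) (Set_cat U) F" and t: "fob F One = {t}"
  shows "\<exists>!\<tau>. is_nat_trans (PSh M U) (Set_cat U) (Gamma M) F \<tau>"
proof (rule ex1I)
  \<comment> \<open>A fixed point x, viewed as a map from \<open>One\<close> to X, is sent to the
    value at t of F applied to that map.\<close>
  define \<tau> where "\<tau> = (\<lambda>X\<in>Ob (PSh M U).
    (fixed_points M X, restrict (\<lambda>x. app (fmor F (from_One X x)) t) (fixed_points M X), fob F X))"
  have F1: "fmor F (from_One X x) \<in> Hom (Set_cat U) {t} (fob F X)"
    if "X \<in> Ob (PSh M U)" "x \<in> fixed_points M X" for X x
    using functor_Hom[OF F from_One[OF that]] t by simp
  have \<tau>: "\<tau> X \<in> Hom (Set_cat U) (fixed_points M X) (fob F X)" if X: "X \<in> Ob (PSh M U)" for X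
    using Set_homI[OF small_fixed_points[OF X] functor_Ob[OF F X, unfolded Ob_Set],
        of "\<lambda>x. app (fmor F (from_One X x)) t"] Set.app_in[OF F1[OF X]] X by (simp add: \<tau>_def)
  show "is_nat_trans (PSh M U) (Set_cat U) (Gamma M) F \<tau>"
  proof (rule is_nat_transI)
    show "\<tau> X \<in> Hom (Set_cat U) (fob (Gamma M) X) (fob F X)" if "X \<in> Ob (PSh M U)" for X
      using \<tau>[OF that] by simp
    fix X Y f assume f: "f \<in> Hom (PSh M U) X Y"
    have X: "X \<in> Ob (PSh M U)" and Y: "Y \<in> Ob (PSh M U)" using f by (auto simp: Hom_PSh)
    show "cmp (Set_cat U) (fmor F f) (\<tau> X) = cmp (Set_cat U) (\<tau> Y) (fmor (Gamma M) f)"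
    proof (rule Set_mor_eqI[OF cmp_Hom[OF is_category_Set \<tau>[OF X] functor_Hom[OF F f]]
          cmp_Hom[OF is_category_Set Gamma_Hom[OF f] \<tau>[OF Y]]])
      fix x assume x: "x \<in> fixed_points M X"
      note px = from_One[OF X x]
      have "cmp (PSh M U) f (from_One X x) = from_One Y (app f x)"
        using PSh.app_cmp[OF px, of base f]
        by (intro from_One_eqI cmp_Hom[OF is_category_PSh px f]) (simp add: pts_One app_from_One)
      then have "app (fmor F f) (app (fmor F (from_One X x)) t) = app (fmor F (from_One Y (app f x))) t"
        using functor_cmp[OF F px f] Set.app_cmp[OF F1[OF X x], of t "fmor F f"] by simp
      then show "app (cmp (Set_cat U) (fmor F f) (\<tau> X)) x = app (cmp (Set_cat U) (\<tau> Y) (fmor (Gamma M) f)) x"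
        using X Y x app_fixed_points[OF f x]
        by (simp add: Set.app_cmp[OF \<tau>[OF X] x] Set.app_cmp[OF Gamma_Hom[OF f] x] app_Gamma[OF f x])
          (simp add: \<tau>_def)
    qed
  qed (simp add: \<tau>_def)
  fix \<sigma> assume \<sigma>: "is_nat_trans (PSh M U) (Set_cat U) (Gamma M) F \<sigma>"
  have \<sigma>_Hom: "\<sigma> X \<in> Hom (Set_cat U) (fixed_points M X) (fob F X)" if "X \<in> Ob (PSh M U)" for X
    using nat_trans_Hom[OF \<sigma> that] by simp
  show "\<sigma> = \<tau>"
  proof (rule extensionalityI)
    show "\<sigma> \<in> extensional (Ob (PSh M U))" using \<sigma> by (simp add: is_nat_trans_def)
    show "\<tau> \<in> extensional (Ob (PSh M U))" by (simp add: \<tau>_def)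
    fix X assume X: "X \<in> Ob (PSh M U)"
    show "\<sigma> X = \<tau> X"
    proof (rule Set_mor_eqI[OF \<sigma>_Hom[OF X] \<tau>[OF X]])
      fix x assume x: "x \<in> fixed_points M X"
      note px = from_One[OF X x]
      have base: "base \<in> fixed_points M One" by (simp add: fixed_points_One)
      \<comment> \<open>The universal element of \<Gamma> is \<open>base\<close> in
        \<open>One\<close>. As F has a single element there, its image is forced, and naturality
        along \<open>from_One X x\<close> determines \<open>\<sigma> X\<close> at x.\<close>
      have \<sigma>_base: "app (\<sigma> One) base = t"
        using Set.app_in[OF \<sigma>_Hom[OF One_Ob] base] t by simp
      have "app (cmp (Set_cat U) (fmor F (from_One X x)) (\<sigma> One)) base
          = app (cmp (Set_cat U) (\<sigma> X) (fmor (Gamma M) (from_One X x))) base"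
        using nat_trans_natural[OF \<sigma> px] by simp
      then have "app (\<sigma> X) x = app (fmor F (from_One X x)) t"
        using Set.app_cmp[OF \<sigma>_Hom[OF One_Ob] base] Set.app_cmp[OF Gamma_Hom[OF px] base]
          app_Gamma[OF px base] \<sigma>_base by (simp add: app_from_One)
      then show "app (\<sigma> X) x = app (\<tau> X) x" using X x by (simp add: \<tau>_def)
    qed
  qed
qed

lemma right_absorbing_initial_point:
  assumes r: "right_absorbing M r"
  shows "\<exists>p. initial_in (points_category M U) p"
proof -
  obtain p where p: "geometric_morphism (Set_cat U) (PSh M U) p" and p\<Gamma>: "inv_im p = Gamma M"
    using Gamma_point[OF r] by blast
  have "\<exists>!f. f \<in> Hom (points_category M U) p q" if q: "geometric_morphism (Set_cat U) (PSh M U) q" for q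
  proof -
    obtain t where "fob (inv_im q) One = {t}" using point_inverse_image(3)[OF q] by blast
    from ex1_nat_trans_from_Gamma[OF point_inverse_image(1)[OF q] this]
    show ?thesis using p q unfolding Hom_points p\<Gamma> by blast
  qed
  then have "initial_in (points_category M U) p"
    using p by (simp add: initial_in_def points_category_def)
  then show ?thesis by blast
qed

text \<open>The canonical point, whose inverse image is the forgetful functor, has every \<open>m \<in> M\<close> as an
  endomorphism \<open>x \<mapsto> xm\<close>; so the map from an initial point takes values in fixed points.\<close>

lemma initial_point_right_absorbing:
  assumes p: "initial_in (points_category M U) p"
  shows "\<exists>r. right_absorbing M r"
proof -
  obtain q where q: "geometric_morphism (Set_cat U) (PSh M U) q" and qV: "inv_im q = Forget"
    using forgetful_point by blast
  have pg: "geometric_morphism (Set_cat U) (PSh M U) p"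
    and ex1: "\<exists>!f. f \<in> Hom (points_category M U) p q"
    using p q by (auto simp: initial_in_def points_category_def)
  define F where "F = inv_im p"
  note F = point_inverse_image[OF pg, folded F_def]
  obtain \<tau> where \<tau>: "is_nat_trans (PSh M U) (Set_cat U) F Forget \<tau>"
    using ex1 unfolding Hom_points qV F_def by blast
  have uniq: "\<sigma> = \<tau>" if "is_nat_trans (PSh M U) (Set_cat U) F Forget \<sigma>" for \<sigma>
  proof -
    have "(p, \<sigma>, q) \<in> Hom (points_category M U) p q" "(p, \<tau>, q) \<in> Hom (points_category M U) p q"
      unfolding Hom_points qV using pg q that \<tau> by (auto simp: F_def)
    then have "(p, \<sigma>, q) = (p, \<tau>, q)" using ex1 by blast
    then show ?thesis by simp
  qed
  have \<tau>_Hom: "\<tau> X \<in> Hom (Set_cat U) (fob F X) (pts X)" if "X \<in> Ob (PSh M U)" for X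
    using nat_trans_Hom[OF \<tau> that] by (simp add: Forget_def)
  have shifted: "act X (app (\<tau> X) b) m = app (\<tau> X) b"
    if m: "m \<in> carrier M" and X: "X \<in> Ob (PSh M U)" and b: "b \<in> fob F X" for m X b
  proof -
    \<comment> \<open>This is \<tau> followed by the endomorphism x \<mapsto> xm of the forgetful
      functor, natural because morphisms are equivariant.\<close>
    define \<sigma> where "\<sigma> = (\<lambda>X\<in>Ob (PSh M U). (fob F X, restrict (\<lambda>b. act X (app (\<tau> X) b) m) (fob F X), pts X))"
    have \<sigma>_Hom: "\<sigma> X \<in> Hom (Set_cat U) (fob F X) (pts X)" if X: "X \<in> Ob (PSh M U)" for X
      using Set_homI[OF functor_Ob[OF F(1) X, unfolded Ob_Set], of "pts X" "\<lambda>b. act X (app (\<tau> X) b) m"]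
        act_in[OF X Set.app_in[OF \<tau>_Hom[OF X]] m] X by (simp add: \<sigma>_def Ob_PSh)
    have "is_nat_trans (PSh M U) (Set_cat U) F Forget \<sigma>"
    proof (rule is_nat_transI)
      show "\<sigma> X \<in> Hom (Set_cat U) (fob F X) (fob Forget X)" if "X \<in> Ob (PSh M U)" for X
        using \<sigma>_Hom[OF that] by (simp add: Forget_def)
      fix X Y f assume f: "f \<in> Hom (PSh M U) X Y"
      have X: "X \<in> Ob (PSh M U)" and Y: "Y \<in> Ob (PSh M U)" using f by (auto simp: Hom_PSh)
      note Ff = functor_Hom[OF F(1) f]
      show "cmp (Set_cat U) (fmor Forget f) (\<sigma> X) = cmp (Set_cat U) (\<sigma> Y) (fmor F f)"
      proof (rule Set_mor_eqI[OF cmp_Hom[OF is_category_Set \<sigma>_Hom[OF X] Forget_Hom[OF f]]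
            cmp_Hom[OF is_category_Set Ff \<sigma>_Hom[OF Y]]])
        fix b assume b: "b \<in> fob F X"
        have "app (cmp (Set_cat U) (fmor Forget f) (\<tau> X)) b = app (cmp (Set_cat U) (\<tau> Y) (fmor F f)) b"
          using nat_trans_natural[OF \<tau> f] by simp
        then have "app f (app (\<tau> X) b) = app (\<tau> Y) (app (fmor F f) b)"
          using Set.app_cmp[OF \<tau>_Hom[OF X] b] Set.app_cmp[OF Ff b] by (simp add: Forget_def)
        then show "app (cmp (Set_cat U) (fmor Forget f) (\<sigma> X)) b = app (cmp (Set_cat U) (\<sigma> Y) (fmor F f)) b"
          using X Y b Set.app_in[OF Ff b] app_act[OF f Set.app_in[OF \<tau>_Hom[OF X] b] m]
          by (simp add: Set.app_cmp[OF \<sigma>_Hom[OF X] b] Set.app_cmp[OF Ff b]) (simp add: \<sigma>_def Forget_def)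
      qed
    qed (simp add: \<sigma>_def)
    from fun_cong[OF uniq[OF this], of X] have "\<tau> X = \<sigma> X" by simp
    then have "app (\<tau> X) b = app (\<sigma> X) b" by simp
    also have "\<dots> = act X (app (\<tau> X) b) m" using X b by (simp add: \<sigma>_def)
    finally show ?thesis by simp
  qed
  \<comment> \<open>F sends the map from \<open>Reg\<close> to \<open>One\<close> to a surjection
    onto a singleton, so F has an element at \<open>Reg\<close> whose image under \<tau> can be
    taken.\<close>
  have "epi_in (Set_cat U) (fmor F (to_One Reg))"
    using F(2) to_One_Reg_epi unfolding preserves_epis_def by blast
  moreover have "fmor F (to_One Reg) \<in> Hom (Set_cat U) (fob F Reg) (fob F One)"
    using functor_Hom[OF F(1) to_One[OF Reg_Ob]] .
  ultimately obtain b where b: "b \<in> fob F Reg" using Set_epi_surj F(3) by blast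
  have "app (\<tau> Reg) b \<in> fixed_points M Reg"
    using Set.app_in[OF \<tau>_Hom[OF Reg_Ob] b] shifted[OF _ Reg_Ob b] by (simp add: fixed_points_def)
  then show ?thesis by (rule fixed_points_Reg)
qed

section \<open>The equivalences\<close>

lemma right_absorbing_iff_preserves_epis:
  "(\<exists>r. right_absorbing M r) \<longleftrightarrow> preserves_epis (PSh M U) (Set_cat U) (Gamma M)"
  using Gamma_preserves_epis preserves_epis_right_absorbing by blast

lemma right_absorbing_iff_right_adjoint:
  "(\<exists>r. right_absorbing M r) \<longleftrightarrow> has_right_adjoint (PSh M U) (Set_cat U) (Gamma M)"
proof
  assume "has_right_adjoint (PSh M U) (Set_cat U) (Gamma M)"
  then obtain G \<eta> \<epsilon> where "adjunction (PSh M U) (Set_cat U) (Gamma M) G \<eta> \<epsilon>"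
    unfolding has_right_adjoint_def by blast
  from preserves_epis_right_absorbing[OF left_adjoint_preserves_epis[OF this is_category_PSh is_category_Set]]
  show "\<exists>r. right_absorbing M r" .
qed (use Gamma_right_adjoint in blast)

lemma right_absorbing_iff_local:
  "(\<exists>r. right_absorbing M r) \<longleftrightarrow> local_geom (PSh M U) (Set_cat U) (global_sections M U)"
  using right_absorbing_iff_right_adjoint global_sections_geometric
  by (simp add: local_geom_def global_sections_def)

lemma right_absorbing_iff_alpha_epi: "(\<exists>r. right_absorbing M r) \<longleftrightarrow>
    epi_in (functor_category (PSh M U) (Set_cat U)) (Gamma M, alpha M U, Comps M)"
  using right_absorbing_alpha_epi alpha_epi_right_absorbing by blast

text \<open>Connectedness and the left adjoint C are present for every monoid, so only the condition
  on \<alpha> carries information.\<close>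

lemma right_absorbing_iff_punctually_locally_connected:
  "(\<exists>r. right_absorbing M r) \<longleftrightarrow> punctually_locally_connected M U"
  unfolding punctually_locally_connected_def right_absorbing_iff_alpha_epi
  using global_sections_connected global_sections_essential by blast

text \<open>Locality alone already gives r back. Conversely, hyperconnectedness and essentiality
  hold for every monoid, while locality and the preservation of products by C are derived from
  r.\<close>

lemma right_absorbing_iff_precohesive:
  "(\<exists>r. right_absorbing M r) \<longleftrightarrow> precohesive_geom (PSh M U) (Set_cat U) (global_sections M U)"
proof
  assume r: "\<exists>r. right_absorbing M r"
  then have "preserves_finite_products (PSh M U) (Set_cat U) (Comps M)"
    using Comps_preserves_finite_products by blast
  then show "precohesive_geom (PSh M U) (Set_cat U) (global_sections M U)"
    using r global_sections_hyperconnected global_sections_essential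
    unfolding precohesive_geom_def right_absorbing_iff_local by blast
qed (simp add: precohesive_geom_def right_absorbing_iff_local)

lemma right_absorbing_iff_projective: "(\<exists>r. right_absorbing M r) \<longleftrightarrow>
    (\<exists>T. terminal_in (PSh M U) T \<and> projective_in (PSh M U) T)"
  using One_terminal One_projective projective_terminal_right_absorbing by blast

end

theorem theorem2p24:
  fixes M :: "('m, 'z) monoid_scheme" and U :: "'u set"
  assumes "monoid M" and "universe_for M U"
  shows
   "((\<exists>r. right_absorbing M r) \<longleftrightarrow> preserves_epis (PSh M U) (Set_cat U) (Gamma M)) \<and>
    ((\<exists>r. right_absorbing M r) \<longleftrightarrow> (\<exists>T. terminal_in (PSh M U) T \<and> projective_in (PSh M U) T)) \<and>
    ((\<exists>r. right_absorbing M r) \<longleftrightarrow> has_right_adjoint (PSh M U) (Set_cat U) (Gamma M)) \<and>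
    ((\<exists>r. right_absorbing M r) \<longleftrightarrow> local_geom (PSh M U) (Set_cat U) (global_sections M U)) \<and>
    ((\<exists>r. right_absorbing M r) \<longleftrightarrow>
       epi_in (functor_category (PSh M U) (Set_cat U)) (Gamma M, alpha M U, Comps M)) \<and>
    ((\<exists>r. right_absorbing M r) \<longleftrightarrow> punctually_locally_connected M U) \<and>
    ((\<exists>r. right_absorbing M r) \<longleftrightarrow> precohesive_geom (PSh M U) (Set_cat U) (global_sections M U)) \<and>
    ((\<exists>r. right_absorbing M r) \<longleftrightarrow> full_functor (PSh M U) (Set_cat U) (Comps M)) \<and>
    ((\<exists>r. right_absorbing M r) \<longleftrightarrow> reflects_initial (PSh M U) (Set_cat U) (Gamma M)) \<and>
    ((\<exists>r. right_absorbing M r) \<longleftrightarrow>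
       (\<forall>X\<in>Ob (PSh M U). pts X \<noteq> {} \<longrightarrow> fixed_points M X \<noteq> {})) \<and>
    ((\<exists>r. right_absorbing M r) \<longleftrightarrow> (\<exists>p. initial_in (points_category M U) p))"
proof -
  interpret mset_universe M U
    using assms by (intro mset_universe.intro mset_universe_axioms.intro)
  have full: "(\<exists>r. right_absorbing M r) \<longleftrightarrow> full_functor (PSh M U) (Set_cat U) (Comps M)"
    using Comps_full full_right_absorbing by blast
  have reflects: "(\<exists>r. right_absorbing M r) \<longleftrightarrow> reflects_initial (PSh M U) (Set_cat U) (Gamma M)"
    using right_absorbing_iff_nonempty_fixed_points reflects_initial_Gamma_iff by simp
  have point: "(\<exists>r. right_absorbing M r) \<longleftrightarrow> (\<exists>p. initial_in (points_category M U) p)"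
    using right_absorbing_initial_point initial_point_right_absorbing by blast
  show ?thesis
    by (intro conjI right_absorbing_iff_preserves_epis right_absorbing_iff_projective
        right_absorbing_iff_right_adjoint right_absorbing_iff_local right_absorbing_iff_alpha_epi
        right_absorbing_iff_punctually_locally_connected right_absorbing_iff_precohesive full reflects
        right_absorbing_iff_nonempty_fixed_points point)
qed

end
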